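(* Let $a_1,a_2,a_3$ be pairwise coprime positive integers and let $\rho:\pi_1\Sigma(a_1,a_2,a_3)\to SL(2;\mathbb{C})$ be an irreducible representation of the fundamental group of the Brieskorn homology 3-sphere $\Sigma(a_1,a_2,a_3)$. If $\rho$ is not conjugate in $SL(2;\mathbb{C})$ to a representation with image in $SU(2)$, then $\rho$ is conjugate in $SL(2;\mathbb{C})$ to a representation with image in $SL(2;\mathbb{R})$ which is induced by a homomorphism $f:\Gamma(a_1,a_2,a_3)\to PSL(2;\mathbb{R})$ from the orbifold fundamental group of the base orbifold.
   Context: $\Sigma(a_1,a_2,a_3)=\{(z_1,z_2,z_3)\in\mathbb{C}^3 : z_1^{a_1}+z_2^{a_2}+z_3^{a_3}=0,\ |z_1|^2+|z_2|^2+|z_3|^2=1\}$. It is a Seifert fibered space over the orbifold $S^2(a_1,a_2,a_3)$ (the sphere with three cone points), whose orbifold fundamental group is $\Gamma(a_1,a_2,a_3)=\langle x,y,z\mid x^{a_1}=y^{a_2}=z^{a_3}=xyz=1\rangle$. Put $a=a_1a_2a_3$ and choose integers $b,b_1,b_2,b_3$ with $a(b+b_1/a_1+b_2/a_2+b_3/a_3)=1$. Then $\pi_1\Sigma(a_1,a_2,a_3)=\langle x,y,z,h\mid h\text{ central},\ x^{a_1}=h^{-b_1},\ y^{a_2}=h^{-b_2},\ z^{a_3}=h^{-b_3},\ xyz=h^{b}\rangle$. $\widetilde{PSL}(2;\mathbb{R})$ is the universal cover of $PSL(2;\mathbb{R})=SL(2;\mathbb{R})/\{\pm I\}$, acting on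 $\mathbb{R}$, the universal cover of $\mathbb{R}P^1=\mathbb{R}/\mathbb{Z}$. Its center is $\langle \mathrm{sh}(1)\rangle\cong\mathbb{Z}$, where $\mathrm{sh}(r):t\mapsto t+r$. The projection $\widetilde{PSL}(2;\mathbb{R})\to SL(2;\mathbb{R})$ has kernel $\langle\mathrm{sh}(2)\rangle$ and sends $\mathrm{sh}(1)$ to $-I$. Meaning of "induced by $f$". Given $f:\Gamma(a_1,a_2,a_3)\to PSL(2;\mathbb{R})$, pull back the central extension $0\to\mathbb{Z}\to\widetilde{PSL}(2;\mathbb{R})\to PSL(2;\mathbb{R})\to 1$ along $f$ to obtain a central extension $\widetilde{\Gamma}(a_1,a_2,a_3)$ of $\Gamma(a_1,a_2,a_3)$ by $\mathbb{Z}=\langle h\rangle$ and a homomorphism $\widetilde\Gamma(a_1,a_2,a_3)\to\widetilde{PSL}(2;\mathbb{R})$ with $h\mapsto\mathrm{sh}(1)$. The group $\widetilde\Gamma(a_1,a_2,a_3)$ has a presentation $\langle x,y,z,h\mid h\text{ central},\ x^{a_1}=h^{-\beta_1},\ y^{a_2}=h^{-\beta_2},\ z^{a_3}=h^{-\beta_3},\ xyz=h^{\beta}\rangle$ for some integers $\beta,\beta_i$, and is the fundamental group of the Seifert fibered space $\overline M=M(0;(1,\beta),(a_1,\beta_1),(a_2,\beta_2),(a_3,\beta_3))$, whose euler number is $e(\overline M)=-(\beta+\beta_1/a_1+\beta_2/a_2+\beta_3/a_3)$. Composing with the projection to $SL(2;\mathbb{R})$ gives $\overline\rho:\pi_1\overline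 M\to SL(2;\mathbb{R})$. When $e(\overline M)\ne 0$, $H_1(\overline M;\mathbb{Z})\cong\mathbb{Z}/a|e(\overline M)|$ and $\Sigma(a_1,a_2,a_3)$ is the universal abelian cover of $\overline M$, of degree $a|e(\overline M)|$. Let $p:\pi_1\Sigma(a_1,a_2,a_3)\to\pi_1\overline M$ be the induced homomorphism (injective, with image the commutator subgroup of $\pi_1\overline M$, sending $h$ to $h^{a|e(\overline M)|}$). The $SL(2;\mathbb{R})$-representation of $\pi_1\Sigma(a_1,a_2,a_3)$ induced by $f$ is $p^*\overline\rho=\overline\rho\circ p$. *)

theory Defs
  imports "HOL-Analysis.Analysis" "HOL-Algebra.Algebra"
begin

section \<open>Group presentations\<close>

text \<open>A letter \<open>(g, True)\<close> stands for the generator \<open>g\<close>, and \<open>(g, False)\<close> for its inverse.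
  A relation \<open>u = v\<close> is a pair of words.  The group presented by a set \<open>R\<close> of relations is the set
  of words modulo the congruence generated by \<open>R\<close> and by the cancellations of a letter against
  its inverse.\<close>

type_synonym 'g word = "('g \<times> bool) list"

inductive pres_eq :: "('g word \<times> 'g word) set \<Rightarrow> 'g word \<Rightarrow> 'g word \<Rightarrow> bool"
  for R where
  rel: "(u, v) \<in> R \<Longrightarrow> pres_eq R u v"
| cancel: "pres_eq R [(g, e), (g, \<not> e)] []"
| refl: "pres_eq R u u"
| sym: "pres_eq R u v \<Longrightarrow> pres_eq R v u"
| trans: "pres_eq R u v \<Longrightarrow> pres_eq R v w \<Longrightarrow> pres_eq R u w"
| append: "pres_eq R u u' \<Longrightarrow> pres_eq R v v' \<Longrightarrow> pres_eq R (u @ v) (u' @ v')"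

definition word_class :: "('g word \<times> 'g word) set \<Rightarrow> 'g word \<Rightarrow> 'g word set" where
  "word_class R u = {v. pres_eq R u v}"

definition presented_group :: "('g word \<times> 'g word) set \<Rightarrow> 'g word set monoid" where
  "presented_group R =
     \<lparr>carrier = range (word_class R),
      mult = (\<lambda>A B. \<Union>u\<in>A. \<Union>v\<in>B. word_class R (u @ v)),
      one = word_class R []\<rparr>"

definition letter :: "'g \<Rightarrow> 'g word" where
  "letter g = [(g, True)]"

definition letter_pow :: "'g \<Rightarrow> int \<Rightarrow> 'g word" where
  "letter_pow g n = replicate (nat \<bar>n\<bar>) (g, n \<ge> 0)"

lemma word_class_eq_iff: "word_class R u = word_class R v \<longleftrightarrow> pres_eq R u v"
  unfolding word_class_def by (auto intro: pres_eq.refl pres_eq.sym pres_eq.trans)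

lemma presented_mult:
  "word_class R u \<otimes>\<^bsub>presented_group R\<^esub> word_class R v = word_class R (u @ v)"
proof -
  have *: "word_class R (u' @ v') = word_class R (u @ v)"
    if "u' \<in> word_class R u" "v' \<in> word_class R v" for u' v'
    unfolding word_class_eq_iff
    using that by (intro pres_eq.append pres_eq.sym[of R u] pres_eq.sym[of R v])
      (simp_all add: word_class_def)
  have "u \<in> word_class R u" "v \<in> word_class R v"
    by (simp_all add: word_class_def pres_eq.refl)
  then have "(\<Union>u'\<in>word_class R u. \<Union>v'\<in>word_class R v. word_class R (u' @ v')) = word_class R (u @ v)"
    using * by blast
  then show ?thesis
    by (simp add: presented_group_def)
qed

lemma carrier_presented_group: "carrier (presented_group R) = range (word_class R)"
  and one_presented_group: "\<one>\<^bsub>presented_group R\<^esub> = word_class R []"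
  by (simp_all add: presented_group_def)

lemma presented_left_inverse: "\<exists>v. pres_eq R (v @ u) []"
proof (induction u)
  case Nil
  show ?case by (metis append_Nil pres_eq.refl)
next
  case (Cons l u)
  obtain g e where l: "l = (g, e)" by (cases l)
  obtain v where v: "pres_eq R (v @ u) []" using Cons by blast
  have "pres_eq R ([(g, \<not> e)] @ [(g, e)]) []"
    using pres_eq.cancel[of R g "\<not> e"] by simp
  then have "pres_eq R (v @ ([(g, \<not> e)] @ [(g, e)]) @ u) (v @ [] @ u)"
    by (intro pres_eq.append pres_eq.refl)
  then have "pres_eq R (v @ ([(g, \<not> e)] @ [(g, e)]) @ u) []"
    using v pres_eq.trans by fastforce
  then have "pres_eq R ((v @ [(g, \<not> e)]) @ l # u) []"
    using l by simp
  then show ?case by blast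
qed

lemma group_presented_group: "group (presented_group R)"
proof (rule groupI)
  show "\<exists>y\<in>carrier (presented_group R). y \<otimes>\<^bsub>presented_group R\<^esub> x = \<one>\<^bsub>presented_group R\<^esub>"
    if x_in: "x \<in> carrier (presented_group R)" for x
  proof -
    obtain u where x: "x = word_class R u"
      using x_in by (auto simp: carrier_presented_group)
    obtain v where "pres_eq R (v @ u) []" using presented_left_inverse by blast
    then have "word_class R v \<otimes>\<^bsub>presented_group R\<^esub> x = \<one>\<^bsub>presented_group R\<^esub>"
      by (simp add: x presented_mult one_presented_group word_class_eq_iff)
    then show ?thesis by (auto simp: carrier_presented_group)
  qed
qed (auto simp: carrier_presented_group one_presented_group presented_mult)


section \<open>Triangle groups and Seifert groups\<close>

datatype triangle_gen = TX | TY | TZ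

definition triangle_rels ::
  "nat \<Rightarrow> nat \<Rightarrow> nat \<Rightarrow> (triangle_gen word \<times> triangle_gen word) set" where
  "triangle_rels a1 a2 a3 =
     {(letter_pow TX (int a1), []), (letter_pow TY (int a2), []), (letter_pow TZ (int a3), []),
      (letter TX @ letter TY @ letter TZ, [])}"

definition triangle_group :: "nat \<Rightarrow> nat \<Rightarrow> nat \<Rightarrow> triangle_gen word set monoid" where
  "triangle_group a1 a2 a3 = presented_group (triangle_rels a1 a2 a3)"

definition triangle_gen_class :: "nat \<Rightarrow> nat \<Rightarrow> nat \<Rightarrow> triangle_gen \<Rightarrow> triangle_gen word set" where
  "triangle_gen_class a1 a2 a3 g = word_class (triangle_rels a1 a2 a3) (letter g)"

datatype seifert_gen = SX | SY | SZ | SH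

definition seifert_rels ::
  "nat \<Rightarrow> nat \<Rightarrow> nat \<Rightarrow> int \<Rightarrow> int \<Rightarrow> int \<Rightarrow> int \<Rightarrow> (seifert_gen word \<times> seifert_gen word) set" where
  "seifert_rels a1 a2 a3 b b1 b2 b3 =
     {(letter SH @ letter SX, letter SX @ letter SH),
      (letter SH @ letter SY, letter SY @ letter SH),
      (letter SH @ letter SZ, letter SZ @ letter SH),
      (letter_pow SX (int a1), letter_pow SH (- b1)),
      (letter_pow SY (int a2), letter_pow SH (- b2)),
      (letter_pow SZ (int a3), letter_pow SH (- b3)),
      (letter SX @ letter SY @ letter SZ, letter_pow SH b)}"

text \<open>The group presented by these relations is the fundamental group of the Seifert fibered space
  \<open>M(0; (1,b), (a1,b1), (a2,b2), (a3,b3))\<close>, with \<open>SH\<close> the class of the regular fibre.\<close>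

definition seifert_group ::
  "nat \<Rightarrow> nat \<Rightarrow> nat \<Rightarrow> int \<Rightarrow> int \<Rightarrow> int \<Rightarrow> int \<Rightarrow> seifert_gen word set monoid" where
  "seifert_group a1 a2 a3 b b1 b2 b3 = presented_group (seifert_rels a1 a2 a3 b b1 b2 b3)"

definition seifert_gen_class ::
  "nat \<Rightarrow> nat \<Rightarrow> nat \<Rightarrow> int \<Rightarrow> int \<Rightarrow> int \<Rightarrow> int \<Rightarrow> seifert_gen \<Rightarrow> seifert_gen word set" where
  "seifert_gen_class a1 a2 a3 b b1 b2 b3 g =
     word_class (seifert_rels a1 a2 a3 b b1 b2 b3) (letter g)"

definition euler_number :: "nat \<Rightarrow> nat \<Rightarrow> nat \<Rightarrow> int \<Rightarrow> int \<Rightarrow> int \<Rightarrow> int \<Rightarrow> rat" where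
  "euler_number a1 a2 a3 b b1 b2 b3 =
     - (of_int b + of_int b1 / of_nat a1 + of_int b2 / of_nat a2 + of_int b3 / of_nat a3)"

text \<open>The integers \<open>b, b1, b2, b3\<close> are Seifert invariants of the Brieskorn sphere
  \<open>\<Sigma>(a1, a2, a3)\<close>; its fundamental group is then \<open>seifert_group a1 a2 a3 b b1 b2 b3\<close>.\<close>

definition brieskorn_invariants ::
  "nat \<Rightarrow> nat \<Rightarrow> nat \<Rightarrow> int \<Rightarrow> int \<Rightarrow> int \<Rightarrow> int \<Rightarrow> bool" where
  "brieskorn_invariants a1 a2 a3 b b1 b2 b3 \<longleftrightarrow>
     (of_nat (a1 * a2 * a3) :: rat) *
       (of_int b + of_int b1 / of_nat a1 + of_int b2 / of_nat a2 + of_int b3 / of_nat a3) = 1"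


section \<open>Matrix groups\<close>

definition SL2 :: "('a::field ^ 2 ^ 2) monoid" where
  "SL2 = \<lparr>carrier = {A. det A = 1}, mult = (**), one = mat 1\<rparr>"

definition PSL2R :: "(real ^ 2 ^ 2) set monoid" where
  "PSL2R = SL2 Mod {mat 1, - mat 1}"

definition SU2 :: "(complex ^ 2 ^ 2) set" where
  "SU2 = {A. det A = 1 \<and> A ** (\<chi> i j. cnj (A $ j $ i)) = mat 1}"

definition complex_mat :: "real ^ 2 ^ 2 \<Rightarrow> complex ^ 2 ^ 2" where
  "complex_mat A = (\<chi> i j. complex_of_real (A $ i $ j))"

definition irreducible_rep :: "('g, 'm) monoid_scheme \<Rightarrow> ('g \<Rightarrow> complex ^ 2 ^ 2) \<Rightarrow> bool" where
  "irreducible_rep G \<rho> \<longleftrightarrow>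
     (\<forall>V. vec.subspace V \<and> (\<forall>g\<in>carrier G. \<forall>v\<in>V. \<rho> g *v v \<in> V) \<longrightarrow> V = {0} \<or> V = UNIV)"

definition conj_rep :: "complex ^ 2 ^ 2 \<Rightarrow> ('g \<Rightarrow> complex ^ 2 ^ 2) \<Rightarrow> 'g \<Rightarrow> complex ^ 2 ^ 2" where
  "conj_rep P \<rho> g = P ** \<rho> g ** matrix_inv P"

lemma group_SL2: "group (SL2 :: ('a::field ^ 2 ^ 2) monoid)"
proof (rule groupI)
  fix A :: "'a ^ 2 ^ 2"
  assume "A \<in> carrier SL2"
  then have A: "det A = 1" by (simp add: SL2_def)
  then have "invertible A" by (simp add: invertible_det_nz)
  then obtain B where B: "A ** B = mat 1" "B ** A = mat 1" by (auto simp: invertible_def)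
  have "det B = 1" using arg_cong[OF B(1), of det] A by (simp add: det_mul)
  then show "\<exists>B\<in>carrier SL2. B \<otimes>\<^bsub>SL2\<^esub> A = \<one>\<^bsub>SL2\<^esub>" using B by (auto simp: SL2_def)
qed (auto simp: SL2_def det_mul matrix_mul_assoc)

lemma normal_pm1: "{mat 1, - mat 1} \<lhd> (SL2 :: (real ^ 2 ^ 2) monoid)"
proof -
  interpret group "SL2 :: (real ^ 2 ^ 2) monoid" by (rule group_SL2)
  have m: "(- mat 1 :: real ^ 2 ^ 2) ** A = - A" "A ** (- mat 1 :: real ^ 2 ^ 2) = - A" for A
    by (simp_all add: vec_eq_iff matrix_matrix_mult_def mat_def forall_2 sum_2)
  have d: "det (- mat 1 :: real ^ 2 ^ 2) = 1" by (simp add: det_2 mat_def)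
  have "subgroup {mat 1, - mat 1} (SL2 :: (real ^ 2 ^ 2) monoid)"
  proof (rule subgroupI)
    show "inv\<^bsub>SL2\<^esub> A \<in> {mat 1, - mat 1}"
      if "A \<in> {mat 1, - mat 1 :: real ^ 2 ^ 2}" for A
    proof -
      have "A \<in> carrier SL2" "A ** A = mat 1" using that by (auto simp: SL2_def d m)
      then have "inv\<^bsub>SL2\<^esub> A = A"
        using inv_equality[of A A] by (simp add: SL2_def)
      then show ?thesis using that by simp
    qed
  qed (auto simp: SL2_def d m)
  then show ?thesis
    unfolding normal_inv_iff
  proof (intro conjI ballI)
    fix A B :: "real ^ 2 ^ 2"
    assume A: "A \<in> carrier SL2" and B: "B \<in> {mat 1, - mat 1}"
    have "A \<otimes>\<^bsub>SL2\<^esub> B = B \<otimes>\<^bsub>SL2\<^esub> A" using B by (auto simp: SL2_def m)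
    moreover have "B \<in> carrier SL2" using B by (auto simp: SL2_def d)
    ultimately have "A \<otimes>\<^bsub>SL2\<^esub> B \<otimes>\<^bsub>SL2\<^esub> inv\<^bsub>SL2\<^esub> A = B"
      using A by (simp add: m_assoc)
    then show "A \<otimes>\<^bsub>SL2\<^esub> B \<otimes>\<^bsub>SL2\<^esub> inv\<^bsub>SL2\<^esub> A \<in> {mat 1, - mat 1}" using B by simp
  qed
qed


section \<open>The universal cover of PSL(2;R)\<close>

text \<open>The covering \<open>\<real> \<rightarrow> \<real>P\<^sup>1 = \<real>/\<int>\<close> sends \<open>t\<close> to the line spanned by \<open>direction t\<close>.  The universal
  cover of \<open>PSL(2;\<real>)\<close> is realised by its action on \<open>\<real>\<close>: its elements are the lifts to \<open>\<real>\<close> of the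
  projective transformations of \<open>\<real>P\<^sup>1\<close> given by matrices of determinant 1.\<close>

definition direction :: "real \<Rightarrow> real ^ 2" where
  "direction t = vector [cos (pi * t), sin (pi * t)]"

definition lifts_projective :: "(real \<Rightarrow> real) \<Rightarrow> real ^ 2 ^ 2 \<Rightarrow> bool" where
  "lifts_projective g A \<longleftrightarrow> continuous_on UNIV g \<and>
     (\<forall>t. \<exists>c. c \<noteq> 0 \<and> A *v direction t = c *\<^sub>R direction (g t))"

definition PSL2R_cover :: "(real \<Rightarrow> real) monoid" where
  "PSL2R_cover = \<lparr>carrier = {g. \<exists>A\<in>carrier SL2. lifts_projective g A}, mult = (\<circ>), one = id\<rparr>"

definition sh :: "real \<Rightarrow> real \<Rightarrow> real" where
  "sh r = (\<lambda>t. t + r)"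

text \<open>The set of all matrices covered by \<open>g\<close> is a coset \<open>{A, - A}\<close>.\<close>

definition cover_to_PSL2R :: "(real \<Rightarrow> real) \<Rightarrow> (real ^ 2 ^ 2) set" where
  "cover_to_PSL2R g = {A \<in> carrier SL2. lifts_projective g A}"

text \<open>Since \<open>direction\<close> has period 2, its values run over the circle of oriented lines, and the
  matrix in \<open>SL(2;\<real>)\<close> below \<open>g\<close> is the one that acts on oriented lines as \<open>g\<close> does.\<close>

definition cover_to_SL2R :: "(real \<Rightarrow> real) \<Rightarrow> real ^ 2 ^ 2" where
  "cover_to_SL2R g =
     (THE A. A \<in> carrier SL2 \<and> (\<forall>t. \<exists>c>0. A *v direction t = c *\<^sub>R direction (g t)))"

lemma cover_to_SL2R_unique:
  assumes "\<forall>t. \<exists>c>0. A *v direction t = c *\<^sub>R direction (g t)" and "A \<in> carrier SL2"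
    and "\<forall>t. \<exists>c>0. B *v direction t = c *\<^sub>R direction (g t)" and "B \<in> carrier SL2"
  shows "A = B"
proof -
  have "\<exists>r>0. A *v direction t = r *\<^sub>R (B *v direction t)" for t
  proof -
    obtain c d where "c > 0" "A *v direction t = c *\<^sub>R direction (g t)"
      "d > 0" "B *v direction t = d *\<^sub>R direction (g t)" using assms by meson
    then show ?thesis by (intro exI[of _ "c / d"]) simp
  qed
  note ex = this
  have e0: "direction 0 = vector [1, 0]" and e1: "direction (1/2) = vector [0, 1]"
    and em: "direction (1/4) = (sqrt 2 / 2) *\<^sub>R vector [1, 1]"
    by (simp_all add: direction_def vec_eq_iff forall_2 cos_45 sin_45)
  obtain r where r: "r > 0" "A *v direction 0 = r *\<^sub>R (B *v direction 0)" using ex by blast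
  obtain s where s: "s > 0" "A *v direction (1/2) = s *\<^sub>R (B *v direction (1/2))" using ex by blast
  obtain m where m: "m > 0" "A *v direction (1/4) = m *\<^sub>R (B *v direction (1/4))" using ex by blast
  have dA: "A$1$1 * A$2$2 - A$1$2 * A$2$1 = 1" and dB: "B$1$1 * B$2$2 - B$1$2 * B$2$1 = 1"
    using assms by (simp_all add: SL2_def det_2)
  have 1: "A$1$1 = r * B$1$1" "A$2$1 = r * B$2$1"
    using r(2) by (simp_all add: e0 vec_eq_iff forall_2 matrix_vector_mult_def sum_2)
  have 2: "A$1$2 = s * B$1$2" "A$2$2 = s * B$2$2"
    using s(2) by (simp_all add: e1 vec_eq_iff forall_2 matrix_vector_mult_def sum_2)
  have "sqrt 2 / 2 * (A$1$1 + A$1$2) = sqrt 2 / 2 * (m * (B$1$1 + B$1$2))"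
    "sqrt 2 / 2 * (A$2$1 + A$2$2) = sqrt 2 / 2 * (m * (B$2$1 + B$2$2))"
    using m(2) by (simp_all add: em vec_eq_iff forall_2 matrix_vector_mult_def sum_2 algebra_simps)
  then have 3: "A$1$1 + A$1$2 = m * (B$1$1 + B$1$2)" "A$2$1 + A$2$2 = m * (B$2$1 + B$2$2)"
    by simp_all
  have l1: "(r - m) * B$1$1 + (s - m) * B$1$2 = 0" and l2: "(r - m) * B$2$1 + (s - m) * B$2$2 = 0"
    using 1 2 3 by (simp_all add: algebra_simps)
  have "(r - m) * (B$1$1 * B$2$2 - B$1$2 * B$2$1) =
      B$2$2 * ((r - m) * B$1$1 + (s - m) * B$1$2) - B$1$2 * ((r - m) * B$2$1 + (s - m) * B$2$2)"
    by (simp add: algebra_simps)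
  then have rm: "r = m" using dB l1 l2 by simp
  have "(s - m) * (B$1$1 * B$2$2 - B$1$2 * B$2$1) =
      B$1$1 * ((r - m) * B$2$1 + (s - m) * B$2$2) - B$2$1 * ((r - m) * B$1$1 + (s - m) * B$1$2)"
    by (simp add: algebra_simps)
  then have sm: "s = m" using dB l1 l2 by simp
  have "m * m * (B$1$1 * B$2$2 - B$1$2 * B$2$1) = 1"
    using dA unfolding 1 2 rm sm by (simp add: algebra_simps)
  then have "m\<^sup>2 = 1" using dB by (simp add: power2_eq_square)
  then have "m = 1" using m(1) by (simp add: power2_eq_1_iff)
  then show ?thesis using 1 2 rm sm by (simp add: vec_eq_iff forall_2)
qed

lemma cover_to_SL2R_sh_1: "cover_to_SL2R (sh 1) = - mat 1"
proof -
  have *: "- mat 1 \<in> carrier (SL2 :: (real ^ 2 ^ 2) monoid)"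
    by (simp add: SL2_def det_2 mat_def)
  have "(- mat 1) *v direction t = 1 *\<^sub>R direction (sh 1 t)" for t
    by (simp add: direction_def sh_def vec_eq_iff forall_2 matrix_vector_mult_def sum_2 mat_def
        distrib_left)
  then have **: "\<forall>t. \<exists>c>0. (- mat 1) *v direction t = c *\<^sub>R direction (sh 1 t)"
    by (metis zero_less_one)
  show ?thesis unfolding cover_to_SL2R_def
    by (rule the_equality) (use * ** cover_to_SL2R_unique in blast)+
qed


section \<open>Representations induced by homomorphisms to PSL(2;R)\<close>

text \<open>Pullback of the central extension \<open>0 \<rightarrow> \<int> \<rightarrow> PSL2R_cover \<rightarrow> PSL2R \<rightarrow> 1\<close> along \<open>f\<close>.\<close>

definition pullback_extension ::
  "('g, 'm) monoid_scheme \<Rightarrow> ('g \<Rightarrow> (real ^ 2 ^ 2) set) \<Rightarrow> ('g \<times> (real \<Rightarrow> real)) monoid" where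
  "pullback_extension G f = (G \<times>\<times> PSL2R_cover)
     \<lparr>carrier := {(\<gamma>, g). \<gamma> \<in> carrier G \<and> g \<in> carrier PSL2R_cover \<and> f \<gamma> = cover_to_PSL2R g}\<rparr>"

definition pullback_central :: "('g, 'm) monoid_scheme \<Rightarrow> 'g \<times> (real \<Rightarrow> real)" where
  "pullback_central G = (\<one>\<^bsub>G\<^esub>, sh 1)"

text \<open>\<open>\<psi>\<close> is a presentation of the pullback extension of the triangle group, in which \<open>h\<close> is the
  central generator and \<open>x, y, z\<close> lie over the generators \<open>x, y, z\<close> of the triangle group.\<close>

definition seifert_presentation ::
  "nat \<Rightarrow> nat \<Rightarrow> nat \<Rightarrow> (triangle_gen word set \<Rightarrow> (real ^ 2 ^ 2) set) \<Rightarrow>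
   int \<Rightarrow> int \<Rightarrow> int \<Rightarrow> int \<Rightarrow>
   (seifert_gen word set \<Rightarrow> triangle_gen word set \<times> (real \<Rightarrow> real)) \<Rightarrow> bool" where
  "seifert_presentation a1 a2 a3 f \<beta> \<beta>1 \<beta>2 \<beta>3 \<psi> \<longleftrightarrow>
     \<psi> \<in> iso (seifert_group a1 a2 a3 \<beta> \<beta>1 \<beta>2 \<beta>3) (pullback_extension (triangle_group a1 a2 a3) f) \<and>
     \<psi> (seifert_gen_class a1 a2 a3 \<beta> \<beta>1 \<beta>2 \<beta>3 SH) = pullback_central (triangle_group a1 a2 a3) \<and>
     fst (\<psi> (seifert_gen_class a1 a2 a3 \<beta> \<beta>1 \<beta>2 \<beta>3 SX)) = triangle_gen_class a1 a2 a3 TX \<and>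
     fst (\<psi> (seifert_gen_class a1 a2 a3 \<beta> \<beta>1 \<beta>2 \<beta>3 SY)) = triangle_gen_class a1 a2 a3 TY \<and>
     fst (\<psi> (seifert_gen_class a1 a2 a3 \<beta> \<beta>1 \<beta>2 \<beta>3 SZ)) = triangle_gen_class a1 a2 a3 TZ"

text \<open>\<open>p\<close> is the homomorphism induced by the universal abelian cover \<open>\<Sigma>(a1, a2, a3) \<rightarrow> M\<close>, where
  \<open>M\<close> has fundamental group \<open>pullback_extension (triangle_group a1 a2 a3) f\<close> and Euler number \<open>e\<close>:
  it identifies \<open>\<pi>\<^sub>1\<Sigma>\<close> with the commutator subgroup and sends \<open>h\<close> to the power of \<open>h\<close> given by the
  degree \<open>a1 a2 a3 \<bar>e\<bar>\<close> (an integer) of the cover.\<close>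

definition abelian_cover_hom ::
  "nat \<Rightarrow> nat \<Rightarrow> nat \<Rightarrow> int \<Rightarrow> int \<Rightarrow> int \<Rightarrow> int \<Rightarrow>
   (triangle_gen word set \<Rightarrow> (real ^ 2 ^ 2) set) \<Rightarrow> rat \<Rightarrow>
   (seifert_gen word set \<Rightarrow> triangle_gen word set \<times> (real \<Rightarrow> real)) \<Rightarrow> bool" where
  "abelian_cover_hom a1 a2 a3 b b1 b2 b3 f e p \<longleftrightarrow>
     (let G = seifert_group a1 a2 a3 b b1 b2 b3;
          E = pullback_extension (triangle_group a1 a2 a3) f
      in p \<in> mon G E \<and>
         p ` carrier G = derived E (carrier E) \<and>
         (\<exists>d::nat. of_nat d = of_nat (a1 * a2 * a3) * \<bar>e\<bar> \<and>
            p (seifert_gen_class a1 a2 a3 b b1 b2 b3 SH)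
              = pullback_central (triangle_group a1 a2 a3) [^]\<^bsub>E\<^esub> d))"

definition induced_rep ::
  "nat \<Rightarrow> nat \<Rightarrow> nat \<Rightarrow> int \<Rightarrow> int \<Rightarrow> int \<Rightarrow> int \<Rightarrow>
   (triangle_gen word set \<Rightarrow> (real ^ 2 ^ 2) set) \<Rightarrow> (seifert_gen word set \<Rightarrow> real ^ 2 ^ 2) \<Rightarrow> bool" where
  "induced_rep a1 a2 a3 b b1 b2 b3 f \<sigma> \<longleftrightarrow>
     (\<exists>\<beta> \<beta>1 \<beta>2 \<beta>3 \<psi> p.
        seifert_presentation a1 a2 a3 f \<beta> \<beta>1 \<beta>2 \<beta>3 \<psi> \<and>
        euler_number a1 a2 a3 \<beta> \<beta>1 \<beta>2 \<beta>3 \<noteq> 0 \<and>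
        abelian_cover_hom a1 a2 a3 b b1 b2 b3 f (euler_number a1 a2 a3 \<beta> \<beta>1 \<beta>2 \<beta>3) p \<and>
        (\<forall>g\<in>carrier (seifert_group a1 a2 a3 b b1 b2 b3). \<sigma> g = cover_to_SL2R (snd (p g))))"

end

theory Submission
  imports Defs
begin

text \<open>
  Let \<open>G\<close> be the Seifert group of \<open>\<Sigma>(a1, a2, a3)\<close>, generated by \<open>x, y, h\<close>.  The proof has an
  algebraic half, which makes \<open>\<rho>\<close> real, and a topological half, which recognises a real
  representation as an induced one.

  \<^bold>\<open>Making \<open>\<rho>\<close> real.\<close>  By Schur's lemma \<open>\<rho> h = \<plusminus>1\<close> (\<open>irreducible_fibre\<close>), so the relations of \<open>G\<close> make
  \<open>\<rho> x\<close>, \<open>\<rho> y\<close> and \<open>\<rho> (x y)\<close> matrices of finite order modulo \<open>\<plusminus>1\<close>.  Their eigenvalues lie on the unit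
  circle, hence their traces are real.  A pair \<open>A, B\<close> of such matrices without a common eigenvector can
  be brought into the form \<open>A = diag(u, cnj u)\<close>, \<open>B = (p, q; r, cnj p)\<close> with \<open>q r\<close> real and nonzero; after
  conjugation by a positive diagonal matrix \<open>r = \<plusminus>cnj q\<close> according to the sign of \<open>q r\<close>.  One sign puts
  both matrices into \<open>SU(2)\<close>, the other into \<open>SU(1,1)\<close>, which the Cayley transform carries into
  \<open>SL(2;\<real>)\<close> (\<open>real_or_unitary_pair\<close>).  Since \<open>SU(2)\<close> is excluded, \<open>\<rho>\<close> is conjugate to some
  \<open>\<sigma> : G \<rightarrow> SL(2;\<real>)\<close>.

  \<^bold>\<open>Recognising \<open>\<sigma>\<close>.\<close>  Lift \<open>\<sigma> x, \<sigma> y, \<sigma> z\<close> to elements \<open>gx, gy, gz\<close> of the universal cover of \<open>PSL(2;\<real>)\<close>.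
  The relations of \<open>G\<close> hold for the lifts up to integer translations, which defines integers
  \<open>\<beta>, \<beta>1, \<beta>2, \<beta>3\<close> with \<open>gx^a1 = sh(-\<beta>1)\<close>, \<open>gy^a2 = sh(-\<beta>2)\<close>, \<open>gz^a3 = sh(-\<beta>3)\<close> and
  \<open>gx gy gz = sh(\<beta>)\<close>; they are Seifert invariants of the pullback extension \<open>E\<close> of the triangle group
  along the homomorphism \<open>f\<close> induced by \<open>\<sigma>\<close>.  Put \<open>d = a1 a2 a3 (\<beta> + \<beta>1/a1 + \<beta>2/a2 + \<beta>3/a3)\<close>.

  If \<open>d = 0\<close>, then \<open>a1\<close> divides \<open>\<beta>1\<close>, so that \<open>gx\<close> is of finite order up to a translation; the universal
  cover acts on the line by increasing maps and has no torsion, which forces \<open>\<sigma> x = \<plusminus>1\<close>, against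
  irreducibility.  If \<open>d < 0\<close>, conjugation by \<open>diag(\<i>, -\<i>)\<close>, which reflects the line, changes the sign of
  \<open>d\<close>; this is where the freedom of conjugating in \<open>SL(2;\<complex>)\<close> is needed, for a homomorphism \<open>G \<rightarrow> E\<close> over
  the identity of the triangle group that sends \<open>h\<close> to a positive power of the fibre exists only for
  \<open>d > 0\<close>.

  If \<open>d > 0\<close>, suitable translates of \<open>gx, gy, gz\<close> satisfy the relations of \<open>G\<close> with \<open>sh(d)\<close> in the role
  of \<open>h\<close>.  This gives a homomorphism \<open>p : G \<rightarrow> E\<close> over the identity of the triangle group.  It is
  injective because its kernel lies in \<open>\<langle>h\<rangle>\<close> (\<open>hom_over_identity_mono\<close>), and its image is the commutator
  subgroup because \<open>G\<close> is perfect and \<open>E\<close> is generated by the image and a central subgroup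
  (\<open>hom_over_identity_image\<close>).  Finally \<open>\<sigma>\<close> and the representation induced by \<open>f\<close> agree up to sign, and
  a sign character of the perfect group \<open>G\<close> is trivial (\<open>sign_ambiguity_trivial\<close>).
\<close>

section \<open>Homomorphisms out of presented groups\<close>

primrec word_val :: "('a, 'm) monoid_scheme \<Rightarrow> ('g \<Rightarrow> 'a) \<Rightarrow> 'g word \<Rightarrow> 'a" where
  "word_val G \<phi> [] = \<one>\<^bsub>G\<^esub>"
| "word_val G \<phi> (l # w) =
     (if snd l then \<phi> (fst l) else inv\<^bsub>G\<^esub> \<phi> (fst l)) \<otimes>\<^bsub>G\<^esub> word_val G \<phi> w"

context group
begin

lemma word_val_closed [simp]: "range \<phi> \<subseteq> carrier G \<Longrightarrow> word_val G \<phi> w \<in> carrier G"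
  by (induction w) (auto simp: image_subset_iff)

lemma word_val_append:
  assumes "range \<phi> \<subseteq> carrier G"
  shows "word_val G \<phi> (u @ v) = word_val G \<phi> u \<otimes> word_val G \<phi> v"
  using assms by (induction u) (auto simp: m_assoc image_subset_iff)

lemma word_val_letter [simp]: "range \<phi> \<subseteq> carrier G \<Longrightarrow> word_val G \<phi> (letter g) = \<phi> g"
  by (auto simp: letter_def image_subset_iff)

lemma word_val_replicate:
  assumes "range \<phi> \<subseteq> carrier G"
  shows "word_val G \<phi> (replicate n (g, e)) = (if e then \<phi> g else inv \<phi> g) [^] n"
proof (induction n)
  case (Suc n)
  have "\<phi> g \<in> carrier G" using assms by auto
  then show ?case using Suc nat_pow_Suc2[of "\<phi> g" n] nat_pow_Suc2[of "inv \<phi> g" n] by simp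
qed simp

lemma word_val_letter_pow [simp]:
  assumes "range \<phi> \<subseteq> carrier G"
  shows "word_val G \<phi> (letter_pow g n) = \<phi> g [^] n"
proof -
  have "\<phi> g \<in> carrier G" using assms by auto
  then show ?thesis
    unfolding letter_pow_def word_val_replicate[OF assms] int_pow_def2
    by (cases "n < 0") (simp_all add: int_pow_inv)
qed

lemma word_val_cong_pres_eq:
  assumes \<phi>: "range \<phi> \<subseteq> carrier G"
    and R: "\<And>u v. (u, v) \<in> R \<Longrightarrow> word_val G \<phi> u = word_val G \<phi> v"
    and "pres_eq R u v"
  shows "word_val G \<phi> u = word_val G \<phi> v"
  using assms(3)
proof induction
  case (rel u v)
  then show ?case by (rule R)
next
  case (cancel g e)
  have "\<phi> g \<in> carrier G" using \<phi> by auto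
  then show ?case by simp
qed (simp_all add: word_val_append[OF \<phi>])

end

lemma word_class_gen_in_carrier [simp]: "word_class R w \<in> carrier (presented_group R)"
  by (simp add: carrier_presented_group)

text \<open>The universal property of a presentation.  The values of the homomorphism on words that are not
  single letters are forced, so only the generators appear in the conclusion.\<close>
lemma (in group) presented_group_hom_exists:
  assumes \<phi>: "range \<phi> \<subseteq> carrier G"
    and R: "\<And>u v. (u, v) \<in> R \<Longrightarrow> word_val G \<phi> u = word_val G \<phi> v"
  obtains F where "F \<in> hom (presented_group R) G" "\<And>g. F (word_class R (letter g)) = \<phi> g"
proof
  \<comment> \<open>An element of the presented group is a class of words; by the preceding lemma every
    representative has the same value.\<close>
  define F where "F A = word_val G \<phi> (SOME w. w \<in> A)" for A
  have F: "F (word_class R w) = word_val G \<phi> w" for w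
  proof -
    have "w \<in> word_class R w" by (simp add: word_class_def pres_eq.refl)
    then have "(SOME v. v \<in> word_class R w) \<in> word_class R w" by (rule someI)
    then have "pres_eq R w (SOME v. v \<in> word_class R w)" by (simp add: word_class_def)
    then show ?thesis unfolding F_def using word_val_cong_pres_eq[OF \<phi> R] by metis
  qed
  show "F \<in> hom (presented_group R) G"
    by (rule homI) (auto simp: carrier_presented_group F presented_mult word_val_append[OF \<phi>] \<phi>)
  show "F (word_class R (letter g)) = \<phi> g" for g
    by (simp add: F \<phi>)
qed

text \<open>The class of a word is the product of the classes of its letters; this turns statements about
  words into computations in the presented group.\<close>
lemma presented_word_val:
  "word_val (presented_group R) (\<lambda>g. word_class R (letter g)) w = word_class R w"
proof -
  interpret P: group "presented_group R" by (rule group_presented_group)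
  show ?thesis
  proof (induction w)
    case Nil
    show ?case by (simp add: one_presented_group)
  next
    case (Cons l w)
    obtain g e where l: "l = (g, e)" by (cases l)
    have "word_class R [(g, False)] \<otimes>\<^bsub>presented_group R\<^esub> word_class R (letter g) = \<one>\<^bsub>presented_group R\<^esub>"
      using pres_eq.cancel[of R g False]
      by (simp add: presented_mult one_presented_group word_class_eq_iff letter_def)
    then have "inv\<^bsub>presented_group R\<^esub> word_class R (letter g) = word_class R [(g, False)]"
      by (rule P.inv_equality) simp_all
    then show ?case using Cons by (cases e) (simp_all add: l presented_mult letter_def)
  qed
qed

lemma presented_group_rel:
  assumes "(u, v) \<in> R"
  shows "word_val (presented_group R) (\<lambda>g. word_class R (letter g)) u =
    word_val (presented_group R) (\<lambda>g. word_class R (letter g)) v"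
  unfolding presented_word_val word_class_eq_iff using assms by (rule pres_eq.rel)

lemma presented_group_generated:
  assumes K: "subgroup K (presented_group R)" and gens: "\<And>g. word_class R (letter g) \<in> K"
  shows "K = carrier (presented_group R)"
proof
  interpret P: group "presented_group R" by (rule group_presented_group)
  show "K \<subseteq> carrier (presented_group R)" using K by (rule subgroup.subset)
  have "word_val (presented_group R) (\<lambda>g. word_class R (letter g)) w \<in> K" for w
    by (induction w) (auto simp: gens subgroup.one_closed[OF K] subgroup.m_closed[OF K] subgroup.m_inv_closed[OF K])
  then show "carrier (presented_group R) \<subseteq> K"
    by (auto simp: presented_word_val carrier_presented_group)
qed

lemma (in group) hom_equalizer_subgroup:
  assumes "group H" "F \<in> hom G H" "F' \<in> hom G H"
  shows "subgroup {s \<in> carrier G. F s = F' s} G"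
proof -
  interpret F: group_hom G H F
    using assms by (simp add: group_hom_def group_hom_axioms_def is_group)
  interpret F': group_hom G H F'
    using assms by (simp add: group_hom_def group_hom_axioms_def is_group)
  show ?thesis
    by (rule subgroupI) (use F.hom_one F'.hom_one in \<open>auto intro!: exI[of _ \<one>]\<close>)
qed

lemma presented_group_hom_ext:
  assumes "group G" "F \<in> hom (presented_group R) G" "F' \<in> hom (presented_group R) G"
    and gens: "\<And>g. F (word_class R (letter g)) = F' (word_class R (letter g))"
    and s: "s \<in> carrier (presented_group R)"
  shows "F s = F' s"
proof -
  have "{s \<in> carrier (presented_group R). F s = F' s} = carrier (presented_group R)"
    by (rule presented_group_generated, rule group.hom_equalizer_subgroup)
      (use assms group_presented_group in auto)
  then show ?thesis using s by blast
qed

section \<open>Lifts of projective transformations to the line\<close>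

text \<open>An element of the universal cover of \<open>PSL(2;\<real>)\<close> is a continuous map of the line that lifts a
  projective transformation.  All its properties come from the angle form \<open>wedge\<close>: it is invariant
  under \<open>SL(2;\<real>)\<close>, and on the directions of angles \<open>\<pi> s\<close> and \<open>\<pi> t\<close> it equals \<open>sin (\<pi> (t - s))\<close>.\<close>
lemma direction_nonzero: "direction t \<noteq> 0"
proof
  assume "direction t = 0"
  then have "cos (pi * t) = 0 \<and> sin (pi * t) = 0"
    by (simp add: direction_def vec_eq_iff forall_2)
  then show False using sin_cos_squared_add[of "pi * t"] by simp
qed

lemma direction_add_int: "direction (t + of_int n) = (if even n then 1 else - 1) *\<^sub>R direction t"
  by (auto simp: direction_def vec_eq_iff forall_2 distrib_left cos_add sin_add)

definition wedge :: "real ^ 2 \<Rightarrow> real ^ 2 \<Rightarrow> real" where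
  "wedge u v = u $ 1 * v $ 2 - u $ 2 * v $ 1"

lemma wedge_direction: "wedge (direction s) (direction t) = sin (pi * (t - s))"
  by (simp add: wedge_def direction_def right_diff_distrib sin_diff)

lemma wedge_scaleR: "wedge (c *\<^sub>R u) (d *\<^sub>R v) = c * d * wedge u v"
  by (simp add: wedge_def algebra_simps)

lemma wedge_SL2:
  assumes "A \<in> carrier SL2"
  shows "wedge (A *v u) (A *v v) = wedge u v"
proof -
  have "wedge (A *v u) (A *v v) = det A * wedge u v"
    by (simp add: wedge_def det_2 matrix_vector_mult_def sum_2 algebra_simps)
  then show ?thesis using assms by (simp add: SL2_def)
qed

lemma direction_parallel:
  assumes "c *\<^sub>R direction s = d *\<^sub>R direction t" and "c \<noteq> 0" and "d \<noteq> 0"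
  obtains n :: int where "t = s + of_int n"
proof -
  have "c * c * wedge (direction s) (direction s) = c * d * wedge (direction s) (direction t)"
    using assms(1) wedge_scaleR by metis
  then have "sin (pi * (t - s)) = 0" using assms by (simp add: wedge_direction)
  then obtain n :: int where "pi * (t - s) = of_int n * pi" unfolding sin_zero_iff_int2 by blast
  then have "t = s + of_int n" by (simp add: mult.commute[of pi])
  then show ?thesis by (rule that)
qed

lemma continuous_on_int_valued_const:
  fixes F :: "real \<Rightarrow> real"
  assumes "continuous_on UNIV F" and "\<And>t. F t \<in> \<int>"
  obtains n :: int where "\<And>t. F t = of_int n"
proof -
  have "\<exists>e>0. \<forall>y. y \<in> UNIV \<and> F y \<noteq> F x \<longrightarrow> e \<le> norm (F y - F x)" for x
  proof (intro exI[of _ 1] conjI allI impI)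
    fix y assume y: "y \<in> UNIV \<and> F y \<noteq> F x"
    have "F y - F x \<in> \<int>" using assms(2) by simp
    with y show "1 \<le> norm (F y - F x)" by (simp add: Ints_nonzero_abs_ge1)
  qed simp
  then have "F constant_on UNIV"
    by (intro continuous_discrete_range_constant assms(1)) auto
  then obtain c where "\<And>t. F t = c" by (auto simp: constant_on_def)
  then show ?thesis using that assms(2) by (metis Ints_cases)
qed

text \<open>A map that lifts the action of \<open>A\<close> on oriented lines determines \<open>A\<close>, and not only \<open>\<plusminus>A\<close>, and it can
  be composed without keeping track of signs.\<close>
definition oriented_lift :: "(real \<Rightarrow> real) \<Rightarrow> real ^ 2 ^ 2 \<Rightarrow> bool" where
  "oriented_lift g A \<longleftrightarrow> A \<in> carrier SL2 \<and> continuous_on UNIV g \<and>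
     (\<forall>t. \<exists>c>0. A *v direction t = c *\<^sub>R direction (g t))"

lemma oriented_lift_imp_projective: "oriented_lift g A \<Longrightarrow> lifts_projective g A"
  unfolding oriented_lift_def lifts_projective_def by (metis less_irrefl)

text \<open>The curve \<open>t \<mapsto> A (direction t)\<close> avoids \<open>0\<close>, so it has a continuous logarithm; the imaginary part
  of the logarithm is the lifted angle, the exponential of its real part the positive factor.\<close>
lemma oriented_lift_exists:
  assumes A: "A \<in> carrier SL2"
  obtains g where "oriented_lift g A"
proof -
  have nz: "A *v direction t \<noteq> 0" for t
  proof
    assume *: "A *v direction t = 0"
    have "wedge (direction t) v = 0" for v
      using wedge_SL2[OF A, of "direction t" v] by (simp add: * wedge_def)
    from this[of "direction (t + 1/2)"] show False by (simp add: wedge_direction)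
  qed
  define F where "F t = Complex ((A *v direction t) $ 1) ((A *v direction t) $ 2)" for t
  have cont: "continuous_on UNIV (\<lambda>t. (A *v direction t) $ i)" for i
    unfolding matrix_vector_mult_def direction_def
    by (simp add: sum_2) (intro continuous_intros)
  have "continuous_on UNIV F"
    unfolding F_def Complex_eq
    by (intro continuous_on_add continuous_on_mult continuous_on_const continuous_on_of_real cont)
  moreover have "F t \<noteq> 0" for t
    using nz[of t] by (auto simp: F_def complex_eq_iff vec_eq_iff forall_2)
  ultimately obtain L where L: "continuous_on UNIV L" "\<And>t. F t = exp (L t)"
    using continuous_logarithm_on_contractible[of UNIV F] contractible_UNIV by auto
  have "continuous_on UNIV (\<lambda>t. Im (L t) / pi)"
    by (intro continuous_intros L) simp
  moreover have "A *v direction t = exp (Re (L t)) *\<^sub>R direction (Im (L t) / pi)" for t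
    using L(2)[of t] by (simp add: F_def complex_eq_iff vec_eq_iff forall_2 direction_def Re_exp Im_exp)
  ultimately have "oriented_lift (\<lambda>t. Im (L t) / pi) A"
    unfolding oriented_lift_def using A exp_gt_zero by blast
  then show ?thesis by (rule that)
qed

lemma oriented_lift_sh: "oriented_lift (sh (of_int n)) (if even n then mat 1 else - mat 1)"
  unfolding oriented_lift_def
proof (intro conjI allI)
  show "(if even n then mat 1 else - mat 1) \<in> carrier (SL2 :: (real ^ 2 ^ 2) monoid)"
    by (simp add: SL2_def det_2 mat_def)
  show "continuous_on UNIV (sh (real_of_int n))"
    unfolding sh_def by (intro continuous_intros)
  have m: "(- mat 1 :: real ^ 2 ^ 2) *v v = - v" for v
    by (simp add: vec_eq_iff forall_2 matrix_vector_mult_def sum_2 mat_def)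
  show "\<exists>c>0. (if even n then mat 1 else - mat 1) *v direction t = c *\<^sub>R direction (sh (of_int n) t)" for t
    by (rule exI[of _ 1]) (simp add: sh_def direction_add_int m)
qed

lemma oriented_lift_comp:
  assumes g: "oriented_lift g A" and k: "oriented_lift k B"
  shows "oriented_lift (g \<circ> k) (A ** B)"
  unfolding oriented_lift_def
proof (intro conjI allI)
  show "A ** B \<in> carrier SL2" using g k by (simp add: oriented_lift_def SL2_def det_mul)
  show "continuous_on UNIV (g \<circ> k)"
    using g k unfolding oriented_lift_def
    by (metis continuous_on_compose continuous_on_subset subset_UNIV)
  fix t
  obtain c where c: "c > 0" "B *v direction t = c *\<^sub>R direction (k t)"
    using k unfolding oriented_lift_def by blast
  obtain d where d: "d > 0" "A *v direction (k t) = d *\<^sub>R direction (g (k t))"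
    using g unfolding oriented_lift_def by blast
  have "(A ** B) *v direction t = (c * d) *\<^sub>R direction ((g \<circ> k) t)"
    by (simp add: matrix_vector_mul_assoc[symmetric] c d matrix_vector_mult_scaleR)
  then show "\<exists>c>0. (A ** B) *v direction t = c *\<^sub>R direction ((g \<circ> k) t)"
    using c d by (intro exI[of _ "c * d"]) simp
qed

text \<open>Two lifts of one matrix differ at every point by an integer, which depends continuously on the
  point and is therefore constant.\<close>
lemma projective_lifts_differ_by_sh:
  assumes g: "lifts_projective g A" and k: "lifts_projective k A"
  obtains n :: int where "k = sh (of_int n) \<circ> g"
proof -
  have "k t - g t \<in> \<int>" for t
  proof -
    obtain c d where "c \<noteq> 0" "A *v direction t = c *\<^sub>R direction (g t)"
      "d \<noteq> 0" "A *v direction t = d *\<^sub>R direction (k t)"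
      using assms unfolding lifts_projective_def by meson
    then obtain n :: int where "k t = g t + of_int n"
      using direction_parallel[of c "g t" d "k t"] by metis
    then show ?thesis by simp
  qed
  moreover have "continuous_on UNIV (\<lambda>t. k t - g t)"
    using assms unfolding lifts_projective_def by (intro continuous_intros) auto
  ultimately obtain n :: int where "\<And>t. k t - g t = of_int n"
    using continuous_on_int_valued_const by metis
  then have "k = sh (of_int n) \<circ> g"
    by (auto simp: sh_def fun_eq_iff algebra_simps)
  then show ?thesis by (rule that)
qed

lemma oriented_lift_unique:
  "oriented_lift g A \<Longrightarrow> oriented_lift g B \<Longrightarrow> A = B"
  unfolding oriented_lift_def using cover_to_SL2R_unique[of A g B] by blast

lemma cover_to_SL2R_eq: "oriented_lift g A \<Longrightarrow> cover_to_SL2R g = A"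
  unfolding cover_to_SL2R_def
  by (rule the_equality) (auto simp: oriented_lift_def intro: cover_to_SL2R_unique)

lemma neg_mat_mult: "(- A :: 'a::comm_ring_1 ^ 2 ^ 2) ** B = - (A ** B)" "A ** (- B) = - (A ** B)"
  by (simp_all add: vec_eq_iff matrix_matrix_mult_def sum_2)

text \<open>A given lift is an integer translate of an oriented one, and a translation by one reverses the
  orientation of every line.\<close>
lemma projective_lift_orientable:
  assumes A: "A \<in> carrier SL2" and g: "lifts_projective g A"
  shows "oriented_lift g A \<or> oriented_lift g (- A)"
proof -
  obtain k where k: "oriented_lift k A" using oriented_lift_exists[OF A] .
  obtain n :: int where n: "g = sh (of_int n) \<circ> k"
    using projective_lifts_differ_by_sh[OF oriented_lift_imp_projective[OF k] g] .
  have "oriented_lift g ((if even n then mat 1 else - mat 1) ** A)"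
    unfolding n by (intro oriented_lift_comp oriented_lift_sh k)
  then show ?thesis by (auto simp: neg_mat_mult split: if_splits)
qed

lemma carrier_PSL2R_cover: "g \<in> carrier PSL2R_cover \<longleftrightarrow> (\<exists>A. oriented_lift g A)"
proof
  show "\<exists>A. oriented_lift g A" if "g \<in> carrier PSL2R_cover"
    using that projective_lift_orientable unfolding PSL2R_cover_def by fastforce
  assume "\<exists>A. oriented_lift g A"
  then obtain A where A: "oriented_lift g A" ..
  then have "A \<in> carrier SL2" by (simp add: oriented_lift_def)
  then show "g \<in> carrier PSL2R_cover"
    using oriented_lift_imp_projective[OF A] by (auto simp: PSL2R_cover_def)
qed

lemma oriented_lift_cover_to_SL2R:
  "g \<in> carrier PSL2R_cover \<Longrightarrow> oriented_lift g (cover_to_SL2R g)"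
  using carrier_PSL2R_cover cover_to_SL2R_eq by metis

lemma mult_PSL2R_cover [simp]: "g \<otimes>\<^bsub>PSL2R_cover\<^esub> k = g \<circ> k"
  and one_PSL2R_cover [simp]: "\<one>\<^bsub>PSL2R_cover\<^esub> = id"
  by (simp_all add: PSL2R_cover_def)

lemma sh_in_cover [simp]: "sh (of_int n) \<in> carrier PSL2R_cover"
  using carrier_PSL2R_cover oriented_lift_sh by blast

lemma sh_comp: "sh r \<circ> sh s = sh (r + s)"
  by (auto simp: sh_def)

lemma sh_0 [simp]: "sh 0 = id"
  by (auto simp: sh_def)

lemma group_PSL2R_cover: "group PSL2R_cover"
proof (rule groupI)
  show "\<one>\<^bsub>PSL2R_cover\<^esub> \<in> carrier PSL2R_cover"
    using sh_in_cover[of 0] by simp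
  show "g \<otimes>\<^bsub>PSL2R_cover\<^esub> k \<in> carrier PSL2R_cover"
    if "g \<in> carrier PSL2R_cover" "k \<in> carrier PSL2R_cover" for g k
    using that oriented_lift_comp unfolding carrier_PSL2R_cover mult_PSL2R_cover by blast
  show "\<exists>k\<in>carrier PSL2R_cover. k \<otimes>\<^bsub>PSL2R_cover\<^esub> g = \<one>\<^bsub>PSL2R_cover\<^esub>"
    if g_in: "g \<in> carrier PSL2R_cover" for g
  proof -
    interpret S: group "SL2 :: (real ^ 2 ^ 2) monoid" by (rule group_SL2)
    obtain A where A: "oriented_lift g A" using g_in by (auto simp: carrier_PSL2R_cover)
    then have "A \<in> carrier SL2" by (simp add: oriented_lift_def)
    then obtain B where B: "B \<in> carrier SL2" "B ** A = mat 1"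
      using S.l_inv_ex by (auto simp: SL2_def)
    obtain k where k: "oriented_lift k B" using oriented_lift_exists[OF B(1)] .
    have "oriented_lift (k \<circ> g) (mat 1)" using oriented_lift_comp[OF k A] B by simp
    moreover have "oriented_lift id (mat 1)" using oriented_lift_sh[of 0] by simp
    ultimately obtain n :: int where "id = sh (of_int n) \<circ> (k \<circ> g)"
      by (metis projective_lifts_differ_by_sh oriented_lift_imp_projective)
    moreover have "sh (of_int n) \<circ> k \<in> carrier PSL2R_cover"
      using oriented_lift_comp[OF oriented_lift_sh k] by (auto simp: carrier_PSL2R_cover)
    ultimately show ?thesis
      by (intro bexI[of _ "sh (of_int n) \<circ> k"]) (simp_all add: comp_assoc)
  qed
qed (simp_all add: comp_assoc)

text \<open>Invariance of the angle form, read through the lift: the lift preserves the sign of the sine of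
  an angle, which is the local form of the statement that it preserves orientation.\<close>
lemma oriented_lift_sgn_sin:
  assumes "oriented_lift g A"
  shows "sgn (sin (pi * (g t - g s))) = sgn (sin (pi * (t - s)))"
proof -
  obtain c d where c: "c > 0" "A *v direction s = c *\<^sub>R direction (g s)"
    and d: "d > 0" "A *v direction t = d *\<^sub>R direction (g t)"
    using assms unfolding oriented_lift_def by meson
  have "wedge (A *v direction s) (A *v direction t) = wedge (direction s) (direction t)"
    using assms by (intro wedge_SL2) (simp add: oriented_lift_def)
  then have "c * d * sin (pi * (g t - g s)) = sin (pi * (t - s))"
    by (simp add: c d wedge_scaleR wedge_direction)
  then have "sgn (c * d * sin (pi * (g t - g s))) = sgn (sin (pi * (t - s)))" by simp
  then show ?thesis using c d by (simp add: sgn_mult)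
qed

text \<open>The increment \<open>F r\<close> of the lift over \<open>[s, s + r]\<close> starts at \<open>0\<close>, and \<open>sin (\<pi> F r) > 0\<close> for \<open>0 < r < 1\<close>.
  By the intermediate value theorem \<open>F\<close> is confined to the unit interval.  At \<open>r = 1\<close> it is an integer
  because opposite vectors span the same line, and this integer is not \<open>0\<close> because they are
  opposite.\<close>
lemma oriented_lift_local:
  assumes g: "oriented_lift g A"
  shows oriented_lift_increment: "0 < r \<Longrightarrow> r < 1 \<Longrightarrow> g (s + r) - g s \<in> {0<..<1}"
    and oriented_lift_period: "g (s + 1) = g s + 1"
proof -
  define F where "F r = g (s + r) - g s" for r
  have F0: "F 0 = 0" by (simp add: F_def)
  have pos: "sin (pi * F r) > 0" if "0 < r" "r < 1" for r
  proof -
    have "sin (pi * r) > 0" using that by (intro sin_gt_zero) auto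
    then show ?thesis
      using oriented_lift_sgn_sin[OF g, of "s + r" s] by (simp add: F_def sgn_1_pos)
  qed
  have cont: "continuous_on UNIV F"
  proof -
    have g_cont: "continuous_on UNIV g" using g by (simp add: oriented_lift_def)
    have "continuous_on UNIV (\<lambda>r. g (s + r))"
      by (rule continuous_on_compose2[OF g_cont]) (intro continuous_intros, simp)
    then show ?thesis unfolding F_def by (intro continuous_intros)
  qed
  have cont_on: "continuous_on {0..r} F" for r
    using cont by (rule continuous_on_subset) simp
  have up: "\<exists>q. 0 \<le> q \<and> q \<le> r \<and> F q = y" if "0 \<le> r" "0 \<le> y" "y \<le> F r" for r y
    using IVT'[OF _ that(3,1) cont_on] F0 that(2) by auto
  have down: "\<exists>q. 0 \<le> q \<and> q \<le> r \<and> F q = y" if "0 \<le> r" "y \<le> 0" "F r \<le> y" for r y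
    using IVT2'[OF that(3) _ that(1) cont_on] F0 that(2) by auto
  have no1: "F r < 1" if r: "0 < r" "r < 1" for r
  proof (rule ccontr)
    assume "\<not> F r < 1"
    then obtain q where q: "0 \<le> q" "q \<le> r" "F q = 1"
      using up[of r 1] r by auto
    then have "q > 0" using F0 by (cases "q = 0") auto
    then show False using pos[of q] q r by simp
  qed
  have below: "F r > - 1 / 2" if r: "0 \<le> r" "r < 1" for r
  proof (rule ccontr)
    assume "\<not> F r > - 1 / 2"
    then obtain q where q: "0 \<le> q" "q \<le> r" "F q = - 1 / 2"
      using down[of r "- 1 / 2"] r by auto
    then have "q > 0" using F0 by (cases "q = 0") auto
    then show False using pos[of q] q r by simp
  qed
  have F_in: "F r \<in> {0<..<1}" if "0 < r" "r < 1" for r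
  proof -
    have "F r > 0"
    proof (rule ccontr)
      assume "\<not> F r > 0"
      then have "0 \<le> pi * - F r" "pi * - F r \<le> pi"
        using below[of r] that mult_left_le[of "- F r" pi] by (auto simp: mult_le_0_iff)
      then have "sin (pi * - F r) \<ge> 0" by (rule sin_ge_zero)
      then show False using pos[OF that] by simp
    qed
    then show ?thesis using no1[OF that] by simp
  qed
  then show "0 < r \<Longrightarrow> r < 1 \<Longrightarrow> g (s + r) - g s \<in> {0<..<1}" for r
    by (simp add: F_def)
  have "F 1 \<le> 1"
  proof (rule ccontr)
    assume "\<not> F 1 \<le> 1"
    then obtain q where q: "0 \<le> q" "q \<le> 1" "F q = 1"
      using up[of 1 1] by auto
    then have "q \<noteq> 0" "q \<noteq> 1" using F0 \<open>\<not> F 1 \<le> 1\<close> by auto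
    then show False using F_in[of q] q by simp
  qed
  moreover have "F 1 \<ge> 0"
  proof (rule ccontr)
    assume neg: "\<not> F 1 \<ge> 0"
    then obtain q where q: "0 \<le> q" "q \<le> 1" "F q = F 1 / 2"
      using down[of 1 "F 1 / 2"] by auto
    then have "q \<noteq> 0" "q \<noteq> 1" using F0 neg by auto
    then show False using F_in[of q] q neg by simp
  qed
  moreover have "F 1 = 1" if "F 1 \<in> {0..1}"
  proof -
    obtain c d where c: "c > 0" "A *v direction s = c *\<^sub>R direction (g s)"
      and d: "d > 0" "A *v direction (s + 1) = d *\<^sub>R direction (g (s + 1))"
      using g unfolding oriented_lift_def by meson
    have "direction (s + 1) = (- 1) *\<^sub>R direction s" using direction_add_int[of s 1] by simp
    then have opp: "(- c) *\<^sub>R direction (g s) = d *\<^sub>R direction (g (s + 1))"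
      using c(2) d(2) matrix_vector_mult_scaleR[of A "- 1" "direction s"] by simp
    then obtain n :: int where n: "g (s + 1) = g s + of_int n"
      using direction_parallel[of "- c" "g s" d "g (s + 1)"] c d by auto
    have "F 1 \<noteq> 0"
    proof
      assume "F 1 = 0"
      then have "g (s + 1) = g s" by (simp add: F_def)
      then have "(d - (- c)) *\<^sub>R direction (g s) = 0"
        unfolding scaleR_left_diff_distrib right_minus_eq using opp by simp
      then show False using c d direction_nonzero[of "g s"] by simp
    qed
    moreover have "F 1 = of_int n" using n by (simp add: F_def)
    ultimately show ?thesis using that by auto
  qed
  ultimately show "g (s + 1) = g s + 1" by (simp add: F_def)
qed

lemma oriented_lift_comm_sh:
  assumes "oriented_lift g A"
  shows "g \<circ> sh (of_int n) = sh (of_int n) \<circ> g"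
proof -
  have nat: "g (t + real m) = g t + real m" for t m
  proof (induction m)
    case (Suc m)
    have "g (t + real (Suc m)) = g ((t + real m) + 1)" by (simp add: algebra_simps)
    then show ?case using oriented_lift_period[OF assms, of "t + real m"] Suc by simp
  qed simp
  have "g (t + of_int n) = g t + of_int n" for t
  proof (cases "n \<ge> 0")
    case True
    then show ?thesis using nat[of t "nat n"] by simp
  next
    case False
    then show ?thesis using nat[of "t + of_int n" "nat (- n)"] by simp
  qed
  then show ?thesis by (simp add: sh_def fun_eq_iff)
qed

lemma oriented_lift_strict_mono:
  assumes "oriented_lift g A" and "s < t"
  shows "g s < g t"
proof -
  define n where "n = \<lfloor>t - s\<rfloor>"
  define r where "r = frac (t - s)"
  have t: "t = (s + r) + of_int n" by (simp add: n_def r_def frac_def)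
  have "g t = g (s + r) + of_int n"
    using fun_cong[OF oriented_lift_comm_sh[OF assms(1), of n], of "s + r"] t by (simp add: sh_def)
  moreover have "n \<ge> 0" using assms(2) by (simp add: n_def)
  moreover have "n \<ge> 1" if "r = 0" using that t assms(2) by simp
  moreover have "g (s + r) > g s" if "r \<noteq> 0"
    using that oriented_lift_increment[OF assms(1), of r s] frac_ge_0[of "t - s"] frac_lt_1[of "t - s"]
    by (auto simp: r_def)
  ultimately show ?thesis by (cases "r = 0") auto
qed

text \<open>If an increasing map moves a point to one side, all its iterates move the point to that side.\<close>
lemma PSL2R_cover_torsion_free:
  assumes g: "g \<in> carrier PSL2R_cover" and n: "n > 0" and pow: "g [^]\<^bsub>PSL2R_cover\<^esub> (n :: nat) = id"
  shows "g = id"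
proof -
  interpret C: group PSL2R_cover by (rule group_PSL2R_cover)
  have mono: "k s < k t" if "k \<in> carrier PSL2R_cover" "s < t" for k s t
    using that oriented_lift_strict_mono carrier_PSL2R_cover by blast
  have up: "t < (g [^]\<^bsub>PSL2R_cover\<^esub> Suc m) t" if "t < g t" for t m
  proof (induction m)
    case (Suc m)
    have "(g [^]\<^bsub>PSL2R_cover\<^esub> Suc m) t < (g [^]\<^bsub>PSL2R_cover\<^esub> Suc m) (g t)"
      using that g by (intro mono[of "g [^]\<^bsub>PSL2R_cover\<^esub> Suc m"] C.nat_pow_closed)
    then show ?case using Suc by simp
  qed (use that g in simp)
  have down: "(g [^]\<^bsub>PSL2R_cover\<^esub> Suc m) t < t" if "g t < t" for t m
  proof (induction m)
    case (Suc m)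
    have "(g [^]\<^bsub>PSL2R_cover\<^esub> Suc m) (g t) < (g [^]\<^bsub>PSL2R_cover\<^esub> Suc m) t"
      using that g by (intro mono[of "g [^]\<^bsub>PSL2R_cover\<^esub> Suc m"] C.nat_pow_closed)
    then show ?case using Suc by simp
  qed (use that g in simp)
  obtain m where m: "n = Suc m" using n by (cases n) auto
  show ?thesis
  proof
    fix t
    show "g t = id t"
      using up[of t m] down[of t m] pow unfolding m by (metis id_apply less_irrefl linorder_less_linear)
  qed
qed

lemma PSL2R_cover_sh_pow:
  "sh (of_int m) [^]\<^bsub>PSL2R_cover\<^esub> (n :: int) = sh (of_int (m * n))"
proof -
  interpret C: group PSL2R_cover by (rule group_PSL2R_cover)
  have nat: "sh (of_int m) [^]\<^bsub>PSL2R_cover\<^esub> k = sh (of_int (m * int k))" for k :: nat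
    by (induction k) (simp_all add: sh_comp algebra_simps)
  have inv: "inv\<^bsub>PSL2R_cover\<^esub> sh (of_int k) = sh (of_int (- k))" for k
    by (rule C.inv_equality[OF _ sh_in_cover sh_in_cover]) (simp add: sh_comp)
  show ?thesis
    unfolding int_pow_def2 nat inv by simp
qed

section \<open>The projections of the universal cover\<close>

lemma cover_to_PSL2R_eq:
  assumes "oriented_lift g A"
  shows "cover_to_PSL2R g = {A, - A}"
proof -
  have A: "A \<in> carrier SL2" using assms by (simp add: oriented_lift_def)
  then have mA: "- A \<in> carrier SL2" by (simp add: SL2_def det_2)
  have "lifts_projective g (- A)"
    using oriented_lift_imp_projective[OF assms] unfolding lifts_projective_def
  proof (intro conjI allI)
    fix t
    assume "continuous_on UNIV g \<and> (\<forall>t. \<exists>c. c \<noteq> 0 \<and> A *v direction t = c *\<^sub>R direction (g t))"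
    then obtain c where "c \<noteq> 0" "A *v direction t = c *\<^sub>R direction (g t)" by blast
    then show "\<exists>c. c \<noteq> 0 \<and> - A *v direction t = c *\<^sub>R direction (g t)"
      by (intro exI[of _ "- c"]) (simp add: vec_eq_iff forall_2 matrix_vector_mult_def sum_2)
  qed simp
  moreover have "B = A \<or> B = - A" if "B \<in> carrier SL2" "lifts_projective g B" for B
    using projective_lift_orientable[OF that] oriented_lift_unique[OF assms] by fastforce
  ultimately show ?thesis
    using A mA oriented_lift_imp_projective[OF assms] by (auto simp: cover_to_PSL2R_def)
qed

lemma PSL2R_coset: "{mat 1, - mat 1} #>\<^bsub>SL2\<^esub> A = {A, - A :: real ^ 2 ^ 2}"
  by (auto simp: r_coset_def SL2_def neg_mat_mult)

lemma PSL2R_proj_hom: "(\<lambda>A. {A, - A}) \<in> hom SL2 PSL2R"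
  using normal.r_coset_hom_Mod[OF normal_pm1] unfolding PSL2R_coset PSL2R_def .

lemma group_PSL2R: "group PSL2R"
  unfolding PSL2R_def by (rule normal.factorgroup_is_group[OF normal_pm1])

lemma cover_to_PSL2R_hom: "cover_to_PSL2R \<in> hom PSL2R_cover PSL2R"
proof (rule homI)
  note proj = PSL2R_proj_hom
  show "cover_to_PSL2R g \<in> carrier PSL2R" if "g \<in> carrier PSL2R_cover" for g
  proof -
    obtain A where A: "oriented_lift g A" using \<open>g \<in> carrier PSL2R_cover\<close> carrier_PSL2R_cover by blast
    then have "A \<in> carrier SL2" by (simp add: oriented_lift_def)
    then show ?thesis using hom_in_carrier[OF proj] by (simp add: cover_to_PSL2R_eq[OF A])
  qed
  show "cover_to_PSL2R (g \<otimes>\<^bsub>PSL2R_cover\<^esub> k) = cover_to_PSL2R g \<otimes>\<^bsub>PSL2R\<^esub> cover_to_PSL2R k"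
    if gk: "g \<in> carrier PSL2R_cover" "k \<in> carrier PSL2R_cover" for g k
  proof -
    obtain A B where A: "oriented_lift g A" and B: "oriented_lift k B"
      using gk carrier_PSL2R_cover by blast
    then have "A \<in> carrier SL2" "B \<in> carrier SL2" by (simp_all add: oriented_lift_def)
    then have "{A ** B, - (A ** B)} = {A, - A} \<otimes>\<^bsub>PSL2R\<^esub> {B, - B}"
      using hom_mult[OF proj, of A B] by (simp add: SL2_def)
    then show ?thesis
      using cover_to_PSL2R_eq[OF oriented_lift_comp[OF A B]]
      by (simp add: cover_to_PSL2R_eq[OF A] cover_to_PSL2R_eq[OF B])
  qed
qed

lemma cover_to_PSL2R_sh: "cover_to_PSL2R (sh (of_int n)) = \<one>\<^bsub>PSL2R\<^esub>"
  unfolding cover_to_PSL2R_eq[OF oriented_lift_sh] PSL2R_def by auto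

lemma cover_to_PSL2R_fibre:
  assumes "g \<in> carrier PSL2R_cover" and "cover_to_PSL2R g = cover_to_PSL2R k"
  obtains n :: int where "k = sh (of_int n) \<circ> g"
proof -
  obtain A where A: "oriented_lift g A" using assms(1) carrier_PSL2R_cover by blast
  have "A \<in> cover_to_PSL2R k" unfolding assms(2)[symmetric] cover_to_PSL2R_eq[OF A] by simp
  then have "lifts_projective k A" by (simp add: cover_to_PSL2R_def)
  then show ?thesis
    using that projective_lifts_differ_by_sh oriented_lift_imp_projective[OF A] by metis
qed

lemma cover_to_SL2R_hom: "cover_to_SL2R \<in> hom PSL2R_cover SL2"
proof (rule homI)
  show "cover_to_SL2R g \<in> carrier SL2" if "g \<in> carrier PSL2R_cover" for g
    using oriented_lift_cover_to_SL2R[OF that] by (simp add: oriented_lift_def)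
  show "cover_to_SL2R (g \<otimes>\<^bsub>PSL2R_cover\<^esub> k) = cover_to_SL2R g \<otimes>\<^bsub>SL2\<^esub> cover_to_SL2R k"
    if "g \<in> carrier PSL2R_cover" "k \<in> carrier PSL2R_cover" for g k
    using cover_to_SL2R_eq[OF oriented_lift_comp[OF that[THEN oriented_lift_cover_to_SL2R]]]
    by (simp add: SL2_def)
qed

text \<open>Conjugation by \<open>diag(1, -1)\<close>, which has determinant \<open>-1\<close>, and the corresponding automorphism of the
  universal cover.  It inverts the integer translations, and so it reverses the sign of the Euler
  number of an extension pulled back from the universal cover.\<close>
definition flip :: "real ^ 2 ^ 2 \<Rightarrow> real ^ 2 ^ 2" where
  "flip A = (\<chi> i j. if i = j then A $ i $ j else - A $ i $ j)"

definition mirror :: "(real \<Rightarrow> real) \<Rightarrow> real \<Rightarrow> real" where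
  "mirror g = (\<lambda>t. - g (- t))"

lemma oriented_lift_mirror:
  assumes "oriented_lift g A"
  shows "oriented_lift (mirror g) (flip A)"
  unfolding oriented_lift_def
proof (intro conjI allI)
  show "flip A \<in> carrier SL2"
    using assms by (simp add: oriented_lift_def SL2_def det_2 flip_def)
  have "continuous_on UNIV g" using assms by (simp add: oriented_lift_def)
  then have "continuous_on UNIV (\<lambda>t. g (- t))"
    by (rule continuous_on_compose2) (intro continuous_intros, simp)
  then show "continuous_on UNIV (mirror g)"
    unfolding mirror_def by (intro continuous_intros)
  fix t
  obtain c where "c > 0" "A *v direction (- t) = c *\<^sub>R direction (g (- t))"
    using assms unfolding oriented_lift_def by blast
  then show "\<exists>c>0. flip A *v direction t = c *\<^sub>R direction (mirror g t)"
    by (intro exI[of _ c])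
      (simp add: vec_eq_iff forall_2 matrix_vector_mult_def sum_2 direction_def mirror_def flip_def algebra_simps)
qed

lemma mirror_hom: "mirror \<in> hom PSL2R_cover PSL2R_cover"
proof (rule homI)
  show "mirror g \<in> carrier PSL2R_cover" if "g \<in> carrier PSL2R_cover" for g
    using that oriented_lift_mirror carrier_PSL2R_cover by blast
qed (auto simp: mirror_def)

lemma mirror_sh: "mirror (sh r) = sh (- r)"
  by (auto simp: mirror_def sh_def)

section \<open>Triangle groups and Seifert groups by generators and relations\<close>

lemma (in group) centralizer_subgroup:
  assumes y: "y \<in> carrier G"
  shows "subgroup {x \<in> carrier G. x \<otimes> y = y \<otimes> x} G"
proof (rule subgroupI)
  show "inv x \<in> {x \<in> carrier G. x \<otimes> y = y \<otimes> x}" if "x \<in> {x \<in> carrier G. x \<otimes> y = y \<otimes> x}" for x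
  proof -
    have x: "x \<in> carrier G" "x \<otimes> y = y \<otimes> x" using that by auto
    have "x \<otimes> (inv x \<otimes> y) = x \<otimes> (y \<otimes> inv x)"
      using x y by (simp add: m_assoc[symmetric]) (simp add: m_assoc)
    then show ?thesis using x y by simp
  qed
  show "x \<otimes> x' \<in> {x \<in> carrier G. x \<otimes> y = y \<otimes> x}"
    if "x \<in> {x \<in> carrier G. x \<otimes> y = y \<otimes> x}" "x' \<in> {x \<in> carrier G. x \<otimes> y = y \<otimes> x}" for x x'
    using that y by simp (metis m_assoc)
qed (use y in auto)

lemma (in group) int_pow_commutes:
  assumes "x \<otimes> y = y \<otimes> x" "x \<in> carrier G" "y \<in> carrier G"
  shows "x [^] (n :: int) \<otimes> y = y \<otimes> x [^] n"
  using subgroup_int_pow_closed[OF centralizer_subgroup[OF assms(3)], of x n] assms by simp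

lemma group_triangle_group: "group (triangle_group a1 a2 a3)"
  unfolding triangle_group_def by (rule group_presented_group)

lemma group_seifert_group: "group (seifert_group a1 a2 a3 b b1 b2 b3)"
  unfolding seifert_group_def by (rule group_presented_group)

lemma triangle_gen_in_carrier [simp]: "triangle_gen_class a1 a2 a3 g \<in> carrier (triangle_group a1 a2 a3)"
  by (simp add: triangle_group_def triangle_gen_class_def)

lemma seifert_gen_in_carrier [simp]:
  "seifert_gen_class a1 a2 a3 b b1 b2 b3 g \<in> carrier (seifert_group a1 a2 a3 b b1 b2 b3)"
  by (simp add: seifert_group_def seifert_gen_class_def)

text \<open>The universal properties of the two families of groups, with the relations written as
  equations in the target group.\<close>
lemma triangle_group_hom_exists:
  assumes "group G" and x: "x \<in> carrier G" and y: "y \<in> carrier G" and z: "z \<in> carrier G"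
    and rels: "x [^]\<^bsub>G\<^esub> int a1 = \<one>\<^bsub>G\<^esub>" "y [^]\<^bsub>G\<^esub> int a2 = \<one>\<^bsub>G\<^esub>" "z [^]\<^bsub>G\<^esub> int a3 = \<one>\<^bsub>G\<^esub>"
      "x \<otimes>\<^bsub>G\<^esub> y \<otimes>\<^bsub>G\<^esub> z = \<one>\<^bsub>G\<^esub>"
  obtains F where "F \<in> hom (triangle_group a1 a2 a3) G"
    "F (triangle_gen_class a1 a2 a3 TX) = x" "F (triangle_gen_class a1 a2 a3 TY) = y"
    "F (triangle_gen_class a1 a2 a3 TZ) = z"
proof -
  interpret group G by fact
  define \<phi> where "\<phi> = case_triangle_gen x y z"
  have \<phi>: "range \<phi> \<subseteq> carrier G"
    using x y z by (auto simp: \<phi>_def split: triangle_gen.split)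
  have "word_val G \<phi> u = word_val G \<phi> v" if "(u, v) \<in> triangle_rels a1 a2 a3" for u v
    using that x y z rels
    by (auto simp: triangle_rels_def \<phi> word_val_append[OF \<phi>] m_assoc) (simp_all add: \<phi>_def)
  then obtain F where "F \<in> hom (presented_group (triangle_rels a1 a2 a3)) G"
    "\<And>g. F (word_class (triangle_rels a1 a2 a3) (letter g)) = \<phi> g"
    using presented_group_hom_exists[OF \<phi>] by metis
  then show ?thesis
    using that[of F] by (simp add: triangle_group_def triangle_gen_class_def \<phi>_def)
qed

lemma seifert_group_hom_exists:
  assumes "group G" and x: "x \<in> carrier G" and y: "y \<in> carrier G" and z: "z \<in> carrier G"
    and h: "h \<in> carrier G"
    and comm: "h \<otimes>\<^bsub>G\<^esub> x = x \<otimes>\<^bsub>G\<^esub> h" "h \<otimes>\<^bsub>G\<^esub> y = y \<otimes>\<^bsub>G\<^esub> h" "h \<otimes>\<^bsub>G\<^esub> z = z \<otimes>\<^bsub>G\<^esub> h"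
    and rels: "x [^]\<^bsub>G\<^esub> int a1 = h [^]\<^bsub>G\<^esub> (- b1)" "y [^]\<^bsub>G\<^esub> int a2 = h [^]\<^bsub>G\<^esub> (- b2)"
      "z [^]\<^bsub>G\<^esub> int a3 = h [^]\<^bsub>G\<^esub> (- b3)" "x \<otimes>\<^bsub>G\<^esub> y \<otimes>\<^bsub>G\<^esub> z = h [^]\<^bsub>G\<^esub> b"
  obtains F where "F \<in> hom (seifert_group a1 a2 a3 b b1 b2 b3) G"
    "F (seifert_gen_class a1 a2 a3 b b1 b2 b3 SX) = x" "F (seifert_gen_class a1 a2 a3 b b1 b2 b3 SY) = y"
    "F (seifert_gen_class a1 a2 a3 b b1 b2 b3 SZ) = z" "F (seifert_gen_class a1 a2 a3 b b1 b2 b3 SH) = h"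
proof -
  interpret group G by fact
  define \<phi> where "\<phi> = case_seifert_gen x y z h"
  have \<phi>: "range \<phi> \<subseteq> carrier G"
    using x y z h by (auto simp: \<phi>_def split: seifert_gen.split)
  have "word_val G \<phi> u = word_val G \<phi> v" if "(u, v) \<in> seifert_rels a1 a2 a3 b b1 b2 b3" for u v
    using that x y z h rels comm
    by (auto simp: seifert_rels_def \<phi> word_val_append[OF \<phi>] m_assoc) (simp_all add: \<phi>_def)
  then obtain F where "F \<in> hom (presented_group (seifert_rels a1 a2 a3 b b1 b2 b3)) G"
    "\<And>g. F (word_class (seifert_rels a1 a2 a3 b b1 b2 b3) (letter g)) = \<phi> g"
    using presented_group_hom_exists[OF \<phi>] by metis
  then show ?thesis
    using that[of F] by (simp add: seifert_group_def seifert_gen_class_def \<phi>_def)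
qed

lemma seifert_group_generated:
  assumes "subgroup K (seifert_group a1 a2 a3 b b1 b2 b3)"
    and "\<And>g. seifert_gen_class a1 a2 a3 b b1 b2 b3 g \<in> K"
  shows "K = carrier (seifert_group a1 a2 a3 b b1 b2 b3)"
  using assms presented_group_generated unfolding seifert_group_def seifert_gen_class_def by blast

lemma triangle_group_generated:
  assumes "subgroup K (triangle_group a1 a2 a3)" and "\<And>g. triangle_gen_class a1 a2 a3 g \<in> K"
  shows "K = carrier (triangle_group a1 a2 a3)"
  using assms presented_group_generated unfolding triangle_group_def triangle_gen_class_def by blast

lemma seifert_group_hom_ext:
  assumes "group G" "F \<in> hom (seifert_group a1 a2 a3 b b1 b2 b3) G" "F' \<in> hom (seifert_group a1 a2 a3 b b1 b2 b3) G"
    and "\<And>g. F (seifert_gen_class a1 a2 a3 b b1 b2 b3 g) = F' (seifert_gen_class a1 a2 a3 b b1 b2 b3 g)"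
    and "s \<in> carrier (seifert_group a1 a2 a3 b b1 b2 b3)"
  shows "F s = F' s"
  using assms presented_group_hom_ext unfolding seifert_group_def seifert_gen_class_def by blast

locale seifert =
  fixes a1 a2 a3 :: nat and b b1 b2 b3 :: int
begin

abbreviation "S \<equiv> seifert_group a1 a2 a3 b b1 b2 b3"
abbreviation "sX \<equiv> seifert_gen_class a1 a2 a3 b b1 b2 b3 SX"
abbreviation "sY \<equiv> seifert_gen_class a1 a2 a3 b b1 b2 b3 SY"
abbreviation "sZ \<equiv> seifert_gen_class a1 a2 a3 b b1 b2 b3 SZ"
abbreviation "sH \<equiv> seifert_gen_class a1 a2 a3 b b1 b2 b3 SH"

sublocale S: group S by (rule group_seifert_group)

lemma relations:
  "sX [^]\<^bsub>S\<^esub> int a1 = sH [^]\<^bsub>S\<^esub> (- b1)" "sY [^]\<^bsub>S\<^esub> int a2 = sH [^]\<^bsub>S\<^esub> (- b2)"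
  "sZ [^]\<^bsub>S\<^esub> int a3 = sH [^]\<^bsub>S\<^esub> (- b3)" "sX \<otimes>\<^bsub>S\<^esub> sY \<otimes>\<^bsub>S\<^esub> sZ = sH [^]\<^bsub>S\<^esub> b"
  "sH \<otimes>\<^bsub>S\<^esub> sX = sX \<otimes>\<^bsub>S\<^esub> sH" "sH \<otimes>\<^bsub>S\<^esub> sY = sY \<otimes>\<^bsub>S\<^esub> sH" "sH \<otimes>\<^bsub>S\<^esub> sZ = sZ \<otimes>\<^bsub>S\<^esub> sH"
proof -
  have gens: "range (seifert_gen_class a1 a2 a3 b b1 b2 b3) \<subseteq> carrier S" by auto
  have rel: "word_val S (seifert_gen_class a1 a2 a3 b b1 b2 b3) u =
      word_val S (seifert_gen_class a1 a2 a3 b b1 b2 b3) v"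
    if "(u, v) \<in> seifert_rels a1 a2 a3 b b1 b2 b3" for u v
    using presented_group_rel[OF that] by (simp add: seifert_group_def seifert_gen_class_def[abs_def])
  note ev = S.word_val_letter_pow[OF gens] S.word_val_append[OF gens] S.word_val_letter[OF gens]
  show "sX [^]\<^bsub>S\<^esub> int a1 = sH [^]\<^bsub>S\<^esub> (- b1)" "sY [^]\<^bsub>S\<^esub> int a2 = sH [^]\<^bsub>S\<^esub> (- b2)"
    "sZ [^]\<^bsub>S\<^esub> int a3 = sH [^]\<^bsub>S\<^esub> (- b3)"
    using rel[of "letter_pow SX (int a1)" "letter_pow SH (- b1)"]
      rel[of "letter_pow SY (int a2)" "letter_pow SH (- b2)"]
      rel[of "letter_pow SZ (int a3)" "letter_pow SH (- b3)"]
    unfolding ev by (simp_all add: seifert_rels_def)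
  show "sX \<otimes>\<^bsub>S\<^esub> sY \<otimes>\<^bsub>S\<^esub> sZ = sH [^]\<^bsub>S\<^esub> b"
    using rel[of "letter SX @ letter SY @ letter SZ" "letter_pow SH b"]
    unfolding ev by (simp add: seifert_rels_def S.m_assoc)
  show "sH \<otimes>\<^bsub>S\<^esub> sX = sX \<otimes>\<^bsub>S\<^esub> sH" "sH \<otimes>\<^bsub>S\<^esub> sY = sY \<otimes>\<^bsub>S\<^esub> sH" "sH \<otimes>\<^bsub>S\<^esub> sZ = sZ \<otimes>\<^bsub>S\<^esub> sH"
    using rel[of "letter SH @ letter SX" "letter SX @ letter SH"]
      rel[of "letter SH @ letter SY" "letter SY @ letter SH"]
      rel[of "letter SH @ letter SZ" "letter SZ @ letter SH"]
    unfolding ev by (simp_all add: seifert_rels_def)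
qed

lemma fibre_central:
  assumes "s \<in> carrier S"
  shows "sH \<otimes>\<^bsub>S\<^esub> s = s \<otimes>\<^bsub>S\<^esub> sH"
proof -
  have "{x \<in> carrier S. x \<otimes>\<^bsub>S\<^esub> sH = sH \<otimes>\<^bsub>S\<^esub> x} = carrier S"
  proof (rule seifert_group_generated[OF S.centralizer_subgroup])
    show "seifert_gen_class a1 a2 a3 b b1 b2 b3 g \<in> {x \<in> carrier S. x \<otimes>\<^bsub>S\<^esub> sH = sH \<otimes>\<^bsub>S\<^esub> x}" for g
      using relations(5-7) by (cases g) auto
  qed simp
  then show ?thesis using assms by blast
qed

text \<open>The generator \<open>z\<close> is redundant: \<open>z = (x y)\<inverse> h^b\<close>.\<close>
lemma generated_by_XYH:
  assumes K: "subgroup K S" and "sX \<in> K" "sY \<in> K" "sH \<in> K"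
  shows "K = carrier S"
proof -
  have XY: "sX \<otimes>\<^bsub>S\<^esub> sY \<in> K" using assms by (simp add: subgroup.m_closed)
  have "sZ = inv\<^bsub>S\<^esub> (sX \<otimes>\<^bsub>S\<^esub> sY) \<otimes>\<^bsub>S\<^esub> (sH [^]\<^bsub>S\<^esub> b)"
    using relations(4) by (metis S.inv_solve_left seifert_gen_in_carrier S.m_closed S.int_pow_closed)
  then have "sZ \<in> K"
    using K XY assms by (simp add: subgroup.m_closed subgroup.m_inv_closed S.subgroup_int_pow_closed)
  then have "seifert_gen_class a1 a2 a3 b b1 b2 b3 g \<in> K" for g
    using assms by (cases g) auto
  then show ?thesis by (rule seifert_group_generated[OF K])
qed

text \<open>The triangle group is the quotient of the Seifert group by the central subgroup \<open>\<langle>h\<rangle>\<close>.  The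
  inclusion of the kernel in \<open>\<langle>h\<rangle>\<close> holds because the projection to \<open>S Mod \<langle>h\<rangle>\<close> factors through \<open>N\<close>: the
  relations of the triangle group hold in \<open>S Mod \<langle>h\<rangle>\<close>, which yields a homomorphism \<open>M\<close> from the
  triangle group, and \<open>M \<circ> N\<close> is the projection since both agree on generators.\<close>
lemma kernel_over_triangle_group:
  fixes N
  defines "T \<equiv> triangle_group a1 a2 a3"
  assumes N: "N \<in> hom S T" "N sX = triangle_gen_class a1 a2 a3 TX" "N sY = triangle_gen_class a1 a2 a3 TY"
    "N sZ = triangle_gen_class a1 a2 a3 TZ" "N sH = \<one>\<^bsub>T\<^esub>"
    and s: "s \<in> carrier S" "N s = \<one>\<^bsub>T\<^esub>"
  obtains n :: int where "s = sH [^]\<^bsub>S\<^esub> n"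
proof -
  interpret T: group T unfolding T_def by (rule group_triangle_group)
  define K where "K = range (\<lambda>n :: int. sH [^]\<^bsub>S\<^esub> n)"
  have K: "subgroup K S"
  proof (rule S.subgroupI)
    fix x y assume "x \<in> K" "y \<in> K"
    then obtain m n where xy: "x = sH [^]\<^bsub>S\<^esub> (m :: int)" "y = sH [^]\<^bsub>S\<^esub> (n :: int)" by (auto simp: K_def)
    have "inv\<^bsub>S\<^esub> x = sH [^]\<^bsub>S\<^esub> (- m)" "x \<otimes>\<^bsub>S\<^esub> y = sH [^]\<^bsub>S\<^esub> (m + n)"
      by (simp_all add: xy S.int_pow_neg S.int_pow_mult)
    then show "inv\<^bsub>S\<^esub> x \<in> K" "x \<otimes>\<^bsub>S\<^esub> y \<in> K" unfolding K_def by blast+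
  qed (auto simp: K_def)
  interpret K: normal K S
  proof (rule S.normal_invI[OF K])
    fix x h assume x: "x \<in> carrier S" and "h \<in> K"
    then obtain n where h: "h = sH [^]\<^bsub>S\<^esub> (n :: int)" by (auto simp: K_def)
    have "h \<otimes>\<^bsub>S\<^esub> x = x \<otimes>\<^bsub>S\<^esub> h"
      unfolding h using x by (intro S.int_pow_commutes fibre_central) auto
    then have "x \<otimes>\<^bsub>S\<^esub> h \<otimes>\<^bsub>S\<^esub> inv\<^bsub>S\<^esub> x = h" using x h by (metis S.inv_solve_right' S.int_pow_closed S.m_closed seifert_gen_in_carrier)
    then show "x \<otimes>\<^bsub>S\<^esub> h \<otimes>\<^bsub>S\<^esub> inv\<^bsub>S\<^esub> x \<in> K" using \<open>h \<in> K\<close> by simp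
  qed
  let ?Q = "S Mod K"
  have Q: "group ?Q" by (rule K.factorgroup_is_group)
  have proj: "(\<lambda>s. K #>\<^bsub>S\<^esub> s) \<in> hom S ?Q" by (rule K.r_coset_hom_Mod)
  have triv: "K #>\<^bsub>S\<^esub> (sH [^]\<^bsub>S\<^esub> (n :: int)) = \<one>\<^bsub>?Q\<^esub>" for n
  proof -
    have "sH [^]\<^bsub>S\<^esub> n \<in> K" by (auto simp: K_def)
    then show ?thesis by (simp add: S.coset_join2[OF _ K])
  qed
  have rels: "(K #>\<^bsub>S\<^esub> sX) [^]\<^bsub>?Q\<^esub> int a1 = \<one>\<^bsub>?Q\<^esub>" "(K #>\<^bsub>S\<^esub> sY) [^]\<^bsub>?Q\<^esub> int a2 = \<one>\<^bsub>?Q\<^esub>"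
    "(K #>\<^bsub>S\<^esub> sZ) [^]\<^bsub>?Q\<^esub> int a3 = \<one>\<^bsub>?Q\<^esub>"
    by (simp_all only: K.FactGroup_int_pow seifert_gen_in_carrier relations triv)
  have rel: "(K #>\<^bsub>S\<^esub> sX) \<otimes>\<^bsub>?Q\<^esub> (K #>\<^bsub>S\<^esub> sY) \<otimes>\<^bsub>?Q\<^esub> (K #>\<^bsub>S\<^esub> sZ) = \<one>\<^bsub>?Q\<^esub>"
    by (simp only: hom_mult[OF proj, symmetric] S.m_closed seifert_gen_in_carrier relations triv)
  obtain M where M: "M \<in> hom T ?Q" "M (triangle_gen_class a1 a2 a3 TX) = K #>\<^bsub>S\<^esub> sX"
    "M (triangle_gen_class a1 a2 a3 TY) = K #>\<^bsub>S\<^esub> sY" "M (triangle_gen_class a1 a2 a3 TZ) = K #>\<^bsub>S\<^esub> sZ"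
    unfolding T_def
    by (rule triangle_group_hom_exists[OF Q _ _ _ rels rel]) (auto intro: hom_in_carrier[OF proj])
  have "(M \<circ> N) s = K #>\<^bsub>S\<^esub> s"
  proof (rule seifert_group_hom_ext[OF Q _ proj _ s(1)])
    show "M \<circ> N \<in> hom S ?Q" using N(1) M(1) by (rule hom_compose)
    show "(M \<circ> N) (seifert_gen_class a1 a2 a3 b b1 b2 b3 g) =
        K #>\<^bsub>S\<^esub> seifert_gen_class a1 a2 a3 b b1 b2 b3 g" for g
    proof (cases g)
      case SH
      have "M \<one>\<^bsub>T\<^esub> = \<one>\<^bsub>?Q\<^esub>" using M(1) T.is_group Q by (rule hom_one)
      then show ?thesis using triv[of 1] by (simp add: SH N)
    qed (simp_all add: N M)
  qed
  moreover have "M \<one>\<^bsub>T\<^esub> = \<one>\<^bsub>?Q\<^esub>" using M(1) T.is_group Q by (rule hom_one)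
  ultimately have "K #>\<^bsub>S\<^esub> s = K" by (simp add: s)
  then have "s \<in> K" using s(1) K by (rule S.coset_join1)
  then show ?thesis using that by (auto simp: K_def)
qed

end

text \<open>The integer \<open>- a1 a2 a3 e\<close>, where \<open>e\<close> is the Euler number.  Its absolute value is the order of the first
  homology of the Seifert fibered space if that is finite.\<close>
definition seifert_degree :: "nat \<Rightarrow> nat \<Rightarrow> nat \<Rightarrow> int \<Rightarrow> int \<Rightarrow> int \<Rightarrow> int \<Rightarrow> int" where
  "seifert_degree a1 a2 a3 b b1 b2 b3 =
     int a1 * int a2 * int a3 * b + int a2 * int a3 * b1 + int a1 * int a3 * b2 + int a1 * int a2 * b3"

lemma euler_number_eq_degree:
  assumes "a1 > 0" "a2 > 0" "a3 > 0"
  shows "of_nat (a1 * a2 * a3) * euler_number a1 a2 a3 b b1 b2 b3 =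
    - of_int (seifert_degree a1 a2 a3 b b1 b2 b3)"
  using assms by (simp add: euler_number_def seifert_degree_def field_simps)

lemma brieskorn_invariants_iff:
  assumes "a1 > 0" "a2 > 0" "a3 > 0"
  shows "brieskorn_invariants a1 a2 a3 b b1 b2 b3 \<longleftrightarrow> seifert_degree a1 a2 a3 b b1 b2 b3 = 1"
proof -
  have "of_nat (a1 * a2 * a3) * (of_int b + of_int b1 / of_nat a1 + of_int b2 / of_nat a2 + of_int b3 / of_nat a3) =
      (of_int (seifert_degree a1 a2 a3 b b1 b2 b3) :: rat)"
    using euler_number_eq_degree[OF assms, of b b1 b2 b3]
    unfolding euler_number_def mult_minus_right neg_equal_iff_equal .
  then show ?thesis unfolding brieskorn_invariants_def by simp
qed

lemma (in comm_group) coprime_exponents_trivial: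
  assumes x: "x \<in> carrier G" and "x [^] (m :: int) = \<one>" "x [^] (n :: int) = \<one>" and "m * u + n * v = 1"
  shows "x = \<one>"
proof -
  have "x = x [^] (m * u + n * v)" using assms by simp
  also have "\<dots> = (x [^] m) [^] u \<otimes> (x [^] n) [^] v"
    using x by (simp add: int_pow_mult int_pow_pow del: assms)
  finally show ?thesis using assms(2,3) by simp
qed

text \<open>The Seifert group of a homology sphere is perfect.  The products of powers of the relations give
  \<open>h^d = 1\<close> with \<open>d = 1\<close> the degree.  Then \<open>x^a1 = 1\<close> and \<open>x^(a2 a3) = (y z)^(- a2 a3) = 1\<close>, and the equation
  \<open>d = 1\<close> is a Bezout identity for the coprime exponents \<open>a1\<close> and \<open>a2 a3\<close>.\<close>
lemma (in comm_group) perfect_relations: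
  assumes c: "x \<in> carrier G" "y \<in> carrier G" "z \<in> carrier G" "h \<in> carrier G"
    and rels: "x [^] int a1 = h [^] (- b1)" "y [^] int a2 = h [^] (- b2)" "z [^] int a3 = h [^] (- b3)"
      "x \<otimes> y \<otimes> z = h [^] b"
    and deg: "seifert_degree a1 a2 a3 b b1 b2 b3 = 1"
  shows "x = \<one> \<and> y = \<one> \<and> z = \<one> \<and> h = \<one>"
proof -
  have xyz: "x [^] n \<otimes> y [^] n \<otimes> z [^] n = h [^] (b * n)" for n :: int
    using arg_cong[OF rels(4), of "\<lambda>g. g [^] n"] c by (simp add: int_pow_distrib int_pow_pow)
  have X': "x [^] (int a1 * n) = h [^] (- b1 * n)" and Y: "y [^] (int a2 * n) = h [^] (- b2 * n)"
    and Z: "z [^] (int a3 * n) = h [^] (- b3 * n)" for n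
    using c rels(1-3)[THEN arg_cong, of "\<lambda>g. g [^] n"] by (simp_all only: int_pow_pow)
  have "h [^] (b * (int a1 * int a2 * int a3)) =
      h [^] (- b1 * (int a2 * int a3) + - b2 * (int a1 * int a3) + - b3 * (int a1 * int a2))"
    using xyz[of "int a1 * int a2 * int a3"] X'[of "int a2 * int a3"] Y[of "int a1 * int a3"] Z[of "int a1 * int a2"] c
    by (simp only: int_pow_mult m_closed int_pow_closed) (simp add: mult.commute mult.left_commute)
  then have "h [^] (b * (int a1 * int a2 * int a3) -
      (- b1 * (int a2 * int a3) + - b2 * (int a1 * int a3) + - b3 * (int a1 * int a2))) = \<one>"
    using c by (simp only: int_pow_diff r_inv int_pow_closed)
  moreover have "b * (int a1 * int a2 * int a3) -
      (- b1 * (int a2 * int a3) + - b2 * (int a1 * int a3) + - b3 * (int a1 * int a2)) = 1"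
    using deg by (simp add: seifert_degree_def algebra_simps)
  ultimately have h: "h = \<one>" using c by simp
  have x1: "x [^] (int a1 * n) = \<one>" and y1: "y [^] (int a2 * n) = \<one>" and z1: "z [^] (int a3 * n) = \<one>" for n
    using X' Y Z by (simp_all add: h)
  have xyz1: "x [^] n \<otimes> y [^] n \<otimes> z [^] n = \<one>" for n :: int
    using xyz by (simp add: h)
  have "x [^] (int a2 * int a3) = \<one>"
    using xyz1[of "int a2 * int a3"] y1[of "int a3"] z1[of "int a2"] c by (simp add: mult.commute)
  then have x: "x = \<one>"
    using x1[of 1] c deg
    by (intro coprime_exponents_trivial[of x "int a1" "int a2 * int a3" "int a2 * int a3 * b + int a3 * b2 + int a2 * b3" b1])
       (auto simp: seifert_degree_def algebra_simps)
  have "y [^] (int a1 * int a3) = \<one>"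
    using xyz1[of "int a1 * int a3"] z1[of "int a1"] c by (simp add: mult.commute x)
  then have y: "y = \<one>"
    using y1[of 1] c deg
    by (intro coprime_exponents_trivial[of y "int a2" "int a1 * int a3" "int a1 * int a3 * b + int a3 * b1 + int a1 * b3" b2])
       (auto simp: seifert_degree_def algebra_simps)
  have "z = \<one>" using rels(4) c by (simp add: x y h)
  with x y h show ?thesis by simp
qed

lemma seifert_hom_to_comm_group_trivial:
  assumes A: "comm_group A" and F: "F \<in> hom (seifert_group a1 a2 a3 b b1 b2 b3) A"
    and deg: "seifert_degree a1 a2 a3 b b1 b2 b3 = 1"
    and s: "s \<in> carrier (seifert_group a1 a2 a3 b b1 b2 b3)"
  shows "F s = \<one>\<^bsub>A\<^esub>"
proof -
  interpret seifert a1 a2 a3 b b1 b2 b3 .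
  interpret A: comm_group A by fact
  interpret F: group_hom S A F
    using F by (simp add: group_hom_def group_hom_axioms_def S.is_group A.is_group)
  have "F sX = \<one>\<^bsub>A\<^esub> \<and> F sY = \<one>\<^bsub>A\<^esub> \<and> F sZ = \<one>\<^bsub>A\<^esub> \<and> F sH = \<one>\<^bsub>A\<^esub>"
    using relations(1-4)[THEN arg_cong, of F]
    by (intro A.perfect_relations[OF _ _ _ _ _ _ _ _ deg])
      (simp_all add: F.hom_int_pow F.hom_mult)
  then have "F (seifert_gen_class a1 a2 a3 b b1 b2 b3 g) = \<one>\<^bsub>A\<^esub>" for g
    by (cases g) auto
  then show ?thesis
    using seifert_group_hom_ext[OF A.is_group F, of "\<lambda>_. \<one>\<^bsub>A\<^esub>"] s by (simp add: hom_def)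
qed

section \<open>The pullback extension\<close>

text \<open>Commutators ignore central factors; thus a subgroup that generates a group together with
  central elements contains all commutators.\<close>
lemma (in group) commutator_modulo_center:
  assumes c: "a \<in> carrier G" "b \<in> carrier G" "z \<in> carrier G" "z' \<in> carrier G"
    and z: "\<And>x. x \<in> carrier G \<Longrightarrow> z \<otimes> x = x \<otimes> z" and z': "\<And>x. x \<in> carrier G \<Longrightarrow> z' \<otimes> x = x \<otimes> z'"
  shows "(z \<otimes> a) \<otimes> (z' \<otimes> b) \<otimes> inv (z \<otimes> a) \<otimes> inv (z' \<otimes> b) = a \<otimes> b \<otimes> inv a \<otimes> inv b"
proof -
  define w where "w = z \<otimes> z'"
  have w_in: "w \<in> carrier G" using c by (simp add: w_def)
  have w: "w \<otimes> x = x \<otimes> w" if "x \<in> carrier G" for x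
    unfolding w_def using that c z z' by (metis m_assoc)
  have ab: "(z \<otimes> a) \<otimes> (z' \<otimes> b) = a \<otimes> b \<otimes> w"
    using c z z' unfolding w_def by (metis m_assoc m_closed)
  have "(z' \<otimes> b) \<otimes> (z \<otimes> a) = b \<otimes> a \<otimes> w"
    using c z z' unfolding w_def by (metis m_assoc m_closed)
  then have "inv (z \<otimes> a) \<otimes> inv (z' \<otimes> b) = inv w \<otimes> (inv a \<otimes> inv b)"
    using c w_in by (simp add: inv_mult_group[symmetric] m_assoc[symmetric])
  moreover have "w \<otimes> (inv w \<otimes> x) = x" if "x \<in> carrier G" for x
    using that w_in by (simp add: m_assoc[symmetric])
  ultimately show ?thesis using ab c w_in by (simp add: m_assoc)
qed

text \<open>A homomorphism \<open>f\<close> from the triangle group to \<open>PSL(2;\<real>)\<close> together with lifts of the images of the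
  generators to the universal cover.  The integers \<open>\<beta>, \<beta>1, \<beta>2, \<beta>3\<close> measure how far the lifts are from
  satisfying the relations of the triangle group.\<close>
locale lifted_triangle =
  fixes a1 a2 a3 :: nat and f :: "triangle_gen word set \<Rightarrow> (real ^ 2 ^ 2) set"
    and gx gy gz :: "real \<Rightarrow> real" and \<beta> \<beta>1 \<beta>2 \<beta>3 :: int
  assumes f_hom: "f \<in> hom (triangle_group a1 a2 a3) PSL2R"
    and lift: "gx \<in> carrier PSL2R_cover" "gy \<in> carrier PSL2R_cover" "gz \<in> carrier PSL2R_cover"
    and f_gen: "f (triangle_gen_class a1 a2 a3 TX) = cover_to_PSL2R gx"
      "f (triangle_gen_class a1 a2 a3 TY) = cover_to_PSL2R gy"
      "f (triangle_gen_class a1 a2 a3 TZ) = cover_to_PSL2R gz"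
    and lift_rel: "gx [^]\<^bsub>PSL2R_cover\<^esub> int a1 = sh (of_int (- \<beta>1))"
      "gy [^]\<^bsub>PSL2R_cover\<^esub> int a2 = sh (of_int (- \<beta>2))"
      "gz [^]\<^bsub>PSL2R_cover\<^esub> int a3 = sh (of_int (- \<beta>3))"
      "gx \<circ> gy \<circ> gz = sh (of_int \<beta>)"
begin

abbreviation "T \<equiv> triangle_group a1 a2 a3"
abbreviation "E \<equiv> pullback_extension T f"
abbreviation "tx \<equiv> triangle_gen_class a1 a2 a3 TX"
abbreviation "ty \<equiv> triangle_gen_class a1 a2 a3 TY"
abbreviation "tz \<equiv> triangle_gen_class a1 a2 a3 TZ"

sublocale T: group T by (rule group_triangle_group)
sublocale C: group PSL2R_cover by (rule group_PSL2R_cover)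
sublocale P: group PSL2R by (rule group_PSL2R)
sublocale f: group_hom T PSL2R f
  by (simp add: group_hom_def group_hom_axioms_def f_hom T.is_group P.is_group)
sublocale c: group_hom PSL2R_cover PSL2R cover_to_PSL2R
  by (simp add: group_hom_def group_hom_axioms_def cover_to_PSL2R_hom C.is_group P.is_group)

lemma carrier_E:
  "(\<gamma>, g) \<in> carrier E \<longleftrightarrow> \<gamma> \<in> carrier T \<and> g \<in> carrier PSL2R_cover \<and> f \<gamma> = cover_to_PSL2R g"
  by (simp add: pullback_extension_def)

lemma mult_E [simp]: "(\<gamma>, g) \<otimes>\<^bsub>E\<^esub> (\<delta>, k) = (\<gamma> \<otimes>\<^bsub>T\<^esub> \<delta>, g \<circ> k)"
  and one_E [simp]: "\<one>\<^bsub>E\<^esub> = (\<one>\<^bsub>T\<^esub>, id)"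
  by (simp_all add: pullback_extension_def)

lemma group_E: "group E"
proof -
  interpret D: group "T \<times>\<times> PSL2R_cover"
    by (rule DirProd_group[OF T.is_group C.is_group])
  have "subgroup {(\<gamma>, g). \<gamma> \<in> carrier T \<and> g \<in> carrier PSL2R_cover \<and> f \<gamma> = cover_to_PSL2R g} (T \<times>\<times> PSL2R_cover)"
  proof (rule D.subgroupI)
    show "{(\<gamma>, g). \<gamma> \<in> carrier T \<and> g \<in> carrier PSL2R_cover \<and> f \<gamma> = cover_to_PSL2R g} \<noteq> {}"
      using f.hom_one c.hom_one C.one_closed T.one_closed by force
  qed (auto simp: inv_DirProd[OF T.is_group C.is_group] simp del: mult_PSL2R_cover one_PSL2R_cover)
  then show ?thesis unfolding pullback_extension_def by (rule D.subgroup_imp_group)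
qed

sublocale E: group E by (rule group_E)

lemma fst_hom: "fst \<in> hom E T" and snd_hom: "snd \<in> hom E PSL2R_cover"
  by (auto simp: hom_def carrier_E)

lemma pow_E:
  assumes "(\<gamma>, g) \<in> carrier E"
  shows "(\<gamma>, g) [^]\<^bsub>E\<^esub> (n :: int) = (\<gamma> [^]\<^bsub>T\<^esub> n, g [^]\<^bsub>PSL2R_cover\<^esub> n)"
  using hom_int_pow[OF fst_hom assms E.is_group T.is_group, of n]
    hom_int_pow[OF snd_hom assms E.is_group C.is_group, of n]
  by (metis fst_conv snd_conv prod.collapse)

lemma sh_in_E [simp]: "(\<one>\<^bsub>T\<^esub>, sh (of_int n)) \<in> carrier E"
  using f.hom_one by (simp add: carrier_E cover_to_PSL2R_sh)

lemma sh_pow_E: "(\<one>\<^bsub>T\<^esub>, sh (of_int m)) [^]\<^bsub>E\<^esub> (n :: int) = (\<one>\<^bsub>T\<^esub>, sh (of_int (m * n)))"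
  by (simp only: pow_E[OF sh_in_E] T.int_pow_one PSL2R_cover_sh_pow)

lemma cover_comm_sh:
  "g \<in> carrier PSL2R_cover \<Longrightarrow> g \<circ> sh (of_int n) = sh (of_int n) \<circ> g"
  using carrier_PSL2R_cover oriented_lift_comm_sh by blast

lemma sh_central_E: "e \<in> carrier E \<Longrightarrow> (\<one>\<^bsub>T\<^esub>, sh (of_int n)) \<otimes>\<^bsub>E\<^esub> e = e \<otimes>\<^bsub>E\<^esub> (\<one>\<^bsub>T\<^esub>, sh (of_int n))"
  by (cases e) (simp add: carrier_E cover_comm_sh)

lemma triangle_relations:
  "tx [^]\<^bsub>T\<^esub> int a1 = \<one>\<^bsub>T\<^esub>" "ty [^]\<^bsub>T\<^esub> int a2 = \<one>\<^bsub>T\<^esub>" "tz [^]\<^bsub>T\<^esub> int a3 = \<one>\<^bsub>T\<^esub>"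
  "tx \<otimes>\<^bsub>T\<^esub> ty \<otimes>\<^bsub>T\<^esub> tz = \<one>\<^bsub>T\<^esub>"
proof -
  have gens: "range (triangle_gen_class a1 a2 a3) \<subseteq> carrier T" by auto
  have rel: "word_val T (triangle_gen_class a1 a2 a3) u = word_val T (triangle_gen_class a1 a2 a3) v"
    if "(u, v) \<in> triangle_rels a1 a2 a3" for u v
    using presented_group_rel[OF that] by (simp add: triangle_group_def triangle_gen_class_def[abs_def])
  note ev = T.word_val_letter_pow[OF gens] T.word_val_append[OF gens] T.word_val_letter[OF gens] word_val.simps(1)
  show "tx [^]\<^bsub>T\<^esub> int a1 = \<one>\<^bsub>T\<^esub>" "ty [^]\<^bsub>T\<^esub> int a2 = \<one>\<^bsub>T\<^esub>" "tz [^]\<^bsub>T\<^esub> int a3 = \<one>\<^bsub>T\<^esub>"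
    using rel[of "letter_pow TX (int a1)" "[]"] rel[of "letter_pow TY (int a2)" "[]"]
      rel[of "letter_pow TZ (int a3)" "[]"]
    unfolding ev by (simp_all add: triangle_rels_def)
  show "tx \<otimes>\<^bsub>T\<^esub> ty \<otimes>\<^bsub>T\<^esub> tz = \<one>\<^bsub>T\<^esub>"
    using rel[of "letter TX @ letter TY @ letter TZ" "[]"]
    unfolding ev by (simp add: triangle_rels_def T.m_assoc)
qed

text \<open>Homomorphisms from a Seifert group to the pullback extension \<open>E\<close> that cover the identity of the
  triangle group and send the fibre to \<open>sh(m)\<close>.  The case \<open>m = 1\<close> gives a presentation of \<open>E\<close>; the case
  where \<open>m\<close> is the degree of the universal abelian cover gives the inclusion of the commutator
  subgroup.\<close>
lemma hom_over_identity_exists: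
  assumes k: "kx \<in> carrier PSL2R_cover" "ky \<in> carrier PSL2R_cover" "kz \<in> carrier PSL2R_cover"
    and over: "cover_to_PSL2R kx = f tx" "cover_to_PSL2R ky = f ty" "cover_to_PSL2R kz = f tz"
    and rels: "kx [^]\<^bsub>PSL2R_cover\<^esub> int a1 = sh (of_int (m * - c1))"
      "ky [^]\<^bsub>PSL2R_cover\<^esub> int a2 = sh (of_int (m * - c2))"
      "kz [^]\<^bsub>PSL2R_cover\<^esub> int a3 = sh (of_int (m * - c3))"
      "kx \<circ> ky \<circ> kz = sh (of_int (m * c))"
  obtains q where "q \<in> hom (seifert_group a1 a2 a3 c c1 c2 c3) E"
    "q (seifert_gen_class a1 a2 a3 c c1 c2 c3 SX) = (tx, kx)"
    "q (seifert_gen_class a1 a2 a3 c c1 c2 c3 SY) = (ty, ky)"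
    "q (seifert_gen_class a1 a2 a3 c c1 c2 c3 SZ) = (tz, kz)"
    "q (seifert_gen_class a1 a2 a3 c c1 c2 c3 SH) = (\<one>\<^bsub>T\<^esub>, sh (of_int m))"
proof -
  have mem: "(tx, kx) \<in> carrier E" "(ty, ky) \<in> carrier E" "(tz, kz) \<in> carrier E"
    using k over by (simp_all add: carrier_E)
  show ?thesis
  proof (rule seifert_group_hom_exists[OF E.is_group mem sh_in_E[of m] mem[THEN sh_central_E]])
    show "(tx, kx) [^]\<^bsub>E\<^esub> int a1 = (\<one>\<^bsub>T\<^esub>, sh (of_int m)) [^]\<^bsub>E\<^esub> (- c1)"
      "(ty, ky) [^]\<^bsub>E\<^esub> int a2 = (\<one>\<^bsub>T\<^esub>, sh (of_int m)) [^]\<^bsub>E\<^esub> (- c2)"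
      "(tz, kz) [^]\<^bsub>E\<^esub> int a3 = (\<one>\<^bsub>T\<^esub>, sh (of_int m)) [^]\<^bsub>E\<^esub> (- c3)"
      "(tx, kx) \<otimes>\<^bsub>E\<^esub> (ty, ky) \<otimes>\<^bsub>E\<^esub> (tz, kz) = (\<one>\<^bsub>T\<^esub>, sh (of_int m)) [^]\<^bsub>E\<^esub> c"
      by (simp_all only: mem pow_E sh_pow_E rels mult_E triangle_relations)
  qed (rule that)
qed

text \<open>The kernel lies over the identity, hence in \<open>\<langle>h\<rangle>\<close>, and the image \<open>sh(m)\<close> of \<open>h\<close> has infinite order.\<close>
lemma hom_over_identity_mono:
  fixes q and c c1 c2 c3 :: int
  defines "sg \<equiv> seifert_gen_class a1 a2 a3 c c1 c2 c3"
  assumes q: "q \<in> hom (seifert_group a1 a2 a3 c c1 c2 c3) E"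
    and gens: "fst (q (sg SX)) = tx" "fst (q (sg SY)) = ty" "fst (q (sg SZ)) = tz"
      "q (sg SH) = (\<one>\<^bsub>T\<^esub>, sh (of_int m))"
    and m: "m \<noteq> 0"
  shows "q \<in> mon (seifert_group a1 a2 a3 c c1 c2 c3) E"
proof -
  interpret seifert a1 a2 a3 c c1 c2 c3 .
  show ?thesis
    unfolding mon_iff_hom_one[OF S.is_group E.is_group]
  proof (intro conjI allI impI q)
    fix s assume s: "s \<in> carrier S \<and> q s = \<one>\<^bsub>E\<^esub>"
    have "fst \<circ> q \<in> hom S T" using q fst_hom by (rule hom_compose)
    then obtain n :: int where n: "s = sH [^]\<^bsub>S\<^esub> n"
      by (rule kernel_over_triangle_group) (use s gens in \<open>auto simp: sg_def\<close>)
    have "(\<one>\<^bsub>T\<^esub>, sh (of_int (m * n))) = \<one>\<^bsub>E\<^esub>"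
      using s hom_int_pow[OF q _ S.is_group E.is_group, of sH n] gens(4)
      by (simp add: n sg_def sh_pow_E del: of_int_mult)
    then have "sh (of_int (m * n)) 0 = 0" by simp
    then have "n = 0" using m by (simp add: sh_def)
    then show "s = \<one>\<^bsub>S\<^esub>" by (simp add: n)
  qed
qed

text \<open>Two elements of \<open>E\<close> over the same element of the triangle group differ by an integer
  translation.\<close>
lemma hom_over_identity_covers:
  fixes q and c c1 c2 c3 :: int
  defines "sg \<equiv> seifert_gen_class a1 a2 a3 c c1 c2 c3"
  assumes q: "q \<in> hom (seifert_group a1 a2 a3 c c1 c2 c3) E"
    and gens: "fst (q (sg SX)) = tx" "fst (q (sg SY)) = ty" "fst (q (sg SZ)) = tz"
    and e: "e \<in> carrier E"
  obtains n :: int and s where "s \<in> carrier (seifert_group a1 a2 a3 c c1 c2 c3)"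
    "e = (\<one>\<^bsub>T\<^esub>, sh (of_int n)) \<otimes>\<^bsub>E\<^esub> q s"
proof -
  interpret seifert a1 a2 a3 c c1 c2 c3 .
  interpret F: group_hom S T "fst \<circ> q"
    using hom_compose[OF q fst_hom] by (simp add: group_hom_def group_hom_axioms_def S.is_group T.is_group)
  have "(fst \<circ> q) ` carrier S = carrier T"
  proof (rule triangle_group_generated[OF F.img_is_subgroup])
    show "triangle_gen_class a1 a2 a3 g \<in> (fst \<circ> q) ` carrier S" for g
      using gens by (cases g) (force simp: sg_def intro: image_eqI[OF _ seifert_gen_in_carrier])+
  qed
  moreover obtain \<gamma> g where e': "e = (\<gamma>, g)" by (cases e)
  ultimately obtain s where s: "s \<in> carrier S" "\<gamma> = fst (q s)"
  proof -
    assume *: "\<And>s. s \<in> carrier S \<Longrightarrow> \<gamma> = fst (q s) \<Longrightarrow> thesis"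
    assume "(fst \<circ> q) ` carrier S = carrier T" and "e = (\<gamma>, g)"
    then have "\<gamma> \<in> (fst \<circ> q) ` carrier S" using e by (simp add: carrier_E)
    then show thesis using * by auto
  qed
  obtain k where k: "q s = (\<gamma>, k)" using s(2) by (cases "q s") auto
  have "q s \<in> carrier E" using q s(1) by (rule hom_in_carrier)
  then have "k \<in> carrier PSL2R_cover" "cover_to_PSL2R k = cover_to_PSL2R g"
    using e by (simp_all add: k e' carrier_E)
  then obtain n :: int where "g = sh (of_int n) \<circ> k" by (rule cover_to_PSL2R_fibre)
  then have "e = (\<one>\<^bsub>T\<^esub>, sh (of_int n)) \<otimes>\<^bsub>E\<^esub> q s"
    using e by (simp add: e' k carrier_E)
  then show ?thesis using s(1) that by blast
qed

lemma seifert_presentation_exists: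
  obtains \<psi> where "seifert_presentation a1 a2 a3 f \<beta> \<beta>1 \<beta>2 \<beta>3 \<psi>"
proof -
  interpret seifert a1 a2 a3 \<beta> \<beta>1 \<beta>2 \<beta>3 .
  obtain \<psi> where \<psi>: "\<psi> \<in> hom S E" "\<psi> sX = (tx, gx)" "\<psi> sY = (ty, gy)" "\<psi> sZ = (tz, gz)"
    "\<psi> sH = (\<one>\<^bsub>T\<^esub>, sh (of_int 1))"
    by (rule hom_over_identity_exists[where m = 1, OF lift f_gen[symmetric]]) (simp_all only: lift_rel mult_1)
  have mon: "\<psi> \<in> mon S E" by (rule hom_over_identity_mono[where m = 1]) (simp_all add: \<psi>)
  have "carrier E \<subseteq> \<psi> ` carrier S"
  proof
    fix e assume "e \<in> carrier E"
    then obtain n :: int and s where s: "s \<in> carrier S" "e = (\<one>\<^bsub>T\<^esub>, sh (of_int n)) \<otimes>\<^bsub>E\<^esub> \<psi> s"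
      using hom_over_identity_covers[OF \<psi>(1)] \<psi> by (metis fst_conv)
    have "\<psi> (sH [^]\<^bsub>S\<^esub> n) = (\<one>\<^bsub>T\<^esub>, sh (of_int n))"
      using hom_int_pow[OF \<psi>(1) _ S.is_group E.is_group, of sH n] sh_pow_E[of 1 n] by (simp add: \<psi>)
    then have "e = \<psi> (sH [^]\<^bsub>S\<^esub> n \<otimes>\<^bsub>S\<^esub> s)"
      using s hom_mult[OF \<psi>(1), of "sH [^]\<^bsub>S\<^esub> n" s] by simp
    moreover have "sH [^]\<^bsub>S\<^esub> n \<otimes>\<^bsub>S\<^esub> s \<in> carrier S" using s(1) by simp
    ultimately show "e \<in> \<psi> ` carrier S" by (metis imageI)
  qed
  then have "\<psi> \<in> iso S E"
    using mon hom_in_carrier[OF \<psi>(1)] by (auto simp: iso_iff mon_def)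
  then have "seifert_presentation a1 a2 a3 f \<beta> \<beta>1 \<beta>2 \<beta>3 \<psi>"
    unfolding seifert_presentation_def pullback_central_def by (simp add: \<psi>)
  then show ?thesis by (rule that)
qed

text \<open>The image is contained in the commutator subgroup because the abelianisation of \<open>E\<close> receives
  only the trivial homomorphism from a perfect group.  It contains the commutator subgroup because
  it generates \<open>E\<close> together with the central translations.\<close>
lemma hom_over_identity_image:
  fixes q and c c1 c2 c3 :: int
  defines "sg \<equiv> seifert_gen_class a1 a2 a3 c c1 c2 c3"
  assumes q: "q \<in> hom (seifert_group a1 a2 a3 c c1 c2 c3) E"
    and gens: "fst (q (sg SX)) = tx" "fst (q (sg SY)) = ty" "fst (q (sg SZ)) = tz"
    and deg: "seifert_degree a1 a2 a3 c c1 c2 c3 = 1"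
  shows "q ` carrier (seifert_group a1 a2 a3 c c1 c2 c3) = derived E (carrier E)"
proof
  interpret seifert a1 a2 a3 c c1 c2 c3 .
  interpret q: group_hom S E q
    using q by (simp add: group_hom_def group_hom_axioms_def S.is_group E.is_group)
  let ?D = "derived E (carrier E)"
  have D: "?D \<lhd> E" by (rule E.derived_self_is_normal)
  have ab: "(\<lambda>e. ?D #>\<^bsub>E\<^esub> e) \<circ> q \<in> hom S (E Mod ?D)"
    using q normal.r_coset_hom_Mod[OF D] by (rule hom_compose)
  show "q ` carrier S \<subseteq> ?D"
  proof (rule image_subsetI)
    fix s assume s: "s \<in> carrier S"
    have "?D #>\<^bsub>E\<^esub> q s = ?D"
      using seifert_hom_to_comm_group_trivial[OF E.derived_quot_is_comm_group ab deg s] by simp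
    then show "q s \<in> ?D"
      using q.hom_closed[OF s] normal_imp_subgroup[OF D] by (rule E.coset_join1)
  qed
  have "derived_set E (carrier E) \<subseteq> q ` carrier S"
  proof
    fix x assume "x \<in> derived_set E (carrier E)"
    then obtain e e' where e: "e \<in> carrier E" "e' \<in> carrier E"
      and x: "x = e \<otimes>\<^bsub>E\<^esub> e' \<otimes>\<^bsub>E\<^esub> inv\<^bsub>E\<^esub> e \<otimes>\<^bsub>E\<^esub> inv\<^bsub>E\<^esub> e'" by blast
    obtain n s where s: "s \<in> carrier S" "e = (\<one>\<^bsub>T\<^esub>, sh (of_int n)) \<otimes>\<^bsub>E\<^esub> q s"
      using hom_over_identity_covers[OF q gens[unfolded sg_def] e(1)] .
    obtain n' s' where s': "s' \<in> carrier S" "e' = (\<one>\<^bsub>T\<^esub>, sh (of_int n')) \<otimes>\<^bsub>E\<^esub> q s'"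
      using hom_over_identity_covers[OF q gens[unfolded sg_def] e(2)] .
    let ?z = "(\<one>\<^bsub>T\<^esub>, sh (of_int n))" and ?z' = "(\<one>\<^bsub>T\<^esub>, sh (of_int n'))"
    have "e \<otimes>\<^bsub>E\<^esub> e' \<otimes>\<^bsub>E\<^esub> inv\<^bsub>E\<^esub> e \<otimes>\<^bsub>E\<^esub> inv\<^bsub>E\<^esub> e' =
        q s \<otimes>\<^bsub>E\<^esub> q s' \<otimes>\<^bsub>E\<^esub> inv\<^bsub>E\<^esub> q s \<otimes>\<^bsub>E\<^esub> inv\<^bsub>E\<^esub> q s'"
      unfolding s(2) s'(2) using s(1) s'(1)
      by (intro E.commutator_modulo_center) (simp_all only: sh_in_E sh_central_E q.hom_closed)
    also have "\<dots> = q (s \<otimes>\<^bsub>S\<^esub> s' \<otimes>\<^bsub>S\<^esub> inv\<^bsub>S\<^esub> s \<otimes>\<^bsub>S\<^esub> inv\<^bsub>S\<^esub> s')"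
      using s(1) s'(1) by (simp del: mult_E)
    finally show "x \<in> q ` carrier S"
      unfolding x using s(1) s'(1) by (metis S.inv_closed S.m_closed imageI)
  qed
  then show "?D \<subseteq> q ` carrier S"
    unfolding derived_def using q.img_is_subgroup by (rule E.generate_subgroup_incl)
qed

text \<open>The degree \<open>d\<close> satisfies \<open>d \<equiv> \<beta>1 a2 a3 (mod a1)\<close>, while \<open>b1 a2 a3 \<equiv> 1 (mod a1)\<close>.  So
  \<open>\<beta>1 - d b1 = a1 m1\<close> for some integer \<open>m1\<close>, and \<open>sh(m1) gx\<close> has \<open>a1\<close>-th power \<open>sh(- d b1)\<close>, as
  required of the image of \<open>x\<close> if \<open>h\<close> goes to \<open>sh(d)\<close>.  The same holds for \<open>y\<close> and \<open>z\<close>, and the last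
  relation follows by adding up.\<close>
lemma abelian_cover_hom_exists:
  defines "d \<equiv> seifert_degree a1 a2 a3 \<beta> \<beta>1 \<beta>2 \<beta>3"
  assumes pos: "a1 > 0" "a2 > 0" "a3 > 0"
    and deg: "seifert_degree a1 a2 a3 b b1 b2 b3 = 1" and d: "d > 0"
  obtains p where
    "abelian_cover_hom a1 a2 a3 b b1 b2 b3 f (euler_number a1 a2 a3 \<beta> \<beta>1 \<beta>2 \<beta>3) p"
    "\<And>g. fst (p (seifert_gen_class a1 a2 a3 b b1 b2 b3 g)) =
       (case g of SX \<Rightarrow> tx | SY \<Rightarrow> ty | SZ \<Rightarrow> tz | SH \<Rightarrow> \<one>\<^bsub>T\<^esub>)"
proof -
  interpret seifert a1 a2 a3 b b1 b2 b3 .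
  define m1 where "m1 = \<beta>1 * (int a2 * int a3 * b + int a3 * b2 + int a2 * b3) -
    b1 * (int a2 * int a3 * \<beta> + int a3 * \<beta>2 + int a2 * \<beta>3)"
  define m2 where "m2 = \<beta>2 * (int a1 * int a3 * b + int a3 * b1 + int a1 * b3) -
    b2 * (int a1 * int a3 * \<beta> + int a3 * \<beta>1 + int a1 * \<beta>3)"
  define m3 where "m3 = \<beta>3 * (int a1 * int a2 * b + int a2 * b1 + int a1 * b2) -
    b3 * (int a1 * int a2 * \<beta> + int a2 * \<beta>1 + int a1 * \<beta>2)"
  \<comment> \<open>The equations hold for all integers; inserting degree 1 afterwards gives the divisions by
    \<open>a1\<close>, \<open>a2\<close> and \<open>a3\<close>.\<close>
  have "int a1 * m1 = \<beta>1 * seifert_degree a1 a2 a3 b b1 b2 b3 - d * b1"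
    "int a2 * m2 = \<beta>2 * seifert_degree a1 a2 a3 b b1 b2 b3 - d * b2"
    "int a3 * m3 = \<beta>3 * seifert_degree a1 a2 a3 b b1 b2 b3 - d * b3"
    by (simp_all add: m1_def m2_def m3_def d_def seifert_degree_def algebra_simps)
  then have m: "int a1 * m1 = \<beta>1 - d * b1" "int a2 * m2 = \<beta>2 - d * b2" "int a3 * m3 = \<beta>3 - d * b3"
    by (simp_all add: deg)
  have "int a1 * int a2 * int a3 * (m1 + m2 + m3 + \<beta>) =
      int a2 * int a3 * (int a1 * m1) + int a1 * int a3 * (int a2 * m2) + int a1 * int a2 * (int a3 * m3) +
      int a1 * int a2 * int a3 * \<beta>"
    by (simp add: algebra_simps)
  also have "\<dots> = d - d * (int a2 * int a3 * b1 + int a1 * int a3 * b2 + int a1 * int a2 * b3)"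
    unfolding m by (simp add: d_def seifert_degree_def algebra_simps)
  also have "\<dots> = d - d * (seifert_degree a1 a2 a3 b b1 b2 b3 - int a1 * int a2 * int a3 * b)"
    by (simp add: seifert_degree_def)
  also have "\<dots> = int a1 * int a2 * int a3 * (d * b)"
    by (simp add: deg algebra_simps)
  finally have msum: "m1 + m2 + m3 + \<beta> = d * b" using pos by simp
  have shift: "sh (of_int k) \<circ> g \<in> carrier PSL2R_cover"
    "cover_to_PSL2R (sh (of_int k) \<circ> g) = cover_to_PSL2R g"
    "(sh (of_int k) \<circ> g) [^]\<^bsub>PSL2R_cover\<^esub> n = sh (of_int (k * n)) \<circ> g [^]\<^bsub>PSL2R_cover\<^esub> n"
    if g: "g \<in> carrier PSL2R_cover" for g k and n :: int
  proof -
    show "sh (of_int k) \<circ> g \<in> carrier PSL2R_cover"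
      using C.m_closed[OF sh_in_cover g] by simp
    show "cover_to_PSL2R (sh (of_int k) \<circ> g) = cover_to_PSL2R g"
      using c.hom_mult[OF sh_in_cover g, of k] g by (simp add: cover_to_PSL2R_sh)
    show "(sh (of_int k) \<circ> g) [^]\<^bsub>PSL2R_cover\<^esub> n = sh (of_int (k * n)) \<circ> g [^]\<^bsub>PSL2R_cover\<^esub> n"
      using C.int_pow_mult_distrib[OF _ sh_in_cover g, of k n] cover_comm_sh[OF g, of k]
      by (simp add: PSL2R_cover_sh_pow)
  qed
  have pow: "sh (of_int (k * n)) \<circ> sh (of_int (- c)) = sh (of_int (d * - e))" if "n * k = c - d * e" for k n c e
  proof -
    have "k * n + - c = d * - e" using that by (simp add: algebra_simps)
    then show ?thesis by (simp only: sh_comp flip: of_int_add)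
  qed
  have prod: "(sh (of_int m1) \<circ> gx) \<circ> (sh (of_int m2) \<circ> gy) \<circ> (sh (of_int m3) \<circ> gz) = sh (of_int (d * b))"
  proof
    fix t
    have comm: "g (s + of_int k) = g s + of_int k" if "g \<in> carrier PSL2R_cover" for g s k
      using fun_cong[OF cover_comm_sh[OF that, of k], of s] by (simp add: sh_def)
    have "gx (gy (gz t)) = t + of_int \<beta>"
      using fun_cong[OF lift_rel(4), of t] by (simp add: sh_def)
    then show "((sh (of_int m1) \<circ> gx) \<circ> (sh (of_int m2) \<circ> gy) \<circ> (sh (of_int m3) \<circ> gz)) t =
        sh (of_int (d * b)) t"
      by (simp add: sh_def comm lift flip: msum)
  qed
  obtain p where p: "p \<in> hom S E" "p sX = (tx, sh (of_int m1) \<circ> gx)" "p sY = (ty, sh (of_int m2) \<circ> gy)"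
    "p sZ = (tz, sh (of_int m3) \<circ> gz)" "p sH = (\<one>\<^bsub>T\<^esub>, sh (of_int d))"
  proof (rule hom_over_identity_exists[where m = d, OF shift(1)[OF lift(1)] shift(1)[OF lift(2)] shift(1)[OF lift(3)]])
    show "(sh (of_int m1) \<circ> gx) [^]\<^bsub>PSL2R_cover\<^esub> int a1 = sh (of_int (d * - b1))"
      unfolding shift(3)[OF lift(1)] lift_rel by (rule pow[OF m(1)])
    show "(sh (of_int m2) \<circ> gy) [^]\<^bsub>PSL2R_cover\<^esub> int a2 = sh (of_int (d * - b2))"
      unfolding shift(3)[OF lift(2)] lift_rel by (rule pow[OF m(2)])
    show "(sh (of_int m3) \<circ> gz) [^]\<^bsub>PSL2R_cover\<^esub> int a3 = sh (of_int (d * - b3))"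
      unfolding shift(3)[OF lift(3)] lift_rel by (rule pow[OF m(3)])
    show "(sh (of_int m1) \<circ> gx) \<circ> (sh (of_int m2) \<circ> gy) \<circ> (sh (of_int m3) \<circ> gz) = sh (of_int (d * b))"
      by (rule prod)
  qed (simp_all only: shift(2) lift f_gen that)
  have "p \<in> mon S E"
    by (rule hom_over_identity_mono[where m = d]) (use p d in simp_all)
  moreover have "p ` carrier S = derived E (carrier E)"
    by (rule hom_over_identity_image) (use p deg in simp_all)
  moreover have "\<exists>n::nat. of_nat n = of_nat (a1 * a2 * a3) * \<bar>euler_number a1 a2 a3 \<beta> \<beta>1 \<beta>2 \<beta>3\<bar> \<and>
      p sH = pullback_central T [^]\<^bsub>E\<^esub> n"
  proof (intro exI conjI)
    have "of_nat (a1 * a2 * a3) * \<bar>euler_number a1 a2 a3 \<beta> \<beta>1 \<beta>2 \<beta>3\<bar> =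
        \<bar>of_nat (a1 * a2 * a3) * euler_number a1 a2 a3 \<beta> \<beta>1 \<beta>2 \<beta>3\<bar>"
      by (simp add: abs_mult)
    also have "\<dots> = of_int d"
      unfolding euler_number_eq_degree[OF pos] using d by (simp add: d_def)
    finally show "of_nat (nat d) = of_nat (a1 * a2 * a3) * \<bar>euler_number a1 a2 a3 \<beta> \<beta>1 \<beta>2 \<beta>3\<bar>"
      using d by simp
    show "p sH = pullback_central T [^]\<^bsub>E\<^esub> nat d"
      using sh_pow_E[of 1 d] d by (simp add: p pullback_central_def pow_nat)
  qed
  ultimately have "abelian_cover_hom a1 a2 a3 b b1 b2 b3 f (euler_number a1 a2 a3 \<beta> \<beta>1 \<beta>2 \<beta>3) p"
    by (simp add: abelian_cover_hom_def Let_def)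
  then show ?thesis
    by (rule that) (simp add: p split: seifert_gen.split)
qed

end

text \<open>The sign by which the two homomorphisms differ is a character of a perfect group.\<close>
lemma sign_ambiguity_trivial:
  fixes \<sigma> \<tau> :: "seifert_gen word set \<Rightarrow> real ^ 2 ^ 2"
  assumes \<sigma>: "\<sigma> \<in> hom (seifert_group a1 a2 a3 b b1 b2 b3) SL2" and \<tau>: "\<tau> \<in> hom (seifert_group a1 a2 a3 b b1 b2 b3) SL2"
    and deg: "seifert_degree a1 a2 a3 b b1 b2 b3 = 1"
    and gens: "\<And>g. {\<sigma> (seifert_gen_class a1 a2 a3 b b1 b2 b3 g), - \<sigma> (seifert_gen_class a1 a2 a3 b b1 b2 b3 g)} =
      {\<tau> (seifert_gen_class a1 a2 a3 b b1 b2 b3 g), - \<tau> (seifert_gen_class a1 a2 a3 b b1 b2 b3 g)}"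
    and s: "s \<in> carrier (seifert_group a1 a2 a3 b b1 b2 b3)"
  shows "\<sigma> s = \<tau> s"
proof -
  interpret seifert a1 a2 a3 b b1 b2 b3 .
  note proj = PSL2R_proj_hom
  have "((\<lambda>A. {A, - A}) \<circ> \<sigma>) t = ((\<lambda>A. {A, - A}) \<circ> \<tau>) t" if "t \<in> carrier S" for t
    using seifert_group_hom_ext[OF group_PSL2R hom_compose[OF \<sigma> proj] hom_compose[OF \<tau> proj] _ that] gens
    by simp
  then have "\<exists>e\<in>{1, - 1}. \<sigma> t = e *\<^sub>R \<tau> t" if "t \<in> carrier S" for t
    using that by (fastforce simp: doubleton_eq_iff)
  then obtain e where e: "\<And>t. t \<in> carrier S \<Longrightarrow> e t \<in> {1, - 1} \<and> \<sigma> t = e t *\<^sub>R \<tau> t"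
    by metis
  define U where "U = \<lparr>carrier = {1, - 1 :: real}, mult = (*), one = 1 :: real\<rparr>"
  have "comm_group U"
    by (rule comm_groupI) (auto simp: U_def)
  moreover have "e \<in> hom S U"
  proof (rule homI)
    show "e t \<in> carrier U" if "t \<in> carrier S" for t using e[OF that] by (simp add: U_def)
    fix t u assume t: "t \<in> carrier S" and u: "u \<in> carrier S"
    have "\<sigma> (t \<otimes>\<^bsub>S\<^esub> u) = \<sigma> t ** \<sigma> u" "\<tau> (t \<otimes>\<^bsub>S\<^esub> u) = \<tau> t ** \<tau> u"
      using hom_mult[OF \<sigma> t u] hom_mult[OF \<tau> t u] by (simp_all add: SL2_def)
    then have "e (t \<otimes>\<^bsub>S\<^esub> u) *\<^sub>R \<tau> (t \<otimes>\<^bsub>S\<^esub> u) = (e t * e u) *\<^sub>R \<tau> (t \<otimes>\<^bsub>S\<^esub> u)"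
      using e[OF t] e[OF u] e[of "t \<otimes>\<^bsub>S\<^esub> u"] t u by (auto simp: neg_mat_mult)
    moreover have "\<tau> (t \<otimes>\<^bsub>S\<^esub> u) \<noteq> 0"
    proof
      assume *: "\<tau> (t \<otimes>\<^bsub>S\<^esub> u) = 0"
      have "\<tau> (t \<otimes>\<^bsub>S\<^esub> u) \<in> carrier SL2" using \<tau> t u by (simp add: hom_in_carrier)
      then show False by (simp add: * SL2_def det_2)
    qed
    ultimately show "e (t \<otimes>\<^bsub>S\<^esub> u) = e t \<otimes>\<^bsub>U\<^esub> e u" by (simp add: U_def)
  qed
  ultimately have "e s = \<one>\<^bsub>U\<^esub>" using deg s by (rule seifert_hom_to_comm_group_trivial)
  then show ?thesis using e[OF s] by (simp add: U_def)
qed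

lemma (in lifted_triangle) induced_rep_if_degree_pos:
  fixes \<sigma> :: "seifert_gen word set \<Rightarrow> real ^ 2 ^ 2" and b b1 b2 b3 :: int
  defines "sg \<equiv> seifert_gen_class a1 a2 a3 b b1 b2 b3"
  assumes pos: "a1 > 0" "a2 > 0" "a3 > 0"
    and deg: "seifert_degree a1 a2 a3 b b1 b2 b3 = 1" and d: "seifert_degree a1 a2 a3 \<beta> \<beta>1 \<beta>2 \<beta>3 > 0"
    and \<sigma>: "\<sigma> \<in> hom (seifert_group a1 a2 a3 b b1 b2 b3) SL2"
    and gens: "{\<sigma> (sg SX), - \<sigma> (sg SX)} = cover_to_PSL2R gx" "{\<sigma> (sg SY), - \<sigma> (sg SY)} = cover_to_PSL2R gy"
      "{\<sigma> (sg SZ), - \<sigma> (sg SZ)} = cover_to_PSL2R gz" "\<sigma> (sg SH) \<in> {mat 1, - mat 1}"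
  shows "induced_rep a1 a2 a3 b b1 b2 b3 f \<sigma>"
proof -
  interpret seifert a1 a2 a3 b b1 b2 b3 .
  obtain \<psi> where \<psi>: "seifert_presentation a1 a2 a3 f \<beta> \<beta>1 \<beta>2 \<beta>3 \<psi>"
    by (rule seifert_presentation_exists)
  obtain p where p: "abelian_cover_hom a1 a2 a3 b b1 b2 b3 f (euler_number a1 a2 a3 \<beta> \<beta>1 \<beta>2 \<beta>3) p"
    and p_gen: "\<And>g. fst (p (sg g)) = (case g of SX \<Rightarrow> tx | SY \<Rightarrow> ty | SZ \<Rightarrow> tz | SH \<Rightarrow> \<one>\<^bsub>T\<^esub>)"
    unfolding sg_def using abelian_cover_hom_exists[OF pos deg d] by metis
  have p_hom: "p \<in> hom S E" using p by (simp add: abelian_cover_hom_def Let_def mon_def)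
  have \<tau>: "cover_to_SL2R \<circ> (snd \<circ> p) \<in> hom S SL2"
    using hom_compose[OF hom_compose[OF p_hom snd_hom] cover_to_SL2R_hom] .
  have "\<sigma> s = (cover_to_SL2R \<circ> (snd \<circ> p)) s" if "s \<in> carrier S" for s
  proof (rule sign_ambiguity_trivial[OF \<sigma> \<tau> deg _ that])
    fix g
    obtain \<gamma> k where k: "p (sg g) = (\<gamma>, k)" by (cases "p (sg g)")
    have "p (sg g) \<in> carrier E" using p_hom unfolding sg_def by (rule hom_in_carrier) simp
    then have k_in: "k \<in> carrier PSL2R_cover" and fk: "f \<gamma> = cover_to_PSL2R k"
      unfolding k by (simp_all add: carrier_E)
    have "f \<gamma> = {\<sigma> (sg g), - \<sigma> (sg g)}"
    proof (cases g)
      case SH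
      have "f \<gamma> = {mat 1, - mat 1}"
        using p_gen[of g] f.hom_one by (simp add: SH k[unfolded SH] PSL2R_def)
      moreover have "\<sigma> (sg SH) = mat 1 \<or> \<sigma> (sg SH) = - mat 1" using gens(4) by simp
      ultimately show ?thesis by (elim disjE) (simp_all add: SH insert_commute)
    next
      case SX
      then show ?thesis using p_gen[of SX] k f_gen(1) gens(1) by simp
    next
      case SY
      then show ?thesis using p_gen[of SY] k f_gen(2) gens(2) by simp
    next
      case SZ
      then show ?thesis using p_gen[of SZ] k f_gen(3) gens(3) by simp
    qed
    then show "{\<sigma> (seifert_gen_class a1 a2 a3 b b1 b2 b3 g), - \<sigma> (seifert_gen_class a1 a2 a3 b b1 b2 b3 g)} =
        {(cover_to_SL2R \<circ> (snd \<circ> p)) (seifert_gen_class a1 a2 a3 b b1 b2 b3 g),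
         - (cover_to_SL2R \<circ> (snd \<circ> p)) (seifert_gen_class a1 a2 a3 b b1 b2 b3 g)}"
      using fk cover_to_PSL2R_eq[OF oriented_lift_cover_to_SL2R[OF k_in]] k by (simp add: sg_def)
  qed
  moreover have "euler_number a1 a2 a3 \<beta> \<beta>1 \<beta>2 \<beta>3 \<noteq> 0"
    using euler_number_eq_degree[OF pos, of \<beta> \<beta>1 \<beta>2 \<beta>3] d by auto
  ultimately show ?thesis
    unfolding induced_rep_def using \<psi> p by (metis comp_apply)
qed

section \<open>Pairs of matrices of finite projective order\<close>

definition mat22 :: "'a \<Rightarrow> 'a \<Rightarrow> 'a \<Rightarrow> 'a \<Rightarrow> 'a :: zero ^ 2 ^ 2" where
  "mat22 a b c d = vector [vector [a, b], vector [c, d]]"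

lemma mat22_nth [simp]: "mat22 a b c d $ 1 $ 1 = a" "mat22 a b c d $ 1 $ 2 = b"
  "mat22 a b c d $ 2 $ 1 = c" "mat22 a b c d $ 2 $ 2 = d"
  by (simp_all add: mat22_def)

lemma mat22_eta: "mat22 (A $ 1 $ 1) (A $ 1 $ 2) (A $ 2 $ 1) (A $ 2 $ 2) = A"
  by (simp add: vec_eq_iff forall_2)

lemma mat22_cases: obtains a b c d where "A = mat22 a b c d"
  using mat22_eta by metis

lemma mat22_eq_iff: "mat22 a b c d = mat22 a' b' c' d' \<longleftrightarrow> a = a' \<and> b = b' \<and> c = c' \<and> d = d'"
  by (auto simp: vec_eq_iff forall_2)

lemma mat22_mult: "mat22 a b c d ** mat22 a' b' c' d' =
    mat22 (a * a' + b * c') (a * b' + b * d') (c * a' + d * c') (c * b' + d * d' :: 'a :: comm_ring_1)"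
  by (simp add: vec_eq_iff forall_2 matrix_matrix_mult_def sum_2)

lemma mat22_one: "mat 1 = mat22 1 0 0 (1 :: 'a :: comm_ring_1)"
  by (simp add: vec_eq_iff forall_2 mat_def)

lemma mat22_uminus: "- mat22 a b c d = mat22 (- a) (- b) (- c) (- d :: 'a :: comm_ring_1)"
  by (simp add: vec_eq_iff forall_2)

lemma det_mat22: "det (mat22 a b c d) = a * d - b * (c :: 'a :: comm_ring_1)"
  by (simp add: det_2)

lemma trace_mat22: "trace (mat22 a b c d) = a + (d :: 'a :: comm_ring_1)"
  by (simp add: trace_def sum_2)

lemma SL2_iff: "A \<in> carrier SL2 \<longleftrightarrow> det A = 1"
  by (simp add: SL2_def)

lemma SL2_mult [simp]: "A \<otimes>\<^bsub>SL2\<^esub> B = A ** B"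
  and SL2_one [simp]: "\<one>\<^bsub>SL2\<^esub> = mat 1"
  by (simp_all add: SL2_def)

lemma matrix_inv_SL2:
  fixes P :: "'a :: field ^ 2 ^ 2"
  assumes "P \<in> carrier SL2"
  shows "P ** matrix_inv P = mat 1" "matrix_inv P ** P = mat 1" "matrix_inv P \<in> carrier SL2"
proof -
  have "invertible P" using assms by (simp add: SL2_iff invertible_det_nz)
  then obtain Q where "P ** Q = mat 1 \<and> Q ** P = mat 1" by (auto simp: invertible_def)
  then have inv: "P ** matrix_inv P = mat 1 \<and> matrix_inv P ** P = mat 1"
    unfolding matrix_inv_def by (rule someI)
  then show "P ** matrix_inv P = mat 1" "matrix_inv P ** P = mat 1" by auto
  have "det P * det (matrix_inv P) = 1" using inv by (metis det_I det_mul)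
  then show "matrix_inv P \<in> carrier SL2" using assms by (simp add: SL2_iff)
qed

lemma matrix_inv_eqI:
  fixes P Q :: "'a :: field ^ 2 ^ 2"
  assumes "P \<in> carrier SL2" and "Q ** P = mat 1"
  shows "matrix_inv P = Q"
  using matrix_inv_SL2[OF assms(1)] assms(2) by (metis matrix_mul_assoc matrix_mul_lid matrix_mul_rid)

definition conj_mat :: "'a :: field ^ 2 ^ 2 \<Rightarrow> 'a ^ 2 ^ 2 \<Rightarrow> 'a ^ 2 ^ 2" where
  "conj_mat P A = P ** A ** matrix_inv P"

lemma conj_mat_comp:
  assumes "P \<in> carrier SL2" "Q \<in> carrier SL2"
  shows "conj_mat Q (conj_mat P A) = conj_mat (Q ** P) A"
proof -
  have "matrix_inv P ** matrix_inv Q ** (Q ** P) = matrix_inv P ** (matrix_inv Q ** Q) ** P"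
    by (simp only: matrix_mul_assoc)
  also have "\<dots> = mat 1" using assms by (simp add: matrix_inv_SL2)
  finally have "matrix_inv (Q ** P) = matrix_inv P ** matrix_inv Q"
    using assms by (intro matrix_inv_eqI) (simp_all add: SL2_iff det_mul)
  then show ?thesis by (simp add: conj_mat_def matrix_mul_assoc)
qed

lemma conj_mat_mult:
  assumes "P \<in> carrier SL2"
  shows "conj_mat P (A ** B) = conj_mat P A ** conj_mat P B"
proof -
  have "conj_mat P A ** conj_mat P B = P ** A ** (matrix_inv P ** P) ** B ** matrix_inv P"
    by (simp only: conj_mat_def matrix_mul_assoc)
  then show ?thesis using assms by (simp add: matrix_inv_SL2 conj_mat_def matrix_mul_assoc)
qed

lemma conj_mat_in_SL2: "P \<in> carrier SL2 \<Longrightarrow> A \<in> carrier SL2 \<Longrightarrow> conj_mat P A \<in> carrier SL2"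
  using matrix_inv_SL2(3)[of P] by (simp add: SL2_iff conj_mat_def det_mul)

lemma trace_conj_mat: "P \<in> carrier SL2 \<Longrightarrow> trace (conj_mat P A) = trace A"
  unfolding conj_mat_def
  by (subst trace_mul_sym) (simp add: matrix_mul_assoc matrix_inv_SL2)

lemma conj_mat_pm1: "P \<in> carrier SL2 \<Longrightarrow> A \<in> {mat 1, - mat 1} \<Longrightarrow> conj_mat P A = A"
  by (auto simp: conj_mat_def matrix_inv_SL2 neg_mat_mult)

lemma conj_mat_mat22:
  assumes "a * d - b * c = (1 :: 'a :: field)"
  shows "conj_mat (mat22 a b c d) A = mat22 a b c d ** A ** mat22 d (- b) (- c) a"
proof -
  have "matrix_inv (mat22 a b c d) = mat22 d (- b) (- c) a"
    using assms by (intro matrix_inv_eqI)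
      (simp_all add: SL2_iff det_mat22 mat22_mult mat22_one mat22_eq_iff algebra_simps)
  then show ?thesis by (simp add: conj_mat_def)
qed

definition eigenvector :: "'a :: field ^ 2 ^ 2 \<Rightarrow> 'a \<Rightarrow> 'a ^ 2 \<Rightarrow> bool" where
  "eigenvector A u v \<longleftrightarrow> v \<noteq> 0 \<and> A *v v = u *s v"

lemma eigenvector_exists:
  fixes A :: "'a :: field ^ 2 ^ 2"
  assumes "A \<in> carrier SL2" and "u * u - trace A * u + 1 = 0"
  obtains v where "eigenvector A u v"
proof -
  obtain a b c d where A: "A = mat22 a b c d" by (rule mat22_cases)
  have det: "a * d - b * c = 1" using assms(1) by (simp add: A SL2_iff det_mat22)
  have "det (mat22 (a - u) b c (d - u)) = u * u - trace A * u + 1"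
    unfolding det_mat22 A trace_mat22 det[symmetric] by (simp add: algebra_simps)
  then have "\<not> invertible (mat22 (a - u) b c (d - u))"
    using assms(2) by (simp add: invertible_det_nz)
  then have "\<not> (\<forall>v. mat22 (a - u) b c (d - u) *v v = 0 \<longrightarrow> v = 0)"
    unfolding invertible_left_inverse matrix_left_invertible_ker .
  then obtain v where v: "mat22 (a - u) b c (d - u) *v v = 0" "v \<noteq> 0" by blast
  have "eigenvector A u v"
    using v by (simp add: A eigenvector_def vec_eq_iff forall_2 matrix_vector_mult_def sum_2 algebra_simps)
  then show ?thesis by (rule that)
qed

lemma eigenvalue_exists:
  fixes A :: "complex ^ 2 ^ 2"
  obtains u where "u * u - trace A * u + 1 = 0"
proof
  define w where "w = csqrt (trace A * trace A - 4)"
  have "w * w = trace A * trace A - 4"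
    unfolding w_def by (metis power2_csqrt power2_eq_square)
  moreover have "(trace A + w) / 2 * ((trace A + w) / 2) - trace A * ((trace A + w) / 2) + 1 =
      (w * w - (trace A * trace A - 4)) / 4"
    by (simp add: field_simps)
  ultimately show "(trace A + w) / 2 * ((trace A + w) / 2) - trace A * ((trace A + w) / 2) + 1 = 0"
    by simp
qed

lemma eigenvector_pow:
  assumes "eigenvector A u v"
  shows "(A [^]\<^bsub>SL2\<^esub> (n :: nat)) *v v = u ^ n *s v"
proof (induction n)
  case (Suc n)
  have "(A [^]\<^bsub>SL2\<^esub> Suc n) *v v = (A [^]\<^bsub>SL2\<^esub> n) *v (u *s v)"
    using assms by (simp add: eigenvector_def matrix_vector_mul_assoc[symmetric])
  also have "\<dots> = u *s (u ^ n *s v)"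
    using Suc by (simp add: vector_scalar_commute)
  finally show ?case by (simp add: vector_smult_assoc)
qed simp

lemma eigenvector_pm1_pow:
  assumes "eigenvector A u v" and "A [^]\<^bsub>SL2\<^esub> (n :: nat) = mat e" and "e \<in> {1, - 1}"
  shows "u ^ n = e"
proof -
  have "e *s v = u ^ n *s v"
    using eigenvector_pow[OF assms(1), of n] assms(2,3)
    by (auto simp: vec_eq_iff forall_2 matrix_vector_mult_def sum_2 mat_def)
  moreover obtain i where "v $ i \<noteq> 0"
    using assms(1) by (auto simp: eigenvector_def vec_eq_iff)
  ultimately show ?thesis by (auto simp: vec_eq_iff)
qed

definition finite_projective_order :: "'a :: field ^ 2 ^ 2 \<Rightarrow> bool" where
  "finite_projective_order A \<longleftrightarrow> (\<exists>n>0. A [^]\<^bsub>SL2\<^esub> (n :: nat) \<in> {mat 1, - mat 1})"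

lemma finite_projective_orderE:
  assumes "finite_projective_order A"
  obtains n :: nat and e where "n > 0" "A [^]\<^bsub>SL2\<^esub> n = mat e" "e \<in> {1, - 1}"
proof -
  obtain n :: nat where "n > 0" "A [^]\<^bsub>SL2\<^esub> n \<in> {mat 1, - mat 1}"
    using assms by (auto simp: finite_projective_order_def)
  moreover have "- mat 1 = (mat (- 1) :: 'a ^ 2 ^ 2)"
    by (simp add: vec_eq_iff mat_def)
  ultimately show ?thesis using that by (metis empty_iff insertE insertI1 insertI2)
qed

lemma eigenvalue_norm_1:
  fixes A :: "complex ^ 2 ^ 2"
  assumes "finite_projective_order A" and "eigenvector A u v"
  shows "norm u = 1"
proof -
  obtain n e where n: "n > 0" "A [^]\<^bsub>SL2\<^esub> (n :: nat) = mat e" "e \<in> {1, - 1}"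
    using assms(1) by (rule finite_projective_orderE)
  have "u ^ n = e" using eigenvector_pm1_pow[OF assms(2) n(2,3)] .
  then have "norm u ^ n = 1" using n(3) by (metis norm_power norm_one norm_minus_cancel empty_iff insertE)
  then show ?thesis using n(1) by (metis norm_ge_zero power_eq_imp_eq_base power_one zero_le_one)
qed

lemma unit_complex_quadratic:
  assumes "u * u - t * u + 1 = 0" and "norm u = 1"
  shows "t = u + cnj u" "cnj u * cnj u - t * cnj u + 1 = 0"
proof -
  have uc: "u * cnj u = 1" using assms(2) complex_norm_square[of u] by simp
  have "cnj u * (u * u - t * u + 1) = (u * cnj u) * u - t * (u * cnj u) + cnj u"
    by (simp add: algebra_simps)
  then have "cnj u * 0 = 1 * u - t * 1 + cnj u" unfolding assms(1) uc .
  then show t: "t = u + cnj u" by (simp add: algebra_simps)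
  show "cnj u * cnj u - t * cnj u + 1 = 0"
    using uc unfolding t by (simp add: algebra_simps)
qed

lemma trace_real:
  fixes A :: "complex ^ 2 ^ 2"
  assumes "A \<in> carrier SL2" and "finite_projective_order A"
  shows "cnj (trace A) = trace A"
proof -
  obtain u where u: "u * u - trace A * u + 1 = 0" by (rule eigenvalue_exists)
  obtain v where "eigenvector A u v" using eigenvector_exists[OF assms(1) u] .
  then have "norm u = 1" by (rule eigenvalue_norm_1[OF assms(2)])
  then have "trace A = u + cnj u" by (rule unit_complex_quadratic(1)[OF u])
  then show ?thesis by simp
qed

text \<open>With the double eigenvalue \<open>u = \<plusminus>1\<close> the matrix is \<open>u + N\<close> with \<open>N N = 0\<close>, and its \<open>n\<close>-th power is
  \<open>u^n + n u^(n-1) N\<close>.  In characteristic 0 this is scalar only if \<open>N = 0\<close>.\<close>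
lemma finite_order_unipotent_trivial:
  fixes A :: "'a :: field_char_0 ^ 2 ^ 2"
  assumes A: "A \<in> carrier SL2" "finite_projective_order A" and tr: "trace A = u + u" and u: "u * u = 1"
  shows "A = mat u"
proof -
  obtain a b c d where abcd: "A = mat22 a b c d" by (rule mat22_cases)
  define x where "x = a - u"
  have A_eq: "A = mat22 (u + x) b c (u - x)"
    using tr by (simp add: abcd trace_mat22 mat22_eq_iff x_def algebra_simps)
  have "(u + x) * (u - x) - b * c = 1" using A(1) by (simp add: A_eq SL2_iff det_mat22)
  then have bc: "b * c = - (x * x)" using u by (simp add: algebra_simps eq_neg_iff_add_eq_0)
  \<comment> \<open>The exponent is raised by 2, which \<open>u * u = 1\<close> permits, to avoid a truncated \<open>n - 1\<close>.\<close>
  define k where "k n = of_nat n * u ^ (n + 1)" for n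
  have k_Suc: "k (Suc n) = k n * u + u ^ n" for n
  proof -
    have "u ^ n = u ^ n * (u * u)" using u by simp
    then show ?thesis by (simp add: k_def algebra_simps)
  qed
  have pow: "A [^]\<^bsub>SL2\<^esub> n = mat22 (u ^ n + k n * x) (k n * b) (k n * c) (u ^ n - k n * x)" for n :: nat
  proof (induction n)
    case 0
    show ?case by (simp add: mat22_one k_def)
  next
    case (Suc n)
    have "A [^]\<^bsub>SL2\<^esub> Suc n = mat22 (u ^ n + k n * x) (k n * b) (k n * c) (u ^ n - k n * x) ** mat22 (u + x) b c (u - x)"
      using Suc A_eq by simp
    also have "\<dots> = mat22 (u ^ Suc n + k (Suc n) * x) (k (Suc n) * b) (k (Suc n) * c) (u ^ Suc n - k (Suc n) * x)"
      unfolding mat22_mult mat22_eq_iff k_Suc using arg_cong[OF bc, of "\<lambda>t. k n * t"]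
      by (simp add: algebra_simps eq_neg_iff_add_eq_0)
    finally show ?case .
  qed
  obtain n :: nat and e where n: "n > 0" "A [^]\<^bsub>SL2\<^esub> n = mat e" "e \<in> {1, - 1}"
    using A(2) by (rule finite_projective_orderE)
  have k: "k n \<noteq> 0"
    using n(1) u by (auto simp: k_def)
  have "k n * b = 0" "k n * c = 0" using pow[of n] n(2) by (simp_all add: vec_eq_iff forall_2 mat_def)
  then have "b = 0" "c = 0" using k by simp_all
  then have "x = 0" using bc by simp
  then show ?thesis using \<open>b = 0\<close> \<open>c = 0\<close> by (simp add: A_eq vec_eq_iff forall_2 mat_def)
qed

text \<open>The eigenvalues are \<open>u\<close> and \<open>cnj u\<close>.  If they coincide, the matrix is \<open>\<plusminus>1\<close> by the preceding lemma;
  otherwise the two eigenvectors, one of them rescaled, form the columns of a matrix of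
  determinant 1.\<close>
lemma finite_order_diagonalizable:
  fixes A :: "complex ^ 2 ^ 2"
  assumes A: "A \<in> carrier SL2" "finite_projective_order A" and ne: "A \<noteq> mat 1" "A \<noteq> - mat 1"
  obtains P u where "P \<in> carrier SL2" "conj_mat P A = mat22 u 0 0 (cnj u)" "u \<noteq> cnj u"
proof -
  obtain u where u: "u * u - trace A * u + 1 = 0" by (rule eigenvalue_exists)
  obtain v where v: "eigenvector A u v" using eigenvector_exists[OF A(1) u] .
  have nu: "norm u = 1" using A(2) v by (rule eigenvalue_norm_1)
  note t = unit_complex_quadratic[OF u nu]
  obtain w where w: "eigenvector A (cnj u) w" using eigenvector_exists[OF A(1) t(2)] .
  have uc: "u * cnj u = 1" using nu complex_norm_square[of u] by simp
  have u_ne: "u \<noteq> cnj u"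
  proof
    assume eq: "u = cnj u"
    then have "u * u = 1" using uc by simp
    then have "A = mat u" "u = 1 \<or> u = - 1"
      using finite_order_unipotent_trivial[OF A, of u] t(1) eq square_eq_1_iff by auto
    moreover have "mat (- 1) = (- mat 1 :: complex ^ 2 ^ 2)" by (simp add: vec_eq_iff mat_def)
    ultimately show False using ne by auto
  qed
  obtain a b c d where abcd: "A = mat22 a b c d" by (rule mat22_cases)
  have Av: "a * v $ 1 + b * v $ 2 = u * v $ 1" "c * v $ 1 + d * v $ 2 = u * v $ 2"
    and Aw: "a * w $ 1 + b * w $ 2 = cnj u * w $ 1" "c * w $ 1 + d * w $ 2 = cnj u * w $ 2"
    and v0: "v $ 1 \<noteq> 0 \<or> v $ 2 \<noteq> 0" and w0: "w $ 1 \<noteq> 0 \<or> w $ 2 \<noteq> 0"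
    using v w by (auto simp: eigenvector_def abcd vec_eq_iff forall_2 matrix_vector_mult_def sum_2)
  define D where "D = v $ 1 * w $ 2 - v $ 2 * w $ 1"
  have "D \<noteq> 0"
  proof
    assume D: "D = 0"
    \<comment> \<open>Parallel eigenvectors for different eigenvalues: all products of their coordinates vanish.\<close>
    then have vw: "v $ 1 * w $ 2 = v $ 2 * w $ 1" by (simp add: D_def)
    have "(u - cnj u) * (v $ 1 * w $ 1) = (u * v $ 1) * w $ 1 - v $ 1 * (cnj u * w $ 1)"
      by (simp add: algebra_simps)
    also have "\<dots> = b * (v $ 2 * w $ 1 - v $ 1 * w $ 2)"
      unfolding Av(1)[symmetric] Aw(1)[symmetric] by (simp add: algebra_simps)
    finally have 11: "v $ 1 * w $ 1 = 0" using u_ne vw by simp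
    have "(u - cnj u) * (v $ 2 * w $ 2) = (u * v $ 2) * w $ 2 - v $ 2 * (cnj u * w $ 2)"
      by (simp add: algebra_simps)
    also have "\<dots> = c * (v $ 1 * w $ 2 - v $ 2 * w $ 1)"
      unfolding Av(2)[symmetric] Aw(2)[symmetric] by (simp add: algebra_simps)
    finally have 22: "v $ 2 * w $ 2 = 0" using u_ne vw by simp
    have "(u - cnj u) * (v $ 1 * w $ 2) = (u * v $ 1) * w $ 2 - cnj u * (v $ 1 * w $ 2)"
      by (simp add: algebra_simps)
    also have "\<dots> = (u * v $ 1) * w $ 2 - v $ 2 * (cnj u * w $ 1)"
      unfolding vw by (simp add: algebra_simps)
    also have "\<dots> = a * (v $ 1 * w $ 2 - v $ 2 * w $ 1)"
      unfolding Av(1)[symmetric] Aw(1)[symmetric] by (simp add: algebra_simps)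
    finally have 12: "v $ 1 * w $ 2 = 0" using u_ne vw by simp
    show False using 11 22 12 vw v0 w0 by auto
  qed
  define M where "M = mat22 (v $ 1 / D) (w $ 1) (v $ 2 / D) (w $ 2)"
  have M: "M \<in> carrier SL2"
  proof -
    have "det M = (v $ 1 * w $ 2 - v $ 2 * w $ 1) / D"
      by (simp add: M_def det_mat22 diff_divide_distrib mult.commute)
    then show ?thesis using \<open>D \<noteq> 0\<close> by (simp add: SL2_iff flip: D_def)
  qed
  have AM: "A ** M = M ** mat22 u 0 0 (cnj u)"
    using Av Aw unfolding abcd M_def mat22_mult mat22_eq_iff
    by (simp add: mult.commute add_divide_distrib[symmetric])
  have inv: "matrix_inv (matrix_inv M) = M"
    using M by (intro matrix_inv_eqI) (simp_all add: matrix_inv_SL2)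
  have "conj_mat (matrix_inv M) A = matrix_inv M ** (A ** M)"
    by (simp add: conj_mat_def inv matrix_mul_assoc)
  also have "\<dots> = matrix_inv M ** M ** mat22 u 0 0 (cnj u)"
    by (simp only: AM matrix_mul_assoc)
  finally have "conj_mat (matrix_inv M) A = mat22 u 0 0 (cnj u)"
    using M by (simp add: matrix_inv_SL2)
  then show ?thesis using that matrix_inv_SL2(3)[OF M] u_ne by blast
qed

lemma eigenvector_conj_mat:
  assumes "P \<in> carrier SL2" and "eigenvector (conj_mat P A) u v"
  shows "eigenvector A u (matrix_inv P *v v)"
proof -
  have *: "P *v (matrix_inv P *v v) = v" using assms(1) by (simp add: matrix_vector_mul_assoc matrix_inv_SL2)
  have "A *v (matrix_inv P *v v) = matrix_inv P *v (conj_mat P A *v v)"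
  proof -
    have "matrix_inv P *v (conj_mat P A *v v) = (matrix_inv P ** P) *v (A *v (matrix_inv P *v v))"
      by (simp only: conj_mat_def matrix_vector_mul_assoc matrix_mul_assoc)
    then show ?thesis using assms(1) by (simp add: matrix_inv_SL2)
  qed
  then have "A *v (matrix_inv P *v v) = u *s (matrix_inv P *v v)"
    using assms(2) by (simp add: eigenvector_def vector_scalar_commute)
  moreover have "matrix_inv P *v v \<noteq> 0"
    using * assms(2) by (auto simp: eigenvector_def)
  ultimately show ?thesis by (simp add: eigenvector_def)
qed

lemma SU2_mat22: "a * cnj a + b * cnj b = 1 \<Longrightarrow> mat22 a b (- cnj b) (cnj a) \<in> SU2"
  by (simp add: SU2_def det_mat22 mat22_one vec_eq_iff forall_2 matrix_matrix_mult_def sum_2 algebra_simps)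

text \<open>The Cayley transform, which carries the unit disc to the half plane.\<close>
lemma cayley_SU11_real:
  obtains C where "C \<in> carrier SL2" "\<And>a b. conj_mat C (mat22 a b (cnj b) (cnj a)) \<in> range complex_mat"
proof
  define r where "r = complex_of_real (1 / sqrt 2)"
  have rr: "r * r = 1 / 2" by (simp add: r_def flip: of_real_mult)
  have det: "r * r - (r * \<i>) * (r * \<i>) = 1" using rr by (simp add: algebra_simps)
  show "mat22 r (r * \<i>) (r * \<i>) r \<in> carrier SL2"
    using det by (simp add: SL2_iff det_mat22)
  fix a b :: complex
  define R where "R = mat22 (Re a + Im b) (Re b + Im a) (Re b - Im a) (Re a - Im b)"
  have "conj_mat (mat22 r (r * \<i>) (r * \<i>) r) (mat22 a b (cnj b) (cnj a)) =
      mat22 (r * r * (a + \<i> * cnj b - \<i> * b + cnj a)) (r * r * (- \<i> * a + cnj b + b + \<i> * cnj a))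
        (r * r * (\<i> * a + cnj b + b - \<i> * cnj a)) (r * r * (a - \<i> * cnj b + \<i> * b + cnj a))"
    unfolding conj_mat_mat22[OF det] mat22_mult mat22_eq_iff
    by (simp add: algebra_simps)
  also have "\<dots> = complex_mat R"
    unfolding rr by (simp add: R_def complex_mat_def vec_eq_iff forall_2 complex_eq_iff)
  finally show "conj_mat (mat22 r (r * \<i>) (r * \<i>) r) (mat22 a b (cnj b) (cnj a)) \<in> range complex_mat"
    by blast
qed

text \<open>In a basis in which \<open>A = diag(u, cnj u)\<close>, the traces of \<open>B\<close> and \<open>A B\<close> are two linear functions of the
  diagonal entries of \<open>B\<close>, and their reality forces these entries to be complex conjugates of each
  other.  The product of the off-diagonal entries is then the real number \<open>k = \<bar>p\<bar>\<^sup>2 - 1\<close>; it is not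
  zero, for otherwise a basis vector would be a common eigenvector.  The sign of \<open>k\<close> decides between
  \<open>SU(1,1)\<close> and \<open>SU(2)\<close>.\<close>
lemma real_or_unitary_pair:
  fixes A B :: "complex ^ 2 ^ 2"
  assumes A: "A \<in> carrier SL2" "finite_projective_order A" and B: "B \<in> carrier SL2" "finite_projective_order B"
    and AB: "finite_projective_order (A ** B)" and ne: "A \<noteq> mat 1" "A \<noteq> - mat 1"
    and no_common: "\<And>v c d. \<not> (eigenvector A c v \<and> eigenvector B d v)"
  obtains P where "P \<in> carrier SL2"
    "(conj_mat P A \<in> SU2 \<and> conj_mat P B \<in> SU2) \<or>
     (conj_mat P A \<in> range complex_mat \<and> conj_mat P B \<in> range complex_mat)"
proof -
  obtain P u where P: "P \<in> carrier SL2" and PA: "conj_mat P A = mat22 u 0 0 (cnj u)" and u: "u \<noteq> cnj u"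
    using finite_order_diagonalizable[OF A ne] .
  obtain p q r s where PB: "conj_mat P B = mat22 p q r s" by (rule mat22_cases)
  have "det (conj_mat P B) = 1" using conj_mat_in_SL2[OF P B(1)] by (simp add: SL2_iff)
  then have detB: "p * s - q * r = 1" by (simp add: PB det_mat22)
  have "det (conj_mat P A) = 1" using conj_mat_in_SL2[OF P A(1)] by (simp add: SL2_iff)
  then have uc: "u * cnj u = 1" by (simp add: PA det_mat22)
  have trB: "cnj (p + s) = p + s"
    using trace_real[OF B] trace_conj_mat[OF P, of B] by (simp add: PB trace_mat22)
  have "A ** B \<in> carrier SL2" using A B by (simp add: SL2_iff det_mul)
  then have "cnj (trace (conj_mat P (A ** B))) = trace (conj_mat P (A ** B))"
    using trace_real[OF _ AB] trace_conj_mat[OF P] by simp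
  then have trAB: "cnj (u * p + cnj u * s) = u * p + cnj u * s"
    by (simp add: conj_mat_mult[OF P] PA PB mat22_mult trace_mat22)
  have "(u - cnj u) * (s - cnj p) = 0"
  proof -
    have "(u - cnj u) * (s - cnj p) = u * ((p + s) - cnj (p + s)) + (cnj (u * p + cnj u * s) - (u * p + cnj u * s))"
      by (simp add: algebra_simps)
    then show ?thesis unfolding trB trAB by simp
  qed
  then have s: "s = cnj p" using u by simp
  have "q \<noteq> 0"
  proof
    assume "q = 0"
    then have "eigenvector (conj_mat P A) (cnj u) (vector [0, 1])" "eigenvector (conj_mat P B) s (vector [0, 1])"
      by (simp_all add: PA PB eigenvector_def vec_eq_iff forall_2 matrix_vector_mult_def sum_2)
    then show False using no_common eigenvector_conj_mat[OF P] by blast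
  qed
  have "r \<noteq> 0"
  proof
    assume "r = 0"
    then have "eigenvector (conj_mat P A) u (vector [1, 0])" "eigenvector (conj_mat P B) p (vector [1, 0])"
      by (simp_all add: PA PB eigenvector_def vec_eq_iff forall_2 matrix_vector_mult_def sum_2)
    then show False using no_common eigenvector_conj_mat[OF P] by blast
  qed
  define k where "k = (norm p)\<^sup>2 - 1"
  have qr: "q * r = of_real k"
    using detB complex_norm_square[of p] by (simp add: k_def s algebra_simps)
  then have k: "k \<noteq> 0" using \<open>q \<noteq> 0\<close> \<open>r \<noteq> 0\<close> by auto
  \<comment> \<open>Conjugation by \<open>diag(l, 1/l)\<close> multiplies \<open>q\<close> by \<open>l\<^sup>2\<close> and divides \<open>r\<close> by \<open>l\<^sup>2\<close>; this \<open>l\<close> makes the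
    absolute values of the two entries equal.\<close>
  define l where "l = sqrt (sqrt \<bar>k\<bar> / norm q)"
  have l: "l > 0" using k \<open>q \<noteq> 0\<close> by (simp add: l_def)
  have l2: "l * l = sqrt \<bar>k\<bar> / norm q" by (simp add: l_def)
  have l4: "(l * l) * (l * l) * (norm q)\<^sup>2 = \<bar>k\<bar>"
    unfolding l2 using \<open>q \<noteq> 0\<close> by (simp add: power2_eq_square)
  define L where "L = mat22 (of_real l) 0 0 (inverse (of_real l) :: complex)"
  have detL: "of_real l * inverse (of_real l) - 0 * 0 = (1 :: complex)" using l by simp
  have L: "L \<in> carrier SL2" using detL by (simp add: L_def SL2_iff det_mat22)
  have LP: "L ** P \<in> carrier SL2" using L P by (simp add: SL2_iff det_mul)
  have scale: "conj_mat (L ** P) N = mat22 a (of_real (l * l) * b) (c / of_real (l * l)) d"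
    if "conj_mat P N = mat22 a b c d" for N a b c d
  proof -
    have "conj_mat (L ** P) N = conj_mat L (mat22 a b c d)"
      by (simp only: conj_mat_comp[OF P L, symmetric] that)
    also have "\<dots> = mat22 a (of_real (l * l) * b) (c / of_real (l * l)) d"
      unfolding L_def conj_mat_mat22[OF detL] mat22_mult mat22_eq_iff
      using l by (simp add: field_simps)
    finally show ?thesis .
  qed
  have LPA: "conj_mat (L ** P) A = mat22 u 0 0 (cnj u)"
    using scale[OF PA] by simp
  define q' where "q' = of_real (l * l) * q"
  define r' where "r' = r / of_real (l * l)"
  have LPB: "conj_mat (L ** P) B = mat22 p q' r' (cnj p)"
    using scale[OF PB] by (simp add: q'_def r'_def s)
  have "of_real (sgn k) * of_real (l * l) * of_real (l * l) * (q * cnj q) =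
      complex_of_real (sgn k * ((l * l) * (l * l) * (norm q)\<^sup>2))"
    by (simp only: of_real_mult complex_norm_square[symmetric] mult.assoc)
  also have "\<dots> = q * r"
    unfolding l4 by (simp add: sgn_mult_abs qr)
  finally have "q * (of_real (sgn k) * of_real (l * l) * of_real (l * l) * cnj q) = q * r"
    by (simp only: mult_ac)
  then have "r = of_real (sgn k) * of_real (l * l) * of_real (l * l) * cnj q"
    using \<open>q \<noteq> 0\<close> by simp
  then have r': "r' = of_real (sgn k) * cnj q'"
    using l by (simp add: r'_def q'_def field_simps)
  have q'r': "q' * r' = of_real k" using l qr by (simp add: q'_def r'_def)
  show ?thesis
  proof (cases "k < 0")
    case True
    then have r'': "r' = - cnj q'" using r' by simp
    have "p * cnj p - q' * r' = 1"
      using q'r' detB qr by (simp add: s)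
    then have "p * cnj p + q' * cnj q' = 1" unfolding r'' by simp
    then have "conj_mat (L ** P) B \<in> SU2" unfolding LPB r'' by (rule SU2_mat22)
    moreover have "conj_mat (L ** P) A \<in> SU2"
      unfolding LPA using SU2_mat22[of u 0] uc by simp
    ultimately show ?thesis using that LP by blast
  next
    case False
    then have r'': "r' = cnj q'" using r' k by simp
    obtain C where C: "C \<in> carrier SL2" "\<And>a b. conj_mat C (mat22 a b (cnj b) (cnj a)) \<in> range complex_mat"
      using cayley_SU11_real by metis
    have "conj_mat (C ** (L ** P)) A \<in> range complex_mat"
      using C(2)[of u 0] by (simp add: conj_mat_comp[OF LP C(1), symmetric] LPA)
    moreover have "conj_mat (C ** (L ** P)) B \<in> range complex_mat"
      using C(2)[of p q'] by (simp add: conj_mat_comp[OF LP C(1), symmetric] LPB r'')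
    moreover have "C ** (L ** P) \<in> carrier SL2" using C(1) LP by (simp add: SL2_iff det_mul)
    ultimately show ?thesis using that by blast
  qed
qed

section \<open>Representations of Seifert groups\<close>

lemma pm1_subgroup: "subgroup {mat 1, - mat 1} (SL2 :: ('a :: field ^ 2 ^ 2) monoid)"
proof -
  interpret group "SL2 :: ('a ^ 2 ^ 2) monoid" by (rule group_SL2)
  have d: "- mat 1 \<in> carrier (SL2 :: ('a ^ 2 ^ 2) monoid)" by (simp add: SL2_iff det_2 mat_def)
  have sq: "(- mat 1) ** (- mat 1) = (mat 1 :: 'a ^ 2 ^ 2)" by (simp add: neg_mat_mult)
  have "inv\<^bsub>SL2\<^esub> (- mat 1 :: 'a ^ 2 ^ 2) = - mat 1"
    using d sq by (intro inv_equality) simp_all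
  moreover have "inv\<^bsub>SL2\<^esub> (mat 1 :: 'a ^ 2 ^ 2) = mat 1" using inv_one by simp
  moreover have "mat 1 \<in> carrier (SL2 :: ('a ^ 2 ^ 2) monoid)" by (simp add: SL2_iff)
  ultimately show ?thesis
    using d by (intro subgroupI) (auto simp: neg_mat_mult)
qed

lemma (in group_hom) preimage_subgroup:
  assumes "subgroup K H"
  shows "subgroup {x \<in> carrier G. h x \<in> K} G"
  by (rule G.subgroupI)
    (use assms subgroup.one_closed[OF assms] in
      \<open>auto intro!: exI[of _ "\<one>\<^bsub>G\<^esub>"] simp: subgroup.m_inv_closed[OF assms] subgroup.m_closed[OF assms]\<close>)

definition adjoint_mat :: "complex ^ 2 ^ 2 \<Rightarrow> complex ^ 2 ^ 2" where
  "adjoint_mat A = (\<chi> i j. cnj (A $ j $ i))"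

lemma SU2_subgroup: "subgroup SU2 SL2"
proof -
  interpret group "SL2 :: (complex ^ 2 ^ 2) monoid" by (rule group_SL2)
  have SU2: "A \<in> SU2 \<longleftrightarrow> det A = 1 \<and> A ** adjoint_mat A = mat 1" for A
    by (simp add: SU2_def adjoint_mat_def)
  have adj_mult: "adjoint_mat (A ** B) = adjoint_mat B ** adjoint_mat A" for A B
    by (simp add: adjoint_mat_def vec_eq_iff matrix_matrix_mult_def mult.commute)
  have det_adj: "det (adjoint_mat A) = cnj (det A)" for A
    by (simp add: adjoint_mat_def det_2 mult.commute)
  have adj_adj: "adjoint_mat (adjoint_mat A) = A" for A
    by (simp add: adjoint_mat_def vec_eq_iff)
  show ?thesis
  proof (rule subgroupI)
    show "SU2 \<subseteq> carrier SL2" by (auto simp: SU2 SL2_iff)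
    have "adjoint_mat (mat 1) = mat 1" by (simp add: adjoint_mat_def vec_eq_iff mat_def)
    then show "SU2 \<noteq> {}" using SU2[of "mat 1"] by auto
  next
    fix A assume "A \<in> SU2"
    then have A: "det A = 1" "A ** adjoint_mat A = mat 1" by (simp_all add: SU2)
    have A': "adjoint_mat A ** A = mat 1" using A(2) by (simp add: matrix_left_right_inverse)
    then have "inv\<^bsub>SL2\<^esub> A = adjoint_mat A"
      using A by (intro inv_equality) (simp_all add: SL2_iff det_adj)
    then show "inv\<^bsub>SL2\<^esub> A \<in> SU2" using A A' by (simp add: SU2 det_adj adj_adj)
  next
    fix A B assume "A \<in> SU2" "B \<in> SU2"
    then have A: "det A = 1" "A ** adjoint_mat A = mat 1" and B: "det B = 1" "B ** adjoint_mat B = mat 1"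
      by (simp_all add: SU2)
    have "(A ** B) ** adjoint_mat (A ** B) = A ** (B ** adjoint_mat B) ** adjoint_mat A"
      by (simp only: adj_mult matrix_mul_assoc)
    then show "A \<otimes>\<^bsub>SL2\<^esub> B \<in> SU2" using A B by (simp add: SU2 det_mul)
  qed
qed

lemma complex_mat_mult: "complex_mat (A ** B) = complex_mat A ** complex_mat B"
  by (simp add: complex_mat_def vec_eq_iff matrix_matrix_mult_def sum_2)

lemma complex_mat_det: "det (complex_mat A) = of_real (det A)"
  by (simp add: complex_mat_def det_2)

lemma complex_mat_in_SL2: "complex_mat A \<in> carrier SL2 \<longleftrightarrow> A \<in> carrier SL2"
  unfolding SL2_iff complex_mat_det by simp

lemma complex_mat_inj: "complex_mat A = complex_mat B \<longleftrightarrow> A = B"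
  by (auto simp: complex_mat_def vec_eq_iff)

lemma complex_mat_one: "complex_mat (mat 1) = mat 1"
  by (simp add: complex_mat_def vec_eq_iff mat_def)

lemma complex_mat_uminus: "complex_mat (- A) = - complex_mat A"
  by (simp add: complex_mat_def vec_eq_iff)

lemma real_SL2_subgroup: "subgroup (complex_mat ` carrier SL2) SL2"
proof -
  have "complex_mat \<in> hom SL2 SL2"
    by (rule homI) (simp_all add: complex_mat_in_SL2 complex_mat_mult)
  then interpret group_hom SL2 SL2 complex_mat
    by (simp add: group_hom_def group_hom_axioms_def group_SL2)
  show ?thesis by (rule img_is_subgroup)
qed

context seifert
begin

text \<open>Schur's lemma for the central element \<open>h\<close>: an eigenspace of \<open>\<rho> h\<close> is invariant, hence everything.\<close>
lemma irreducible_fibre: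
  assumes \<rho>: "\<rho> \<in> hom S SL2" and irr: "irreducible_rep S \<rho>"
  shows "\<rho> sH \<in> {mat 1, - mat 1}"
proof -
  have H: "\<rho> sH \<in> carrier SL2" using \<rho> by (rule hom_in_carrier) simp
  obtain u where u: "u * u - trace (\<rho> sH) * u + 1 = 0" by (rule eigenvalue_exists)
  obtain v where v: "eigenvector (\<rho> sH) u v" using eigenvector_exists[OF H u] .
  define V where "V = {w. \<rho> sH *v w = u *s w}"
  have "vec.subspace V"
    unfolding V_def vec.subspace_def
    by (simp add: matrix_vector_right_distrib vector_scalar_commute vector_add_ldistrib vec.scale_right_distrib mult.commute)
  moreover have "\<rho> g *v w \<in> V" if g: "g \<in> carrier S" and w: "w \<in> V" for g w
  proof -
    have "\<rho> sH ** \<rho> g = \<rho> g ** \<rho> sH"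
      using hom_mult[OF \<rho>, of sH g] hom_mult[OF \<rho>, of g sH] fibre_central[OF g] g by simp
    then have "\<rho> sH *v (\<rho> g *v w) = \<rho> g *v (\<rho> sH *v w)"
      by (simp add: matrix_vector_mul_assoc)
    then show ?thesis using w by (simp add: V_def vector_scalar_commute)
  qed
  moreover have "V \<noteq> {0}" using v by (auto simp: V_def eigenvector_def)
  ultimately have "V = UNIV" using irr unfolding irreducible_rep_def by blast
  then have all: "\<rho> sH *v w = u *s w" for w unfolding V_def by blast
  have "\<rho> sH = mat u"
    unfolding matrix_eq all by (simp add: vec_eq_iff forall_2 matrix_vector_mult_def sum_2 mat_def)
  moreover have "u * u = 1" using H \<open>\<rho> sH = mat u\<close> by (simp add: SL2_iff det_2 mat_def)
  then have "u = 1 \<or> u = - 1" by (simp add: square_eq_1_iff)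
  ultimately show ?thesis by (auto simp: vec_eq_iff mat_def)
qed

text \<open>A common eigenvector of \<open>\<rho> x\<close> and \<open>\<rho> y\<close> spans an invariant line, because \<open>\<rho> h\<close> is scalar and \<open>x, y, h\<close>
  generate the group.\<close>
lemma irreducible_no_common_eigenvector:
  assumes \<rho>: "\<rho> \<in> hom S SL2" and irr: "irreducible_rep S \<rho>"
  shows "\<not> (eigenvector (\<rho> sX) c v \<and> eigenvector (\<rho> sY) d v)"
proof
  assume v: "eigenvector (\<rho> sX) c v \<and> eigenvector (\<rho> sY) d v"
  then have v0: "v \<noteq> 0" by (simp add: eigenvector_def)
  interpret \<rho>: group_hom S SL2 \<rho>
    using \<rho> by (simp add: group_hom_def group_hom_axioms_def S.is_group group_SL2)
  define K where "K = {g \<in> carrier S. \<exists>c. \<rho> g *v v = c *s v}"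
  have "subgroup K S"
  proof (rule S.subgroupI)
    have "\<rho> \<one>\<^bsub>S\<^esub> *v v = 1 *s v" using \<rho>.hom_one by simp
    then show "K \<noteq> {}" unfolding K_def using S.one_closed by blast
  next
    fix g assume "g \<in> K"
    then obtain c where g: "g \<in> carrier S" and c: "\<rho> g *v v = c *s v" by (auto simp: K_def)
    have "\<rho> (inv\<^bsub>S\<^esub> g \<otimes>\<^bsub>S\<^esub> g) = mat 1" using g \<rho>.hom_one by simp
    then have "\<rho> (inv\<^bsub>S\<^esub> g) ** \<rho> g = mat 1"
      using \<rho>.hom_mult[of "inv\<^bsub>S\<^esub> g" g] g by simp
    then have "\<rho> (inv\<^bsub>S\<^esub> g) *v (\<rho> g *v v) = v"
      by (simp add: matrix_vector_mul_assoc)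
    then have *: "c *s (\<rho> (inv\<^bsub>S\<^esub> g) *v v) = v"
      by (simp add: c vector_scalar_commute)
    then have "c \<noteq> 0" using v0 by auto
    then have "\<rho> (inv\<^bsub>S\<^esub> g) *v v = inverse c *s v"
      using arg_cong[OF *, of "\<lambda>w. inverse c *s w"] by (simp add: vector_smult_assoc)
    then show "inv\<^bsub>S\<^esub> g \<in> K" using g by (auto simp: K_def)
  next
    fix g k assume "g \<in> K" "k \<in> K"
    then obtain c d where g: "g \<in> carrier S" "\<rho> g *v v = c *s v" and k: "k \<in> carrier S" "\<rho> k *v v = d *s v"
      by (auto simp: K_def)
    have "\<rho> (g \<otimes>\<^bsub>S\<^esub> k) *v v = \<rho> g *v (\<rho> k *v v)"
      using g k by (simp flip: matrix_vector_mul_assoc)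
    also have "\<dots> = (d * c) *s v" using g k by (simp add: vector_scalar_commute vector_smult_assoc)
    finally show "g \<otimes>\<^bsub>S\<^esub> k \<in> K" using g k by (auto simp: K_def)
  qed (auto simp: K_def)
  moreover have "sX \<in> K" "sY \<in> K" using v by (auto simp: K_def eigenvector_def)
  moreover have "sH \<in> K"
  proof -
    have "(- mat 1) *v v = (- 1) *s v"
      by (simp add: vec_eq_iff forall_2 matrix_vector_mult_def sum_2 mat_def)
    moreover have "mat 1 *v v = 1 *s v" by simp
    ultimately have "\<exists>c. \<rho> sH *v v = c *s v" using irreducible_fibre[OF \<rho> irr] by (metis empty_iff insertE)
    then show ?thesis by (simp add: K_def)
  qed
  ultimately have K: "K = carrier S" by (rule generated_by_XYH)
  define V where "V = range (\<lambda>c. c *s v)"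
  have "vec.subspace V"
    unfolding V_def vec.span_singleton[symmetric] by (rule vec.subspace_span)
  moreover have "\<rho> g *v w \<in> V" if "g \<in> carrier S" "w \<in> V" for g w
  proof -
    obtain c where c: "\<rho> g *v v = c *s v" using \<open>g \<in> carrier S\<close> K by (auto simp: K_def)
    obtain e where "w = e *s v" using \<open>w \<in> V\<close> by (auto simp: V_def)
    then have "\<rho> g *v w = (e * c) *s v" by (simp add: c vector_scalar_commute vector_smult_assoc)
    then show ?thesis unfolding V_def by (rule range_eqI)
  qed
  ultimately have "V = {0} \<or> V = UNIV" using irr unfolding irreducible_rep_def by blast
  moreover have "v \<in> V" unfolding V_def by (rule range_eqI[of _ _ 1]) simp
  ultimately have "V = UNIV" using v0 by auto
  then have "vector [1, 0] \<in> V" "vector [0, 1] \<in> V" by auto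
  then obtain c d where "vector [1, 0] = c *s v" "vector [0, 1] = d *s v" by (auto simp: V_def)
  then have "1 = c * v $ 1" "0 = c * v $ 2" "0 = d * v $ 1" "1 = d * v $ 2"
    by (auto simp: vec_eq_iff forall_2)
  then show False by (metis mult_eq_0_iff zero_neq_one)
qed

text \<open>For the product the relation \<open>x y z = h^b\<close> is used: \<open>x y\<close> equals \<open>z\<inverse>\<close> up to a power of the fibre.\<close>
lemma finite_projective_orders:
  assumes \<rho>: "\<rho> \<in> hom S SL2" and H: "\<rho> sH \<in> {mat 1, - mat 1}"
    and pos: "a1 > 0" "a2 > 0" "a3 > 0"
  shows "finite_projective_order (\<rho> sX)" "finite_projective_order (\<rho> sY)"
    "finite_projective_order (\<rho> sX ** \<rho> sY)"
proof -
  interpret \<rho>: group_hom S SL2 \<rho>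
    using \<rho> by (simp add: group_hom_def group_hom_axioms_def S.is_group group_SL2)
  have fin: "finite_projective_order (\<rho> g)"
    if "g \<in> carrier S" "n > 0" "g [^]\<^bsub>S\<^esub> int n = sH [^]\<^bsub>S\<^esub> (k :: int)" for g n k
  proof -
    have "\<rho> (g [^]\<^bsub>S\<^esub> int n) = \<rho> sH [^]\<^bsub>SL2\<^esub> k"
      using that by (simp add: \<rho>.hom_int_pow)
    moreover have "\<rho> (g [^]\<^bsub>S\<^esub> int n) = \<rho> g [^]\<^bsub>SL2\<^esub> n"
      using \<rho>.hom_int_pow[OF that(1), of "int n"] by (simp add: int_pow_int)
    moreover have "\<rho> sH [^]\<^bsub>SL2\<^esub> k \<in> {mat 1, - mat 1}"
      by (rule group.subgroup_int_pow_closed[OF group_SL2 pm1_subgroup H])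
    ultimately show ?thesis unfolding finite_projective_order_def using that(2) by metis
  qed
  show "finite_projective_order (\<rho> sX)" "finite_projective_order (\<rho> sY)"
    using fin[OF _ pos(1) relations(1)] fin[OF _ pos(2) relations(2)] by simp_all
  let ?xy = "sX \<otimes>\<^bsub>S\<^esub> sY"
  have "?xy = sH [^]\<^bsub>S\<^esub> b \<otimes>\<^bsub>S\<^esub> inv\<^bsub>S\<^esub> sZ"
    using relations(4) by (simp add: S.inv_solve_right)
  moreover have "sH [^]\<^bsub>S\<^esub> b \<otimes>\<^bsub>S\<^esub> inv\<^bsub>S\<^esub> sZ = inv\<^bsub>S\<^esub> sZ \<otimes>\<^bsub>S\<^esub> sH [^]\<^bsub>S\<^esub> b"
    by (intro S.int_pow_commutes fibre_central) auto
  ultimately have "?xy [^]\<^bsub>S\<^esub> int a3 = (sH [^]\<^bsub>S\<^esub> b) [^]\<^bsub>S\<^esub> int a3 \<otimes>\<^bsub>S\<^esub> (inv\<^bsub>S\<^esub> sZ) [^]\<^bsub>S\<^esub> int a3"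
    using S.int_pow_mult_distrib by simp
  also have "\<dots> = sH [^]\<^bsub>S\<^esub> (b * int a3 + b3)"
    by (simp add: S.int_pow_pow S.int_pow_inv relations(3) S.int_pow_mult S.int_pow_neg del: of_nat_mult)
  finally have "finite_projective_order (\<rho> ?xy)"
    by (rule fin[OF S.m_closed[OF seifert_gen_in_carrier seifert_gen_in_carrier] pos(3)])
  then show "finite_projective_order (\<rho> sX ** \<rho> sY)" by simp
qed

lemma conj_rep_subgroup:
  assumes \<rho>: "\<rho> \<in> hom S SL2" and P: "P \<in> carrier SL2" and U: "subgroup U SL2"
    and gens: "conj_rep P \<rho> sX \<in> U" "conj_rep P \<rho> sY \<in> U" "conj_rep P \<rho> sH \<in> U"
    and g: "g \<in> carrier S"
  shows "conj_rep P \<rho> g \<in> U"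
proof -
  have "conj_mat P \<in> hom SL2 SL2"
    using conj_mat_in_SL2[OF P] conj_mat_mult[OF P] by (intro homI) auto
  then have "conj_mat P \<circ> \<rho> \<in> hom S SL2" using \<rho> by (rule hom_compose[rotated])
  moreover have "conj_mat P \<circ> \<rho> = conj_rep P \<rho>" by (auto simp: conj_mat_def conj_rep_def)
  ultimately interpret c: group_hom S SL2 "conj_rep P \<rho>"
    by (simp add: group_hom_def group_hom_axioms_def S.is_group group_SL2)
  have "{g \<in> carrier S. conj_rep P \<rho> g \<in> U} = carrier S"
    by (rule generated_by_XYH[OF c.preimage_subgroup[OF U]]) (simp_all add: gens)
  then show ?thesis using g by blast
qed

text \<open>The representation is determined by the pair \<open>\<rho> x, \<rho> y\<close> up to the scalars \<open>\<plusminus>1\<close>, which belong to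
  both real forms \<open>SU(2)\<close> and \<open>SL(2;\<real>)\<close>; so the dichotomy for pairs of matrices is one for
  representations.\<close>
lemma irreducible_non_unitary_real:
  assumes \<rho>: "\<rho> \<in> hom S SL2" and irr: "irreducible_rep S \<rho>" and pos: "a1 > 0" "a2 > 0" "a3 > 0"
    and not_SU2: "\<not> (\<exists>P\<in>carrier SL2. \<forall>g\<in>carrier S. conj_rep P \<rho> g \<in> SU2)"
  obtains P \<sigma> where "P \<in> carrier SL2" "\<sigma> \<in> hom S SL2"
    "\<And>g. g \<in> carrier S \<Longrightarrow> conj_rep P \<rho> g = complex_mat (\<sigma> g)"
    "\<sigma> sH \<in> {mat 1, - mat 1}" "\<sigma> sX \<notin> {mat 1, - mat 1}"
proof -
  note H = irreducible_fibre[OF \<rho> irr]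
  note no_common = irreducible_no_common_eigenvector[OF \<rho> irr]
  have in_SL2: "\<rho> g \<in> carrier SL2" if "g \<in> carrier S" for g using \<rho> that by (rule hom_in_carrier)
  have X: "\<rho> sX \<notin> {mat 1, - mat 1}"
  proof
    assume "\<rho> sX \<in> {mat 1, - mat 1}"
    moreover obtain u where u: "u * u - trace (\<rho> sY) * u + 1 = 0" by (rule eigenvalue_exists)
    obtain v where v: "eigenvector (\<rho> sY) u v" using eigenvector_exists[OF in_SL2 u] by auto
    moreover have "(- mat 1) *v v = (- 1) *s v"
      by (simp add: vec_eq_iff forall_2 matrix_vector_mult_def sum_2 mat_def)
    ultimately have "eigenvector (\<rho> sX) 1 v \<or> eigenvector (\<rho> sX) (- 1) v"
      by (auto simp: eigenvector_def)
    then show False using no_common v by blast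
  qed
  obtain P where P: "P \<in> carrier SL2" and
    "(conj_mat P (\<rho> sX) \<in> SU2 \<and> conj_mat P (\<rho> sY) \<in> SU2) \<or>
     (conj_mat P (\<rho> sX) \<in> range complex_mat \<and> conj_mat P (\<rho> sY) \<in> range complex_mat)"
    by (rule real_or_unitary_pair[of "\<rho> sX" "\<rho> sY"])
      (use finite_projective_orders[OF \<rho> H pos] in_SL2 X no_common in auto)
  then have alt: "(conj_rep P \<rho> sX \<in> SU2 \<and> conj_rep P \<rho> sY \<in> SU2) \<or>
     (conj_rep P \<rho> sX \<in> range complex_mat \<and> conj_rep P \<rho> sY \<in> range complex_mat)"
    by (simp add: conj_mat_def conj_rep_def)
  have cH: "conj_rep P \<rho> sH = \<rho> sH"
    using conj_mat_pm1[OF P H] by (simp add: conj_mat_def conj_rep_def)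
  have pm1: "A \<in> U" if "subgroup U SL2" "- mat 1 \<in> U" "A \<in> {mat 1, - mat 1}" for A :: "complex ^ 2 ^ 2" and U
    using that subgroup.one_closed[OF that(1)] by auto
  have "- mat 1 \<in> SU2" using SU2_mat22[of "- 1" 0] by (simp add: mat22_one mat22_uminus)
  then have "conj_rep P \<rho> sH \<in> SU2" unfolding cH by (rule pm1[OF SU2_subgroup _ H])
  then have "\<not> (conj_rep P \<rho> sX \<in> SU2 \<and> conj_rep P \<rho> sY \<in> SU2)"
    using not_SU2 conj_rep_subgroup[OF \<rho> P SU2_subgroup] P by blast
  then have real: "conj_rep P \<rho> sX \<in> range complex_mat" "conj_rep P \<rho> sY \<in> range complex_mat"
    using alt by blast+
  have img: "A \<in> complex_mat ` carrier SL2" if "A \<in> range complex_mat" "A \<in> carrier SL2" for A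
    using that complex_mat_in_SL2 by auto
  have c_SL2: "conj_rep P \<rho> g \<in> carrier SL2" if "g \<in> carrier S" for g
    using conj_mat_in_SL2[OF P in_SL2[OF that]] by (simp add: conj_mat_def conj_rep_def)
  have "- mat 1 \<in> complex_mat ` carrier SL2"
  proof (rule image_eqI)
    show "- mat 1 = complex_mat (- mat 1)" by (simp add: complex_mat_uminus complex_mat_one)
    show "- mat 1 \<in> carrier (SL2 :: (real ^ 2 ^ 2) monoid)" by (simp add: SL2_iff det_2 mat_def)
  qed
  then have "conj_rep P \<rho> sH \<in> complex_mat ` carrier SL2"
    unfolding cH by (rule pm1[OF real_SL2_subgroup _ H])
  then have "\<forall>g\<in>carrier S. \<exists>A\<in>carrier SL2. conj_rep P \<rho> g = complex_mat A"
    using conj_rep_subgroup[OF \<rho> P real_SL2_subgroup img[OF real(1) c_SL2] img[OF real(2) c_SL2]]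
    by (fastforce simp: image_iff)
  then obtain \<sigma> where \<sigma>: "\<And>g. g \<in> carrier S \<Longrightarrow> \<sigma> g \<in> carrier SL2 \<and> conj_rep P \<rho> g = complex_mat (\<sigma> g)"
    by metis
  have \<sigma>_hom: "\<sigma> \<in> hom S SL2"
  proof (rule homI)
    show "\<sigma> g \<in> carrier SL2" if "g \<in> carrier S" for g using \<sigma>[OF that] by simp
    fix g k assume g: "g \<in> carrier S" and k: "k \<in> carrier S"
    have "conj_rep P \<rho> (g \<otimes>\<^bsub>S\<^esub> k) = conj_rep P \<rho> g ** conj_rep P \<rho> k"
      using conj_mat_mult[OF P, of "\<rho> g" "\<rho> k"] hom_mult[OF \<rho> g k] by (simp add: conj_mat_def conj_rep_def)
    then have "complex_mat (\<sigma> (g \<otimes>\<^bsub>S\<^esub> k)) = complex_mat (\<sigma> g ** \<sigma> k)"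
      using \<sigma>[OF g] \<sigma>[OF k] \<sigma>[of "g \<otimes>\<^bsub>S\<^esub> k"] g k by (simp add: complex_mat_mult)
    then show "\<sigma> (g \<otimes>\<^bsub>S\<^esub> k) = \<sigma> g \<otimes>\<^bsub>SL2\<^esub> \<sigma> k" by (simp add: complex_mat_inj)
  qed
  have pm1_iff: "complex_mat A \<in> {mat 1, - mat 1} \<longleftrightarrow> A \<in> {mat 1, - mat 1}" for A
    by (simp only: insert_iff empty_iff complex_mat_one[symmetric] complex_mat_uminus[symmetric] complex_mat_inj)
  have "\<sigma> sH \<in> {mat 1, - mat 1}" using H cH \<sigma>[of sH] pm1_iff[of "\<sigma> sH"] by simp
  moreover have "\<sigma> sX \<notin> {mat 1, - mat 1}"
  proof
    assume "\<sigma> sX \<in> {mat 1, - mat 1}"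
    then have "conj_mat P (\<rho> sX) \<in> {mat 1, - mat 1}"
      using \<sigma>[of sX] pm1_iff[of "\<sigma> sX"] by (simp add: conj_mat_def conj_rep_def)
    moreover have "conj_mat (matrix_inv P) (conj_mat P (\<rho> sX)) = \<rho> sX"
    proof -
      have "conj_mat (matrix_inv P) (conj_mat P (\<rho> sX)) = conj_mat (mat 1) (\<rho> sX)"
        using P by (simp add: conj_mat_comp matrix_inv_SL2)
      moreover have "matrix_inv (mat 1) = (mat 1 :: complex ^ 2 ^ 2)"
        by (rule matrix_inv_eqI) (simp_all add: SL2_iff)
      ultimately show ?thesis by (simp add: conj_mat_def)
    qed
    ultimately show False using X conj_mat_pm1[OF matrix_inv_SL2(3)[OF P]] by metis
  qed
  ultimately show ?thesis using that P \<sigma>_hom \<sigma> by blast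
qed

end

section \<open>Real representations are induced\<close>

lemma cover_over_pm1:
  assumes "g \<in> carrier PSL2R_cover" and "cover_to_SL2R g \<in> {mat 1, - mat 1}"
  obtains n :: int where "g = sh (of_int n)"
proof -
  have "cover_to_PSL2R g = {mat 1, - mat 1}"
    using cover_to_PSL2R_eq[OF oriented_lift_cover_to_SL2R[OF assms(1)]] assms(2)
    by (elim insertE) auto
  also have "\<dots> = cover_to_PSL2R (sh (of_int 0))"
    unfolding cover_to_PSL2R_sh PSL2R_def by simp
  finally obtain n :: int where "g = sh (of_int n) \<circ> sh (of_int 0)"
    using cover_to_PSL2R_fibre[OF sh_in_cover[of 0], of g] by metis
  then show ?thesis using that by simp
qed

text \<open>Integer translations die in \<open>PSL(2;\<real>)\<close>, so the images of the lifts satisfy the relations of the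
  triangle group.\<close>
lemma lifted_triangle_exists:
  assumes lift: "gx \<in> carrier PSL2R_cover" "gy \<in> carrier PSL2R_cover" "gz \<in> carrier PSL2R_cover"
    and rel: "gx [^]\<^bsub>PSL2R_cover\<^esub> int a1 = sh (of_int (- \<beta>1))"
      "gy [^]\<^bsub>PSL2R_cover\<^esub> int a2 = sh (of_int (- \<beta>2))"
      "gz [^]\<^bsub>PSL2R_cover\<^esub> int a3 = sh (of_int (- \<beta>3))"
      "gx \<circ> gy \<circ> gz = sh (of_int \<beta>)"
  obtains f where "lifted_triangle a1 a2 a3 f gx gy gz \<beta> \<beta>1 \<beta>2 \<beta>3"
proof -
  interpret C: group PSL2R_cover by (rule group_PSL2R_cover)
  interpret c: group_hom PSL2R_cover PSL2R cover_to_PSL2R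
    by (simp add: group_hom_def group_hom_axioms_def cover_to_PSL2R_hom C.is_group group_PSL2R)
  have pow: "cover_to_PSL2R g [^]\<^bsub>PSL2R\<^esub> n = \<one>\<^bsub>PSL2R\<^esub>"
    if "g \<in> carrier PSL2R_cover" "g [^]\<^bsub>PSL2R_cover\<^esub> n = sh (of_int k)" for g and n k :: int
    using c.hom_int_pow[OF that(1), of n] that(2) by (simp add: cover_to_PSL2R_sh)
  have "cover_to_PSL2R gx \<otimes>\<^bsub>PSL2R\<^esub> cover_to_PSL2R gy \<otimes>\<^bsub>PSL2R\<^esub> cover_to_PSL2R gz =
      cover_to_PSL2R (gx \<otimes>\<^bsub>PSL2R_cover\<^esub> gy \<otimes>\<^bsub>PSL2R_cover\<^esub> gz)"
    using lift by (simp only: c.hom_mult C.m_closed)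
  then have prod: "cover_to_PSL2R gx \<otimes>\<^bsub>PSL2R\<^esub> cover_to_PSL2R gy \<otimes>\<^bsub>PSL2R\<^esub> cover_to_PSL2R gz = \<one>\<^bsub>PSL2R\<^esub>"
    by (simp add: rel(4) cover_to_PSL2R_sh)
  obtain f where "f \<in> hom (triangle_group a1 a2 a3) PSL2R"
    "f (triangle_gen_class a1 a2 a3 TX) = cover_to_PSL2R gx"
    "f (triangle_gen_class a1 a2 a3 TY) = cover_to_PSL2R gy"
    "f (triangle_gen_class a1 a2 a3 TZ) = cover_to_PSL2R gz"
    using triangle_group_hom_exists[OF group_PSL2R c.hom_closed[OF lift(1)] c.hom_closed[OF lift(2)]
        c.hom_closed[OF lift(3)] pow[OF lift(1) rel(1)] pow[OF lift(2) rel(2)] pow[OF lift(3) rel(3)] prod] .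
  then have "lifted_triangle a1 a2 a3 f gx gy gz \<beta> \<beta>1 \<beta>2 \<beta>3"
    using lift rel by unfold_locales auto
  then show ?thesis by (rule that)
qed

text \<open>If the Euler number vanishes, \<open>a1\<close> divides \<open>\<beta>1\<close> by coprimality, and the lift can be translated
  so that its \<open>a1\<close>-th power becomes the identity.  The universal cover is torsion free.\<close>
lemma degree_zero_imp_central_lift:
  assumes g: "gx \<in> carrier PSL2R_cover" "gx [^]\<^bsub>PSL2R_cover\<^esub> int a1 = sh (of_int (- \<beta>1))"
    and a1: "a1 > 0" and cop: "coprime a1 a2" "coprime a1 a3"
    and deg: "seifert_degree a1 a2 a3 \<beta> \<beta>1 \<beta>2 \<beta>3 = 0"
  obtains k :: int where "gx = sh (of_int k)"
proof -
  interpret C: group PSL2R_cover by (rule group_PSL2R_cover)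
  have "int a2 * int a3 * \<beta>1 = int a1 * - (int a2 * int a3 * \<beta> + int a3 * \<beta>2 + int a2 * \<beta>3)"
    using deg by (simp add: seifert_degree_def algebra_simps)
  then have "int a1 dvd int a2 * int a3 * \<beta>1" by (metis dvd_triv_left)
  moreover have "coprime (int a1) (int a2 * int a3)" using cop by simp
  ultimately have "int a1 dvd \<beta>1" by (simp add: coprime_dvd_mult_right_iff)
  then obtain k where k: "\<beta>1 = int a1 * k" by blast
  obtain A where A: "oriented_lift gx A" using g(1) carrier_PSL2R_cover by blast
  have "(sh (of_int k) \<circ> gx) [^]\<^bsub>PSL2R_cover\<^esub> int a1 = sh (of_int (k * int a1)) \<circ> sh (of_int (- \<beta>1))"
    using C.int_pow_mult_distrib[OF _ sh_in_cover g(1), of k "int a1"] oriented_lift_comm_sh[OF A, of k]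
    by (simp add: PSL2R_cover_sh_pow g(2))
  also have "\<dots> = id" by (simp add: sh_comp k)
  finally have pow: "(sh (of_int k) \<circ> gx) [^]\<^bsub>PSL2R_cover\<^esub> a1 = id" by (simp add: int_pow_int)
  have "sh (of_int k) \<circ> gx \<in> carrier PSL2R_cover"
    using C.m_closed[OF sh_in_cover g(1), of k] by simp
  then have *: "sh (of_int k) \<circ> gx = id"
    using a1 pow by (rule PSL2R_cover_torsion_free)
  have "gx = sh (of_int (- k))"
  proof
    fix t
    show "gx t = sh (of_int (- k)) t" using fun_cong[OF *, of t] by (simp add: sh_def)
  qed
  then show ?thesis by (rule that)
qed

lemma flip_hom: "flip \<in> hom SL2 SL2"
  by (rule homI) (simp_all add: SL2_iff det_2 flip_def vec_eq_iff forall_2 matrix_matrix_mult_def sum_2)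

text \<open>In \<open>SL(2;\<complex>)\<close> conjugation by \<open>diag(1, -1)\<close> is inner: multiplication of that matrix by \<open>\<i>\<close> makes its
  determinant 1.\<close>
lemma conj_complex_mat_flip:
  "conj_mat (mat22 \<i> 0 0 (- \<i>)) (complex_mat A) = complex_mat (flip A)"
proof -
  obtain a b c d where A: "A = mat22 a b c d" by (rule mat22_cases)
  have "complex_mat (mat22 a b c d) = mat22 (of_real a) (of_real b) (of_real c) (of_real d)" for a b c d
    by (simp add: complex_mat_def vec_eq_iff forall_2)
  moreover have "flip A = mat22 a (- b) (- c) d"
    by (simp add: A flip_def vec_eq_iff forall_2)
  ultimately show ?thesis
    by (simp add: A conj_mat_mat22 mat22_mult mat22_eq_iff complex_eq_iff)
qed

text \<open>The degree of the lifts of \<open>\<sigma> x, \<sigma> y, \<sigma> z\<close> is not zero because \<open>\<sigma> x\<close> is not central, and reflection of the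
  line changes its sign.  So it is positive for \<open>\<sigma>\<close> or for its mirror image.\<close>
lemma (in seifert) real_rep_induced_up_to_flip:
  fixes \<sigma> :: "seifert_gen word set \<Rightarrow> real ^ 2 ^ 2"
  assumes pos: "a1 > 0" "a2 > 0" "a3 > 0" and cop: "coprime a1 a2" "coprime a1 a3"
    and deg: "seifert_degree a1 a2 a3 b b1 b2 b3 = 1"
    and \<sigma>: "\<sigma> \<in> hom S SL2" and H: "\<sigma> sH \<in> {mat 1, - mat 1}" and X: "\<sigma> sX \<notin> {mat 1, - mat 1}"
  obtains f where "f \<in> hom (triangle_group a1 a2 a3) PSL2R"
    "induced_rep a1 a2 a3 b b1 b2 b3 f \<sigma> \<or> induced_rep a1 a2 a3 b b1 b2 b3 f (flip \<circ> \<sigma>)"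
proof -
  interpret \<sigma>: group_hom S SL2 \<sigma>
    using \<sigma> by (simp add: group_hom_def group_hom_axioms_def S.is_group group_SL2)
  interpret C: group PSL2R_cover by (rule group_PSL2R_cover)
  interpret c: group_hom PSL2R_cover SL2 cover_to_SL2R
    by (simp add: group_hom_def group_hom_axioms_def cover_to_SL2R_hom C.is_group group_SL2)
  obtain gx where gx: "oriented_lift gx (\<sigma> sX)"
    using oriented_lift_exists[OF \<sigma>.hom_closed[OF seifert_gen_in_carrier]] .
  obtain gy where gy: "oriented_lift gy (\<sigma> sY)"
    using oriented_lift_exists[OF \<sigma>.hom_closed[OF seifert_gen_in_carrier]] .
  obtain gz where gz: "oriented_lift gz (\<sigma> sZ)"
    using oriented_lift_exists[OF \<sigma>.hom_closed[OF seifert_gen_in_carrier]] .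
  note g = gx gy gz
  have g_in: "gx \<in> carrier PSL2R_cover" "gy \<in> carrier PSL2R_cover" "gz \<in> carrier PSL2R_cover"
    using g carrier_PSL2R_cover by blast+
  have pm1: "\<sigma> sH [^]\<^bsub>SL2\<^esub> (k :: int) \<in> {mat 1, - mat 1}" for k
    by (rule group.subgroup_int_pow_closed[OF group_SL2 pm1_subgroup H])
  have power: "\<exists>\<beta>. k [^]\<^bsub>PSL2R_cover\<^esub> int n = sh (of_int (- \<beta>))"
    if k: "oriented_lift k (\<sigma> s)" and s: "s \<in> carrier S" "s [^]\<^bsub>S\<^esub> int n = sH [^]\<^bsub>S\<^esub> e" for k s n and e :: int
  proof -
    have k_in: "k \<in> carrier PSL2R_cover" using k carrier_PSL2R_cover by blast
    have "cover_to_SL2R (k [^]\<^bsub>PSL2R_cover\<^esub> int n) = \<sigma> (s [^]\<^bsub>S\<^esub> int n)"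
      using c.hom_int_pow[OF k_in] \<sigma>.hom_int_pow[OF s(1)] cover_to_SL2R_eq[OF k] by simp
    then have "cover_to_SL2R (k [^]\<^bsub>PSL2R_cover\<^esub> int n) \<in> {mat 1, - mat 1}"
      using pm1[of e] \<sigma>.hom_int_pow[of sH e] by (simp add: s(2))
    then obtain m :: int where "k [^]\<^bsub>PSL2R_cover\<^esub> int n = sh (of_int m)"
      using cover_over_pm1[OF C.int_pow_closed[OF k_in]] by metis
    then show ?thesis by (intro exI[of _ "- m"]) simp
  qed
  obtain \<beta>1 \<beta>2 \<beta>3 where \<beta>: "gx [^]\<^bsub>PSL2R_cover\<^esub> int a1 = sh (of_int (- \<beta>1))"
    "gy [^]\<^bsub>PSL2R_cover\<^esub> int a2 = sh (of_int (- \<beta>2))" "gz [^]\<^bsub>PSL2R_cover\<^esub> int a3 = sh (of_int (- \<beta>3))"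
    using power[OF g(1) _ relations(1)] power[OF g(2) _ relations(2)] power[OF g(3) _ relations(3)] by auto
  have "cover_to_SL2R (gx \<circ> gy \<circ> gz) = \<sigma> (sX \<otimes>\<^bsub>S\<^esub> sY \<otimes>\<^bsub>S\<^esub> sZ)"
    using cover_to_SL2R_eq[OF oriented_lift_comp[OF oriented_lift_comp[OF g(1,2)] g(3)]] by simp
  then have "cover_to_SL2R (gx \<circ> gy \<circ> gz) \<in> {mat 1, - mat 1}"
    using pm1[of b] \<sigma>.hom_int_pow[of sH b] by (simp add: relations(4))
  moreover have "gx \<circ> gy \<circ> gz \<in> carrier PSL2R_cover"
    using C.m_closed[OF C.m_closed[OF g_in(1,2)] g_in(3)] by simp
  ultimately obtain \<beta> :: int where \<beta>0: "gx \<circ> gy \<circ> gz = sh (of_int \<beta>)"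
    using cover_over_pm1 by metis
  let ?d = "seifert_degree a1 a2 a3 \<beta> \<beta>1 \<beta>2 \<beta>3"
  have "?d \<noteq> 0"
  proof
    assume "?d = 0"
    then obtain k :: int where "gx = sh (of_int k)"
      using degree_zero_imp_central_lift[OF g_in(1) \<beta>(1) pos(1) cop] by metis
    then have "\<sigma> sX = (if even k then mat 1 else - mat 1)"
      using oriented_lift_unique[OF g(1)] oriented_lift_sh[of k] by simp
    then show False using X by (simp split: if_splits)
  qed
  then consider "?d > 0" | "?d < 0" by linarith
  then show ?thesis
  proof cases
    case 1
    obtain f where "lifted_triangle a1 a2 a3 f gx gy gz \<beta> \<beta>1 \<beta>2 \<beta>3"
      using lifted_triangle_exists[OF g_in \<beta> \<beta>0] .
    then interpret L: lifted_triangle a1 a2 a3 f gx gy gz \<beta> \<beta>1 \<beta>2 \<beta>3 .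
    have "induced_rep a1 a2 a3 b b1 b2 b3 f \<sigma>"
      by (rule L.induced_rep_if_degree_pos[OF pos deg 1 \<sigma>])
        (simp_all only: cover_to_PSL2R_eq[OF g(1)] cover_to_PSL2R_eq[OF g(2)] cover_to_PSL2R_eq[OF g(3)] H)
    then show ?thesis using that L.f_hom by blast
  next
    case 2
    interpret m: group_hom PSL2R_cover PSL2R_cover mirror
      by (simp add: group_hom_def group_hom_axioms_def mirror_hom C.is_group)
    have mpow: "mirror k [^]\<^bsub>PSL2R_cover\<^esub> n = sh (of_int (- e))"
      if "k \<in> carrier PSL2R_cover" "k [^]\<^bsub>PSL2R_cover\<^esub> n = sh (of_int e)" for k and n e :: int
      using m.hom_int_pow[OF that(1), of n] by (simp add: that(2) mirror_sh)
    have m0: "mirror gx \<circ> mirror gy \<circ> mirror gz = sh (of_int (- \<beta>))"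
    proof -
      have "mirror gx \<circ> mirror gy \<circ> mirror gz = mirror (gx \<circ> gy \<circ> gz)"
        by (auto simp: mirror_def)
      then show ?thesis by (simp add: \<beta>0 mirror_sh)
    qed
    obtain f where "lifted_triangle a1 a2 a3 f (mirror gx) (mirror gy) (mirror gz) (- \<beta>) (- \<beta>1) (- \<beta>2) (- \<beta>3)"
      using lifted_triangle_exists[OF m.hom_closed[OF g_in(1)] m.hom_closed[OF g_in(2)] m.hom_closed[OF g_in(3)]
          mpow[OF g_in(1) \<beta>(1)] mpow[OF g_in(2) \<beta>(2)] mpow[OF g_in(3) \<beta>(3)] m0] .
    then interpret L: lifted_triangle a1 a2 a3 f "mirror gx" "mirror gy" "mirror gz" "- \<beta>" "- \<beta>1" "- \<beta>2" "- \<beta>3" .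
    have d: "seifert_degree a1 a2 a3 (- \<beta>) (- \<beta>1) (- \<beta>2) (- \<beta>3) > 0"
      using 2 by (simp add: seifert_degree_def)
    have fH: "flip (\<sigma> sH) \<in> {mat 1, - mat 1}"
      using H by (elim insertE) (auto simp: flip_def vec_eq_iff mat_def)
    have "induced_rep a1 a2 a3 b b1 b2 b3 f (flip \<circ> \<sigma>)"
      by (rule L.induced_rep_if_degree_pos[OF pos deg d hom_compose[OF \<sigma> flip_hom]])
        (simp_all only: comp_apply oriented_lift_mirror[OF g(1), THEN cover_to_PSL2R_eq]
          oriented_lift_mirror[OF g(2), THEN cover_to_PSL2R_eq] oriented_lift_mirror[OF g(3), THEN cover_to_PSL2R_eq] fH)
    then show ?thesis using that L.f_hom by blast
  qed
qed

theorem theorem1p1: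
  fixes a1 a2 a3 :: nat and b b1 b2 b3 :: int
    and \<rho> :: "seifert_gen word set \<Rightarrow> complex ^ 2 ^ 2"
  assumes "a1 > 0" and "a2 > 0" and "a3 > 0"
    and "coprime a1 a2" and "coprime a1 a3" and "coprime a2 a3"
    and "brieskorn_invariants a1 a2 a3 b b1 b2 b3"
    and "\<rho> \<in> hom (seifert_group a1 a2 a3 b b1 b2 b3) SL2"
    and "irreducible_rep (seifert_group a1 a2 a3 b b1 b2 b3) \<rho>"
    and "\<not> (\<exists>P\<in>carrier SL2. \<forall>g\<in>carrier (seifert_group a1 a2 a3 b b1 b2 b3). conj_rep P \<rho> g \<in> SU2)"
  shows "\<exists>P\<in>carrier SL2. \<exists>\<sigma>\<in>hom (seifert_group a1 a2 a3 b b1 b2 b3) SL2.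
           (\<forall>g\<in>carrier (seifert_group a1 a2 a3 b b1 b2 b3). conj_rep P \<rho> g = complex_mat (\<sigma> g)) \<and>
           (\<exists>f\<in>hom (triangle_group a1 a2 a3) PSL2R. induced_rep a1 a2 a3 b b1 b2 b3 f \<sigma>)"
proof -
  interpret seifert a1 a2 a3 b b1 b2 b3 .
  have deg: "seifert_degree a1 a2 a3 b b1 b2 b3 = 1"
    using assms(7) brieskorn_invariants_iff[OF assms(1-3)] by simp
  obtain P \<sigma> where P: "P \<in> carrier SL2" and \<sigma>: "\<sigma> \<in> hom S SL2"
    and conj: "\<And>g. g \<in> carrier S \<Longrightarrow> conj_rep P \<rho> g = complex_mat (\<sigma> g)"
    and H: "\<sigma> sH \<in> {mat 1, - mat 1}" and X: "\<sigma> sX \<notin> {mat 1, - mat 1}"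
    using irreducible_non_unitary_real[OF assms(8,9,1-3,10)] by blast
  obtain f where f: "f \<in> hom (triangle_group a1 a2 a3) PSL2R"
    and ind: "induced_rep a1 a2 a3 b b1 b2 b3 f \<sigma> \<or> induced_rep a1 a2 a3 b b1 b2 b3 f (flip \<circ> \<sigma>)"
    using real_rep_induced_up_to_flip[OF assms(1-5) deg \<sigma> H X] .
  from ind show ?thesis
  proof
    assume "induced_rep a1 a2 a3 b b1 b2 b3 f \<sigma>"
    then show ?thesis using P \<sigma> conj f by blast
  next
    assume ind: "induced_rep a1 a2 a3 b b1 b2 b3 f (flip \<circ> \<sigma>)"
    let ?D = "mat22 \<i> 0 0 (- \<i>)"
    have D: "?D \<in> carrier SL2" by (simp add: SL2_iff det_mat22)
    have "conj_rep (?D ** P) \<rho> g = complex_mat ((flip \<circ> \<sigma>) g)" if "g \<in> carrier S" for g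
    proof -
      have "conj_rep (?D ** P) \<rho> g = conj_mat ?D (conj_rep P \<rho> g)"
        using conj_mat_comp[OF P D, of "\<rho> g"] by (simp add: conj_mat_def conj_rep_def)
      then show ?thesis by (simp add: conj[OF that] conj_complex_mat_flip)
    qed
    moreover have "?D ** P \<in> carrier SL2" using P D by (simp add: SL2_iff det_mul)
    ultimately show ?thesis using hom_compose[OF \<sigma> flip_hom] f ind by blast
  qed
qed

end
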